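(* Let $(T(t))_{t\ge0}$ be a uniformly bounded $C_0$-semigroup on a Hilbert space $H$ with generator $A$ such that $i\mathbb{R}\subset\varrho(A)$. For $\xi>0$ let $Q(\xi)\in\mathcal{L}(H)$ be the (unique) self-adjoint solution of the Lyapunov equation $$\langle (A-\xi I)x_1,Q(\xi)x_2\rangle+\langle Q(\xi)x_1,(A-\xi I)x_2\rangle=-\langle x_1,x_2\rangle\qquad (x_1,x_2\in D(A)).$$ The following three assertions hold for a fixed $\alpha>0$. (a) For $\gamma\in(0,1/2)$, let $(\mathrm{L}_\gamma)$ denote the condition that $$\lim_{\xi\to0+}\xi^{1-2\gamma}\langle(-A)^{-\alpha\gamma}x,Q(\xi)(-A)^{-\alpha\gamma}x\rangle=0\qquad\text{for all }x\in H.$$ Then the following are equivalent: $\|T(t)(-A)^{-\alpha}\|=O(1/t)$ as $t\to\infty$; $(\mathrm{L}_\gamma)$ holds for some $\gamma\in(0,1/2)$; $(\mathrm{L}_\gamma)$ holds for all $\gamma\in(0,1/2)$. (b) If $\|T(t)(-A)^{-\alpha}\|=O(1/t)$ as $t\to\infty$, then $$\lim_{\xi\to0+}\frac{\langle(-A)^{-\alpha/2}x,Q(\xi)(-A)^{-\alpha/2}x\rangle}{\log(1/\xi)}=0$$ for all $x\in H$. (c) If $$\lim_{\xi\to0+}\frac{\langle(-A)^{-\alpha/2}x,Q(\xi)(-A)^{-\alpha/2}x\rangle}{\log(1/\xi)}=0$$ for all $x\in H$, then $$\|T(t)(-A)^{-\alpha}\|=O\left(\frac{\log t}{t}\right)\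qquad(t\to\infty).$$
   Context: All spaces are complex. $\langle\cdot,\cdot\rangle$ is the inner product of $H$, $\mathcal{L}(H)$ the bounded linear operators on $H$, $D(A)$ the domain and $\varrho(A)$ the resolvent set of $A$, $i\mathbb{R}=\{i\eta:\eta\in\mathbb{R}\}$. A $C_0$-semigroup is uniformly bounded if $\sup_{t\ge0}\|T(t)\|<\infty$. The unique self-adjoint solution of the Lyapunov equation is $Q(\xi)x=\int_0^\infty e^{-2\xi t}T(t)^*T(t)x\,dt$, $x\in H$. $f(t)=O(g(t))$ as $t\to\infty$ means there are $M>0$ and $t_0$ with $f(t)\le M g(t)$ for all $t\ge t_0$. When $A$ generates a uniformly bounded $C_0$-semigroup and $0\in\varrho(A)$, $-A$ is sectorial and invertible, and the fractional powers $(-A)^{a}$, $a\in\mathbb{R}$, are those of the functional calculus for sectorial operators. In particular, for $a>0$, $(-A)^{-a}$ is the bounded injective operator determined by $(-A)^{-a}=\frac{\sin \pi a}{\pi}\int_0^\infty s^{-a}(sI-A)^{-1}ds$ for $0<a<1$ and $(-A)^{-(k+a)}=((-A)^{-1})^k(-A)^{-a}$ for $k\in\mathbb{N}$, $0\le a<1$ (with $(-A)^0=I$), and $(-A)^{a}$ is its inverse. *)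

theory Defs
  imports "HOL-Analysis.Analysis" "HOL-Library.Landau_Symbols"
begin

text \<open>Complex Hilbert spaces. The inner product is linear in its first argument.\<close>

class complex_inner = real_normed_vector +
  fixes scaleC :: "complex \<Rightarrow> 'a \<Rightarrow> 'a" (infixr "*\<^sub>C" 75)
    and cinner :: "'a \<Rightarrow> 'a \<Rightarrow> complex"
  assumes scaleC_add_right: "c *\<^sub>C (x + y) = c *\<^sub>C x + c *\<^sub>C y"
    and scaleC_add_left: "(c + d) *\<^sub>C x = c *\<^sub>C x + d *\<^sub>C x"
    and scaleC_scaleC: "c *\<^sub>C (d *\<^sub>C x) = (c * d) *\<^sub>C x"
    and scaleR_scaleC: "r *\<^sub>R x = complex_of_real r *\<^sub>C x"
    and cinner_commute: "cinner x y = cnj (cinner y x)"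
    and cinner_add_left: "cinner (x + y) z = cinner x z + cinner y z"
    and cinner_scaleC_left: "cinner (c *\<^sub>C x) y = c * cinner x y"
    and cinner_self_norm: "cinner x x = complex_of_real ((norm x)\<^sup>2)"

class chilbert_space = complex_inner + complete_space

definition bounded_clinear :: "('a::complex_inner \<Rightarrow> 'a) \<Rightarrow> bool" where
  "bounded_clinear f \<longleftrightarrow> bounded_linear f \<and> (\<forall>c x. f (c *\<^sub>C x) = c *\<^sub>C f x)"

definition selfadjoint :: "('a::complex_inner \<Rightarrow> 'a) \<Rightarrow> bool" where
  "selfadjoint S \<longleftrightarrow> bounded_clinear S \<and> (\<forall>x y. cinner (S x) y = cinner x (S y))"

text \<open>A semigroup is a function on all of \<open>real\<close>; its values at negative times are irrelevant.\<close>

definition C0_semigroup :: "(real \<Rightarrow> 'a::complex_inner \<Rightarrow> 'a) \<Rightarrow> bool" where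
  "C0_semigroup T \<longleftrightarrow>
     (\<forall>t\<ge>0. bounded_clinear (T t)) \<and>
     T 0 = id \<and>
     (\<forall>s\<ge>0. \<forall>t\<ge>0. T (s + t) = T s \<circ> T t) \<and>
     (\<forall>x. ((\<lambda>t. T t x) \<longlongrightarrow> x) (at_right 0))"

definition uniformly_bounded :: "(real \<Rightarrow> 'a::complex_inner \<Rightarrow> 'a) \<Rightarrow> bool" where
  "uniformly_bounded T \<longleftrightarrow> bdd_above ((\<lambda>t. onorm (T t)) ` {0..})"

text \<open>An unbounded operator is given by its domain \<open>D\<close> and a total function \<open>A\<close> of which
  only the values on \<open>D\<close> matter.\<close>

definition is_generator ::
    "(real \<Rightarrow> 'a::complex_inner \<Rightarrow> 'a) \<Rightarrow> 'a set \<Rightarrow> ('a \<Rightarrow> 'a) \<Rightarrow> bool" where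
  "is_generator T D A \<longleftrightarrow>
     D = {x. \<exists>y. ((\<lambda>t. (T t x - x) /\<^sub>R t) \<longlongrightarrow> y) (at_right 0)} \<and>
     (\<forall>x\<in>D. ((\<lambda>t. (T t x - x) /\<^sub>R t) \<longlongrightarrow> A x) (at_right 0))"

definition resolvent :: "'a::complex_inner set \<Rightarrow> ('a \<Rightarrow> 'a) \<Rightarrow> complex \<Rightarrow> 'a \<Rightarrow> 'a" where
  "resolvent D A z = inv_into D (\<lambda>x. z *\<^sub>C x - A x)"

definition resolvent_set :: "'a::complex_inner set \<Rightarrow> ('a \<Rightarrow> 'a) \<Rightarrow> complex set" where
  "resolvent_set D A =
     {z. bij_betw (\<lambda>x. z *\<^sub>C x - A x) D UNIV \<and> bounded_clinear (resolvent D A z)}"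

text \<open>\<open>neg_power D A b\<close> is \<open>(-A)\<close> to the power \<open>-b\<close>, for \<open>b \<ge> 0\<close>; \<open>resolvent D A 0\<close> is the
  inverse of \<open>-A\<close>. The integral is taken pointwise and in the Henstock-Kurzweil sense, because
  the library's Bochner integral requires a separable range space; it agrees with the absolutely
  convergent operator-norm integral.\<close>

definition neg_power_frac ::
    "'a::complex_inner set \<Rightarrow> ('a \<Rightarrow> 'a) \<Rightarrow> real \<Rightarrow> 'a \<Rightarrow> 'a" where
  "neg_power_frac D A a x =
     (if a = 0 then x
      else (sin (pi * a) / pi) *\<^sub>R
             integral {0<..} (\<lambda>s. (s powr (- a)) *\<^sub>R resolvent D A (complex_of_real s) x))"

definition neg_power ::
    "'a::complex_inner set \<Rightarrow> ('a \<Rightarrow> 'a) \<Rightarrow> real \<Rightarrow> 'a \<Rightarrow> 'a" where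
  "neg_power D A b = (resolvent D A 0 ^^ nat \<lfloor>b\<rfloor>) \<circ> neg_power_frac D A (frac b)"

definition lyapunov_solution ::
    "'a::complex_inner set \<Rightarrow> ('a \<Rightarrow> 'a) \<Rightarrow> real \<Rightarrow> ('a \<Rightarrow> 'a) \<Rightarrow> bool" where
  "lyapunov_solution D A \<xi> Q \<longleftrightarrow>
     (\<forall>x1\<in>D. \<forall>x2\<in>D. cinner (A x1 - \<xi> *\<^sub>R x1) (Q x2) + cinner (Q x1) (A x2 - \<xi> *\<^sub>R x2)
        = - cinner x1 x2)"

definition lyapunov_decay ::
    "'a::complex_inner set \<Rightarrow> ('a \<Rightarrow> 'a) \<Rightarrow> (real \<Rightarrow> 'a \<Rightarrow> 'a) \<Rightarrow> real \<Rightarrow> real \<Rightarrow> bool" where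
  "lyapunov_decay D A Q \<alpha> \<gamma> \<longleftrightarrow>
     (\<forall>x. ((\<lambda>\<xi>. complex_of_real (\<xi> powr (1 - 2 * \<gamma>)) *
             cinner (neg_power D A (\<alpha> * \<gamma>) x) (Q \<xi> (neg_power D A (\<alpha> * \<gamma>) x)))
           \<longlongrightarrow> 0) (at_right 0))"

definition lyapunov_log_decay ::
    "'a::complex_inner set \<Rightarrow> ('a \<Rightarrow> 'a) \<Rightarrow> (real \<Rightarrow> 'a \<Rightarrow> 'a) \<Rightarrow> real \<Rightarrow> bool" where
  "lyapunov_log_decay D A Q \<alpha> \<longleftrightarrow>
     (\<forall>x. ((\<lambda>\<xi>. cinner (neg_power D A (\<alpha> / 2) x) (Q \<xi> (neg_power D A (\<alpha> / 2) x))
               / complex_of_real (ln (1 / \<xi>)))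
           \<longlongrightarrow> 0) (at_right 0))"

end

theory Submission
  imports Defs "HOL-Real_Asymp.Real_Asymp"
begin

text \<open>
  The Lyapunov form \<open>q \<xi> x = \<langle>x, Q(\<xi>) x\<rangle>\<close> is the weighted energy of the orbit of \<open>x\<close>, the integral of
  \<open>exp (- 2 \<xi> t) \<parallel>T(t) x\<parallel>\<^sup>2\<close> over \<open>t \<ge> 0\<close>. Boundedness of the semigroup gives
  \<open>t \<parallel>T(t) x\<parallel>\<^sup>2 \<le> C q (1/t) x\<close>, so a bound on \<open>q\<close> along the range of a negative power of \<open>-A\<close> becomes,
  by uniform boundedness, an operator norm rate for \<open>T(t)\<close> on that power. Conversely a rate
  \<open>t powr (-p)\<close> improves to \<open>o(t powr (-p))\<close> on each vector by density of the domain, and is inserted into the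
  energy integral. Rates for different powers are related by the law of exponents and
  the moment inequality: \<open>t powr (-1)\<close> for the power \<open>-\<alpha>\<close> is equivalent to \<open>t powr (-\<gamma>)\<close> for the power
  \<open>-\<alpha> \<gamma>\<close>, while at \<open>\<gamma> = 1/2\<close> squaring the rate \<open>sqrt (ln t / t)\<close> yields \<open>ln t / t\<close>.
\<close>

section \<open>Integration over the half-line\<close>

text \<open>The law of exponents is the obstacle: \<open>neg_power\<close> is assembled from a floor
  and a fractional part, and additivity cannot be read off from that. Passing to
  \<open>e - A\<close> with \<open>e > 0\<close> adds exponential damping; negative powers become
  weighted orbit integrals, additivity becomes a convolution, and a change of exponent becomes a
  scalar Fubini argument after pairing with bounded real functionals. The constants in the
  comparison with \<open>neg_power\<close> and in the moment inequality do not depend on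
  \<open>e\<close>, so \<open>e\<close> can tend to \<open>0\<close>. The threshold
  \<open>1/2\<close> comes from the energy: the square of the rate
  \<open>t powr (- \<gamma>)\<close> has a damped integral of order
  \<open>\<xi> powr (2 * \<gamma> - 1)\<close> for \<open>\<gamma> < 1/2\<close>, but of order
  \<open>ln (1 / \<xi>)\<close> at \<open>\<gamma> = 1/2\<close>. A vanishing limit is used only as
  eventual boundedness on each vector, and vanishing is regained in the converse direction; this is
  why one \<gamma> yields all.\<close>

text \<open>The range is not assumed separable, so Bochner integrals are unavailable; the singularity at \<open>0\<close>
  is handled by extending the primitive continuously to \<open>0\<close>.\<close>

lemma integrable_on_Ioi_dominated:
  fixes f :: "real \<Rightarrow> 'a::banach"
  assumes contf: "continuous_on {0<..} f"
    and normf: "\<And>t. t > 0 \<Longrightarrow> norm (f t) \<le> g t"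
    and g: "g integrable_on {0<..}"
  shows "f integrable_on {0<..}"
proof (rule integrable_on_all_intervals_integrable_bound[OF _ _ g])
  show "norm (f t) \<le> g t" if "t \<in> {0<..}" for t
    using normf that by simp
next
  fix a b :: real
  define f0 where "f0 = (\<lambda>x. if x \<in> {0<..} then f x else 0)"
  show "(\<lambda>x. if x \<in> {0<..} then f x else 0) integrable_on cbox a b"
  proof (cases "b > 0")
    case False
    have "(\<lambda>x. 0) integrable_on cbox a b"
      by (rule integrable_0)
    then show ?thesis
      by (rule integrable_eq) (use False in auto)
  next
    case b: True
    define g0 where "g0 = (\<lambda>x. if x \<in> {0<..} then g x else 0)"
    have g0: "g0 integrable_on {c..d}" for c d
      using integrable_altD(1)[OF g, of c d] by (simp add: g0_def)
    have contf': "continuous_on {c..d} f" if "c > 0" for c d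
      using contf by (rule continuous_on_subset) (use that in auto)
    have intf: "f integrable_on {c..d}" if "c > 0" for c d
      using contf'[OF that] by (rule integrable_continuous_real)
    define \<Gamma> where "\<Gamma> = (\<lambda>c. integral {0..c} g0)"
    define F where "F = (\<lambda>c. integral {c..b} f)"
    \<comment> \<open>The modulus of continuity of the truncated integral \<open>F\<close> is that
      of the scalar primitive \<open>\<Gamma>\<close>; hence \<open>F\<close> extends continuously
      to \<open>0\<close> although \<open>f\<close> may blow up there.\<close>
    have F_diff: "norm (F c - F d) \<le> \<bar>\<Gamma> c - \<Gamma> d\<bar>" if "0 < c" "c \<le> d" "d \<le> b" for c d
    proof -
      have "F c = integral {c..d} f + F d"
        unfolding F_def using that
        by (intro Henstock_Kurzweil_Integration.integral_combine[symmetric] intf) auto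
      then have "norm (F c - F d) = norm (integral {c..d} f)"
        by simp
      also have "\<dots> \<le> integral {c..d} g0"
        by (rule integral_norm_bound_integral[OF intf g0]) (use that normf in \<open>auto simp: g0_def\<close>)
      also have "\<dots> = \<Gamma> d - \<Gamma> c"
        using Henstock_Kurzweil_Integration.integral_combine[OF _ _ g0, of 0 c d] that
        by (simp add: \<Gamma>_def)
      finally show ?thesis by simp
    qed
    have "uniformly_continuous_on {0..b} \<Gamma>"
      unfolding \<Gamma>_def by (intro compact_uniformly_continuous indefinite_integral_continuous_1 g0) auto
    then have "uniformly_continuous_on {0<..b} \<Gamma>"
      unfolding uniformly_continuous_on_def by fastforce
    moreover have "dist (F c) (F d) \<le> dist (\<Gamma> c) (\<Gamma> d)" if "c \<in> {0<..b}" "d \<in> {0<..b}" for c d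
      using F_diff[of c d] F_diff[of d c] that
      by (cases "c \<le> d") (auto simp: dist_norm norm_minus_commute)
    ultimately have "uniformly_continuous_on {0<..b} F"
      unfolding uniformly_continuous_on_def by (meson order.strict_trans1)
    then obtain H where H: "uniformly_continuous_on (closure {0<..b}) H"
        and HF: "\<And>x. x \<in> {0<..b} \<Longrightarrow> F x = H x"
      by (rule uniformly_continuous_on_extension_on_closure) blast
    have contH: "continuous_on {0..b} H"
      using uniformly_continuous_imp_continuous[OF H] b by simp
    have derH: "((\<lambda>x. - H x) has_vector_derivative f x) (at x)" if x: "x \<in> {0<..<b}" for x
    proof -
      define c where "c = x / 2"
      have c: "0 < c" "c < x"
        using x by (auto simp: c_def)
      have "((\<lambda>u. integral {c..u} f) has_vector_derivative f x) (at x within {c..b})"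
        by (rule integral_has_vector_derivative[OF contf']) (use c x in auto)
      then have "((\<lambda>u. integral {c..u} f) has_vector_derivative f x) (at x)"
        using at_within_Icc_at[of c x b] c x by simp
      then have "((\<lambda>u. integral {c..u} f - F c) has_vector_derivative f x - 0) (at x)"
        by (intro derivative_intros)
      then have "((\<lambda>u. integral {c..u} f - F c) has_vector_derivative f x) (at x)"
        by simp
      then show ?thesis
      proof (rule has_vector_derivative_transform_within_open[where S="{c<..<b}"])
        fix u assume u: "u \<in> {c<..<b}"
        have "F c = integral {c..u} f + F u"
          unfolding F_def using u c
          by (intro Henstock_Kurzweil_Integration.integral_combine[symmetric] intf) auto
        then show "integral {c..u} f - F c = - H u"
          using HF[of u] u c by simp
      qed (use c x in auto)
    qed
    \<comment> \<open>\<open>H 0\<close> is the value of the improper integral. A derivative is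
      required only on the open interval, so at the singular endpoint continuity of \<open>H\<close>
      suffices.\<close>
    have "(f has_integral (- H b - (- H 0))) {0..b}"
      by (rule fundamental_theorem_of_calculus_interior)
         (use b derH contH in \<open>auto intro!: continuous_intros\<close>)
    then have "f integrable_on {0..b}"
      by blast
    then have "f0 integrable_on {0..b}"
      by (rule integrable_spike[of _ _ "{0}"]) (auto simp: f0_def)
    moreover have "f0 integrable_on {min a 0..0}"
      using integrable_0 by (rule integrable_eq) (auto simp: f0_def)
    ultimately have "f0 integrable_on {min a 0..b}"
      using b by (intro Henstock_Kurzweil_Integration.integrable_combine[of "min a 0" 0 b]) auto
    then have "f0 integrable_on cbox a b"
      unfolding cbox_interval by (rule integrable_on_subinterval) auto
    then show ?thesis
      by (simp add: f0_def)
  qed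
qed

text \<open>A power integrable at \<open>0\<close> and one integrable at infinity meet at
  \<open>\<tau>\<close>. Keeping \<open>\<tau>\<close> free is the point: it becomes the resolvent
  parameter in \<open>norm_V_G_le\<close> and the balancing parameter in
  \<open>moment_inequality_G\<close>.\<close>

lemma split_power_bound:
  fixes f :: "real \<Rightarrow> 'a::banach"
  assumes contf: "continuous_on {0<..} f"
    and pos: "p > 0" "q > 0" "\<tau> > 0"
    and small: "\<And>s. 0 < s \<Longrightarrow> s \<le> \<tau> \<Longrightarrow> norm (f s) \<le> M * s powr (p - 1)"
    and large: "\<And>s. s \<ge> \<tau> \<Longrightarrow> norm (f s) \<le> N * s powr (- q - 1)"
  shows "f integrable_on {0<..}"
    and "norm (integral {0<..} f) \<le> M * (\<tau> powr p / p) + N * (\<tau> powr (- q) / q)"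
proof -
  define g where "g = (\<lambda>s. if s \<le> \<tau> then M * s powr (p - 1) else N * s powr (- q - 1))"
  have "((\<lambda>s. M * s powr (p - 1)) has_integral M * (\<tau> powr p / p)) {0..\<tau>}"
    using has_integral_powr_from_0[of "p - 1" \<tau>] pos by (intro has_integral_mult_right) auto
  then have "((\<lambda>s. M * s powr (p - 1)) has_integral M * (\<tau> powr p / p)) {0<..\<tau>}"
    by (subst (asm) has_integral_spike_set_eq[where T="{0<..\<tau>}"])
       (rule negligible_subset[of "{0}"]; force)+
  then have 1: "(g has_integral M * (\<tau> powr p / p)) {0<..\<tau>}"
    by (rule has_integral_eq[rotated]) (auto simp: g_def)
  have "((\<lambda>s. N * s powr (- q - 1)) has_integral N * (\<tau> powr (- q) / q)) {\<tau>..}"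
    using has_integral_powr_to_inf[of "- q - 1" \<tau>] pos by (intro has_integral_mult_right) auto
  then have 2: "(g has_integral N * (\<tau> powr (- q) / q)) {\<tau>..}"
    by (rule has_integral_spike[of "{\<tau>}", rotated 2]) (auto simp: g_def)
  have "{0<..\<tau>} \<inter> {\<tau>..} = {\<tau>}" "{0<..\<tau>} \<union> {\<tau>..} = {0<..}"
    using pos by auto
  with has_integral_Un[OF 1 2]
  have g: "(g has_integral (M * (\<tau> powr p / p) + N * (\<tau> powr (- q) / q))) {0<..}"
    by simp
  have fg: "norm (f t) \<le> g t" if "t > 0" for t
    using that small large by (auto simp: g_def)
  show int: "f integrable_on {0<..}"
    using integrable_on_Ioi_dominated[OF contf fg] g by blast
  show "norm (integral {0<..} f) \<le> M * (\<tau> powr p / p) + N * (\<tau> powr (- q) / q)"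
    using integral_norm_bound_integral[OF int has_integral_integrable[OF g]] fg g
    by (simp add: integral_unique)
qed

text \<open>The gauge integral over an unbounded set is approximated by every sufficiently large
  box, so the boxes \<open>cbox (- N) N\<close> alone identify its value.\<close>

lemma integral_Ioi_eq_limit:
  fixes f :: "real \<Rightarrow> 'a::banach"
  assumes f: "f integrable_on {0<..}"
    and F: "\<And>N. N > 0 \<Longrightarrow> (f has_integral F N) {0..N}"
    and l: "(F \<longlongrightarrow> l) at_top"
  shows "integral {0<..} f = l"
proof -
  let ?f = "\<lambda>x. if x \<in> {0<..} then f x else 0"
  have int_eq: "integral (cbox (- N) N) ?f = F N" if N: "N > 0" for N
  proof -
    have "(f has_integral F N) {0<..N}"
      using F[OF N]
      by (subst (asm) has_integral_spike_set_eq[where T="{0<..N}"])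
         (rule negligible_subset[of "{0}"]; force)+
    then have "((\<lambda>x. if x \<in> {0<..N} then f x else 0) has_integral F N) {- N..N}"
      by (subst has_integral_restrict) (use N in auto)
    then have "(?f has_integral F N) {- N..N}"
      by (rule has_integral_eq[rotated]) auto
    then show ?thesis
      by (simp add: integral_unique)
  qed
  have "(F \<longlongrightarrow> integral {0<..} f) at_top"
    unfolding tendsto_iff
  proof (intro allI impI)
    fix e :: real assume "e > 0"
    with integrable_integral[OF f, unfolded has_integral_alt'] obtain B where B: "B > 0"
        "\<And>a b. ball 0 B \<subseteq> cbox a b \<Longrightarrow> norm (integral (cbox a b) ?f - integral {0<..} f) < e"
      by blast
    have "dist (F N) (integral {0<..} f) < e" if N: "N \<ge> B" for N
    proof -
      have "ball 0 B \<subseteq> cbox (- N) N"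
        using N by (auto simp: dist_real_def)
      from B(2)[OF this] show ?thesis
        using int_eq[of N] N B(1) by (simp add: dist_norm)
    qed
    then show "\<forall>\<^sub>F N in at_top. dist (F N) (integral {0<..} f) < e"
      unfolding eventually_at_top_linorder by blast
  qed
  with l show ?thesis
    by (metis tendsto_unique trivial_limit_at_top_linorder)
qed

text \<open>Bridge to the Lebesgue integral: an orbit paired with a real functional is scalar and
  absolutely integrable against the kernels below, so Fubini becomes available.\<close>

lemma integral_Ioi_eq_lborel:
  fixes f :: "real \<Rightarrow> real"
  assumes contf: "continuous_on {0<..} f"
    and normf: "\<And>t. t > 0 \<Longrightarrow> \<bar>f t\<bar> \<le> g t"
    and g: "g integrable_on {0<..}"
  shows "integral {0<..} f = (LINT t|lborel. indicator {0<..} t * f t)"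
proof -
  have f: "f integrable_on {0<..}"
    by (rule integrable_on_Ioi_dominated[OF contf _ g]) (use normf in auto)
  have "f absolutely_integrable_on {0<..}"
    by (rule absolutely_integrable_integrable_bound[OF _ f g]) (use normf in auto)
  then have "integrable lebesgue (\<lambda>t. indicator {0<..} t *\<^sub>R f t)"
    by (simp add: set_integrable_def)
  moreover have "(\<lambda>t. indicator {0<..} t *\<^sub>R f t) \<in> borel_measurable borel"
    by (rule borel_measurable_continuous_on_indicator[OF _ contf]) simp
  ultimately have "set_integrable lborel {0<..} f"
    by (simp add: set_integrable_def integrable_completion)
  from set_borel_integral_eq_integral(2)[OF this] show ?thesis
    by (simp add: set_lebesgue_integral_def)
qed

section \<open>Gamma kernels: mass, convolution and Fubini\<close>

text \<open>The unnormalised gamma density of shape \<open>b\<close> and rate \<open>s\<close>,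
  extended by zero so that shifts and convolutions take place on the whole line.\<close>

definition gamma_kernel :: "real \<Rightarrow> real \<Rightarrow> real \<Rightarrow> real" where
  "gamma_kernel s b t = indicator {0<..} t * (t powr (b - 1) * exp (- (s * t)))"

lemma gamma_kernel_nonneg [simp]: "gamma_kernel s b t \<ge> 0"
  by (simp add: gamma_kernel_def)

lemma gamma_kernel_measurable [measurable]: "gamma_kernel s b \<in> borel_measurable borel"
  unfolding gamma_kernel_def by measurable

lemma nn_integral_gamma_kernel:
  fixes s b :: real
  assumes "s > 0" "b > 0"
  shows "(\<integral>\<^sup>+t. ennreal (gamma_kernel s b t) \<partial>lborel) = ennreal (Gamma b / s powr b)"
proof -
  let ?f = "\<lambda>t. ennreal (indicator {0..} t * t powr (b - 1) / exp t)"
  have "ennreal (Gamma b) = (\<integral>\<^sup>+t. ?f t \<partial>lborel)"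
    by (rule Gamma_conv_nn_integral_real) fact
  also have "\<dots> = ennreal s * (\<integral>\<^sup>+t. ?f (s * t) \<partial>lborel)"
    using assms nn_integral_real_affine[of ?f s 0] by simp
  also have "(\<integral>\<^sup>+t. ?f (s * t) \<partial>lborel)
      = (\<integral>\<^sup>+t. ennreal (s powr (b - 1)) * ennreal (gamma_kernel s b t) \<partial>lborel)"
    using assms
    by (intro nn_integral_cong)
       (auto simp: gamma_kernel_def indicator_def powr_mult exp_minus field_simps zero_le_mult_iff
             simp flip: ennreal_mult)
  also have "\<dots> = ennreal (s powr (b - 1)) * (\<integral>\<^sup>+t. ennreal (gamma_kernel s b t) \<partial>lborel)"
    by (rule nn_integral_cmult) simp
  finally have *: "ennreal (Gamma b)
      = ennreal (s powr b) * (\<integral>\<^sup>+t. ennreal (gamma_kernel s b t) \<partial>lborel)"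
    using assms by (simp add: powr_diff field_simps flip: ennreal_mult mult.assoc)
  have **: "ennreal (1 / s powr b) * ennreal (s powr b) = 1"
    using assms by (simp flip: ennreal_mult)
  have "ennreal (Gamma b / s powr b) = ennreal (1 / s powr b) * ennreal (Gamma b)"
    using assms by (simp flip: ennreal_mult)
  also have "\<dots> = (\<integral>\<^sup>+t. ennreal (gamma_kernel s b t) \<partial>lborel)"
    unfolding * mult.assoc[symmetric] ** by simp
  finally show ?thesis ..
qed

lemma integrable_gamma_kernel:
  fixes s b :: real
  assumes "s > 0" "b > 0"
  shows "integrable lborel (gamma_kernel s b)"
  by (rule integrableI_nonneg) (use assms in \<open>auto simp: nn_integral_gamma_kernel\<close>)

lemma has_integral_gamma:
  fixes s b :: real
  assumes "s > 0" "b > 0"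
  shows "((\<lambda>t. t powr (b - 1) * exp (- (s * t))) has_integral Gamma b / s powr b) {0<..}"
proof -
  have "integral\<^sup>L lborel (gamma_kernel s b) = Gamma b / s powr b"
    by (rule integral_eq_nn_integral[THEN trans])
       (use assms nn_integral_gamma_kernel[OF assms] in auto)
  then have "(gamma_kernel s b has_integral Gamma b / s powr b) UNIV"
    using has_integral_integral_lborel[OF integrable_gamma_kernel[OF assms]] by simp
  also have "gamma_kernel s b = (\<lambda>t. if t \<in> {0<..} then t powr (b - 1) * exp (- (s * t)) else 0)"
    by (auto simp: gamma_kernel_def)
  finally show ?thesis
    by (simp only: has_integral_restrict_UNIV)
qed

lemma has_integral_powr_exp_scale:
  fixes s b C :: real
  assumes "s > 0" "b > 0"
  shows "((\<lambda>t. C * (t powr (b - 1) * exp (- (s * t)))) has_integral C * (Gamma b / s powr b)) {0<..}"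
  by (intro has_integral_mult_right has_integral_gamma assms)

text \<open>Source of the constant \<open>sin (pi * a) / pi\<close> in
  \<open>neg_power_frac\<close>. At integers both sides are \<open>0\<close> by the conventions for
  division and for the poles of \<open>Gamma\<close>.\<close>

lemma Gamma_reflection_real:
  fixes a :: real
  shows "Gamma a * Gamma (1 - a) = pi / sin (pi * a)"
proof -
  have "complex_of_real (Gamma a * Gamma (1 - a)) = complex_of_real (pi / sin (pi * a))"
    using Gamma_reflection_complex[of "of_real a"]
    by (simp flip: sin_of_real Gamma_complex_of_real)
  then show ?thesis
    by (simp only: of_real_eq_iff)
qed

text \<open>Gamma densities of equal rate are closed under convolution: the exponentials multiply to
  \<open>exp (- (s * u))\<close>, which is free of \<open>t\<close>, and the powers form a Beta
  integral.\<close>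

lemma nn_integral_gamma_kernel_convolution:
  fixes s :: real
  assumes "b > 0" "c > 0"
  shows "(\<integral>\<^sup>+t. ennreal (gamma_kernel s b t * gamma_kernel s c (u - t)) \<partial>lborel)
    = ennreal (Beta b c * gamma_kernel s (b + c) u)"
proof (cases "u > 0")
  case False
  then have *: "gamma_kernel s b t * gamma_kernel s c (u - t) = 0" for t
    by (auto simp: gamma_kernel_def indicator_def)
  have "gamma_kernel s (b + c) u = 0"
    using False by (simp add: gamma_kernel_def)
  then show ?thesis
    unfolding * by simp
next
  case u: True
  let ?f = "\<lambda>t. ennreal (gamma_kernel s b t * gamma_kernel s c (u - t))"
  have Beta_nn: "(\<integral>\<^sup>+v. ennreal (indicator {0<..<1} v * (v powr (b - 1) * (1 - v) powr (c - 1))) \<partial>lborel)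
      = ennreal (Beta b c)"
    using nn_integral_has_integral_lebesgue[of "{0<..<1}"
        "\<lambda>v. v powr (b - 1) * (1 - v) powr (c - 1)" "Beta b c"] has_integral_Beta_real[OF assms]
    by (simp add: has_integral_Icc_iff_Ioo)
  \<comment> \<open>Substituting \<open>t = u * v\<close> moves the support \<open>0 < t < u\<close>
    to the unit interval and separates the dependence on \<open>u\<close>.\<close>
  have "(\<integral>\<^sup>+t. ?f t \<partial>lborel) = ennreal u * (\<integral>\<^sup>+v. ?f (u * v) \<partial>lborel)"
    using u nn_integral_real_affine[of ?f u 0] by simp
  also have "(\<integral>\<^sup>+v. ?f (u * v) \<partial>lborel)
      = (\<integral>\<^sup>+v. ennreal (u powr (b + c - 2) * exp (- (s * u)))
           * ennreal (indicator {0<..<1} v * (v powr (b - 1) * (1 - v) powr (c - 1))) \<partial>lborel)"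
  proof (intro nn_integral_cong)
    fix v :: real
    show "?f (u * v) = ennreal (u powr (b + c - 2) * exp (- (s * u)))
        * ennreal (indicator {0<..<1} v * (v powr (b - 1) * (1 - v) powr (c - 1)))"
    proof (cases "v \<in> {0<..<1}")
      case False
      then have "gamma_kernel s b (u * v) * gamma_kernel s c (u - u * v) = 0"
        using u by (auto simp: gamma_kernel_def zero_less_mult_iff)
      with False show ?thesis by simp
    next
      case True
      have 1: "u - u * v = u * (1 - v)" by (simp add: algebra_simps)
      have 2: "exp (- (s * (u * v))) * exp (- (s * (u * (1 - v)))) = exp (- (s * u))"
        by (simp flip: exp_add add: algebra_simps)
      have 3: "u powr (b - 1) * u powr (c - 1) = u powr (b + c - 2)"
        by (simp flip: powr_add)
      have "gamma_kernel s b (u * v) * gamma_kernel s c (u - u * v)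
          = (u powr (b - 1) * u powr (c - 1))
            * (exp (- (s * (u * v))) * exp (- (s * (u * (1 - v)))))
            * (v powr (b - 1) * (1 - v) powr (c - 1))"
        unfolding 1 gamma_kernel_def using True u by (simp add: powr_mult)
      then show ?thesis
        unfolding 2 3 using True by (simp flip: ennreal_mult)
    qed
  qed
  also have "\<dots> = ennreal (u powr (b + c - 2) * exp (- (s * u))) * ennreal (Beta b c)"
    by (subst nn_integral_cmult) (simp_all add: Beta_nn)
  also have "ennreal u * \<dots> = ennreal (Beta b c * gamma_kernel s (b + c) u)"
  proof -
    have "Beta b c \<ge> 0"
      using assms by (simp add: Beta_def)
    moreover have "u * u powr (b + c - 2) = u powr (b + c - 1)"
      using u powr_add[of u 1 "b + c - 2"] by simp
    ultimately show ?thesis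
      using u by (simp add: gamma_kernel_def ac_simps flip: ennreal_mult)
  qed
  finally show ?thesis .
qed

text \<open>Tonelli gives joint integrability, because \<open>\<phi>\<close> is bounded and the mass
  of \<open>h\<close> in \<open>t\<close> is the integrable function \<open>H\<close>. Both the
  convolution kernel of \<open>G_add\<close> and the Laplace kernel of
  \<open>G_subordination\<close> have this shape.\<close>

lemma lborel_Fubini_bounded:
  fixes h :: "real \<Rightarrow> real \<Rightarrow> real"
  assumes h [measurable]: "case_prod h \<in> borel_measurable (lborel \<Otimes>\<^sub>M lborel)"
    and h_nonneg: "\<And>t u. h t u \<ge> 0"
    and H: "\<And>u. (\<integral>\<^sup>+t. ennreal (h t u) \<partial>lborel) = ennreal (H u)"
    and H_nonneg: "\<And>u. H u \<ge> 0"
    and intH: "integrable lborel H"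
    and \<phi> [measurable]: "\<phi> \<in> borel_measurable borel"
    and bound: "\<And>u. \<bar>\<phi> u\<bar> \<le> M"
  shows "(LINT t|lborel. (LINT u|lborel. h t u * \<phi> u)) = (LINT u|lborel. H u * \<phi> u)"
proof -
  have M: "M \<ge> 0"
    using bound[of 0] by linarith
  have "integrable (lborel \<Otimes>\<^sub>M lborel) (\<lambda>(t, u). h t u * \<phi> u)"
  proof (rule integrableI_bounded)
    have "(\<integral>\<^sup>+z. ennreal (norm (case z of (t, u) \<Rightarrow> h t u * \<phi> u)) \<partial>(lborel \<Otimes>\<^sub>M lborel))
        = (\<integral>\<^sup>+u. \<integral>\<^sup>+t. ennreal (norm (h t u * \<phi> u)) \<partial>lborel \<partial>lborel)"
      by (subst lborel_pair.nn_integral_snd[symmetric]) auto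
    also have "\<dots> \<le> (\<integral>\<^sup>+u. \<integral>\<^sup>+t. ennreal M * ennreal (h t u) \<partial>lborel \<partial>lborel)"
    proof (intro nn_integral_mono)
      fix u t
      have "norm (h t u * \<phi> u) \<le> M * h t u"
        using bound[of u] h_nonneg[of t u] by (simp add: abs_mult mult.commute mult_right_mono)
      then show "ennreal (norm (h t u * \<phi> u)) \<le> ennreal M * ennreal (h t u)"
        using M h_nonneg[of t u] by (simp flip: ennreal_mult)
    qed
    also have "\<dots> = (\<integral>\<^sup>+u. ennreal M * ennreal (H u) \<partial>lborel)"
      by (intro nn_integral_cong, subst nn_integral_cmult) (simp_all add: H)
    also have "\<dots> = ennreal M * (\<integral>\<^sup>+u. ennreal (H u) \<partial>lborel)"
      using intH by (intro nn_integral_cmult) auto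
    also have "(\<integral>\<^sup>+u. ennreal (H u) \<partial>lborel) = ennreal (integral\<^sup>L lborel H)"
      by (rule nn_integral_eq_integral[OF intH]) (simp add: H_nonneg)
    finally show "(\<integral>\<^sup>+z. ennreal (norm (case z of (t, u) \<Rightarrow> h t u * \<phi> u)) \<partial>(lborel \<Otimes>\<^sub>M lborel)) < \<infinity>"
      by (simp add: ennreal_mult_less_top le_less_trans)
  qed auto
  from lborel_pair.Fubini_integral[OF this]
  have "(LINT t|lborel. (LINT u|lborel. h t u * \<phi> u)) = (LINT u|lborel. (LINT t|lborel. h t u * \<phi> u))"
    by simp
  moreover have "(LINT t|lborel. h t u) = H u" for u
    by (subst integral_eq_nn_integral) (use h_nonneg H_nonneg in \<open>auto simp: H\<close>)
  ultimately show ?thesis by simp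
qed

section \<open>Complex inner product spaces as real normed spaces\<close>

instance chilbert_space \<subseteq> banach ..

text \<open>Baire category: the sets \<open>U n\<close> are open, and if all were dense, a common
  point would violate pointwise boundedness. So some \<open>U n\<close> misses a ball, and linearity
  spreads the bound from that ball. The index set is arbitrary because it will be a half-line of
  times.\<close>

lemma uniform_boundedness:
  fixes f :: "'i \<Rightarrow> 'a::banach \<Rightarrow> 'b::real_normed_vector"
  assumes lin: "\<And>i. i \<in> I \<Longrightarrow> bounded_linear (f i)"
    and bdd: "\<And>x. \<exists>c. \<forall>i\<in>I. norm (f i x) \<le> c"
  shows "\<exists>C>0. \<forall>i\<in>I. \<forall>x. norm (f i x) \<le> C * norm x"
proof -
  define U where "U n = (\<Union>i\<in>I. {x. norm (f i x) > real n})" for n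
  have openU: "open (U n)" for n
    unfolding U_def
    by (intro open_UN ballI open_Collect_less continuous_intros linear_continuous_on lin)
  have "\<exists>n. closure (U n) \<noteq> UNIV"
  proof (rule ccontr)
    assume "\<not> ?thesis"
    then have "(euclidean :: 'a topology) closure_of (\<Inter>(range U)) = topspace euclidean"
      by (intro Baire_category) (auto simp: openU completely_metrizable_space_euclidean)
    then have "\<Inter>(range U) \<noteq> {}"
      by auto
    then obtain x where x: "\<And>n. x \<in> U n"
      by auto
    from bdd[of x] obtain c where c: "\<And>i. i \<in> I \<Longrightarrow> norm (f i x) \<le> c"
      by auto
    obtain n where "real n \<ge> c"
      using real_arch_simple by blast
    with x[of n] c show False
      by (force simp: U_def)
  qed
  then obtain n y where "y \<notin> closure (U n)"
    by blast
  then obtain e where e: "e > 0" "\<And>z. z \<in> U n \<Longrightarrow> \<not> dist z y < e"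
    by (auto simp: closure_approachable)
  have small: "norm (f i z) \<le> real n" if "i \<in> I" "z \<in> ball y e" for i z
    using e(2)[of z] that by (fastforce simp: U_def dist_commute not_less)
  \<comment> \<open>\<open>real n + 1\<close> instead of \<open>real n\<close> keeps
    \<open>C\<close> positive when \<open>n = 0\<close>.\<close>
  define C where "C = 4 * (real n + 1) / e"
  have "norm (f i x) \<le> C * norm x" if i: "i \<in> I" for i x
  proof (cases "x = 0")
    case True
    then show ?thesis
      using linear_0[OF bounded_linear.linear[OF lin[OF i]]] by simp
  next
    case False
    interpret fi: bounded_linear "f i" by (rule lin[OF i])
    \<comment> \<open>Half the radius, so that \<open>y + r *\<^sub>R x\<close> stays in the ball;
      subtracting the value at the centre doubles the bound.\<close>
    define r where "r = e / (2 * norm x)"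
    have r: "r > 0" using e False by (simp add: r_def)
    have "y + r *\<^sub>R x \<in> ball y e"
      using e False by (simp add: r_def dist_norm)
    then have "norm (f i (y + r *\<^sub>R x) - f i y) \<le> 2 * real n"
      using small[OF i] small[OF i, of y] e norm_triangle_ineq4[of "f i (y + r *\<^sub>R x)" "f i y"]
      by fastforce
    then have "r * norm (f i x) \<le> 2 * (real n + 1)"
      using r by (simp add: fi.add fi.scaleR)
    then have "norm (f i x) \<le> 2 * (real n + 1) / r"
      using r by (simp add: field_simps)
    also have "\<dots> = C * norm x"
      using e False by (simp add: r_def C_def)
    finally show ?thesis .
  qed
  moreover have "C > 0"
    using e by (simp add: C_def)
  ultimately show ?thesis
    by blast
qed

section \<open>The real inner product underlying the complex one\<close>

text \<open>It induces the same norm and is a bounded real bilinear map, so limits and derivatives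
  along orbits follow from real calculus.\<close>

definition re_inner :: "'a::complex_inner \<Rightarrow> 'a \<Rightarrow> real" where
  "re_inner x y = Re (cinner x y)"

lemma re_inner_commute: "re_inner x y = re_inner y x"
  unfolding re_inner_def by (subst cinner_commute) simp

lemma re_inner_add_left: "re_inner (x + y) z = re_inner x z + re_inner y z"
  by (simp add: re_inner_def cinner_add_left)

lemma re_inner_scaleR_left: "re_inner (r *\<^sub>R x) z = r * re_inner x z"
  by (simp add: re_inner_def scaleR_scaleC cinner_scaleC_left)

lemma re_inner_add_right: "re_inner z (x + y) = re_inner z x + re_inner z y"
  by (metis re_inner_add_left re_inner_commute)

lemma re_inner_scaleR_right: "re_inner z (r *\<^sub>R x) = r * re_inner z x"
  by (metis re_inner_scaleR_left re_inner_commute)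

lemma re_inner_self: "re_inner x x = (norm x)\<^sup>2"
  by (simp add: re_inner_def cinner_self_norm)

text \<open>Cauchy-Schwarz in reverse order: the triangle inequality belongs to the normed space, so
  expanding the square of \<open>norm (x + y)\<close> and comparing cross terms is enough.\<close>

lemma re_inner_le: "re_inner x y \<le> norm x * norm y"
proof -
  have "(norm (x + y))\<^sup>2 = (norm x)\<^sup>2 + 2 * re_inner x y + (norm y)\<^sup>2"
    using re_inner_commute[of y x]
    by (simp add: re_inner_add_left re_inner_add_right flip: re_inner_self)
  moreover have "(norm (x + y))\<^sup>2 \<le> (norm x + norm y)\<^sup>2"
    by (intro power_mono norm_triangle_ineq) simp
  ultimately show ?thesis
    by (simp add: power2_sum)
qed

lemma bounded_bilinear_re_inner: "bounded_bilinear (re_inner :: 'a::complex_inner \<Rightarrow> 'a \<Rightarrow> real)"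
proof
  show "\<exists>K. \<forall>a b :: 'a. norm (re_inner a b) \<le> norm a * norm b * K"
  proof (rule exI[of _ 1], intro allI)
    fix a b :: 'a
    have "- re_inner a b \<le> norm a * norm b"
      using re_inner_le[of "- a" b] re_inner_scaleR_left[of "- 1" a b] by simp
    then show "norm (re_inner a b) \<le> norm a * norm b * 1"
      using re_inner_le[of a b] by simp
  qed
qed (simp_all add: re_inner_add_left re_inner_add_right re_inner_scaleR_left re_inner_scaleR_right)

lemmas re_inner_tendsto [tendsto_intros] = bounded_bilinear.tendsto[OF bounded_bilinear_re_inner]

text \<open>Reduces identities between vector integrals to scalar ones. The separating functional is
  the pairing with \<open>u - v\<close> itself.\<close>

lemma functionals_separate:
  fixes u v :: "'a::complex_inner"
  assumes "\<And>L :: 'a \<Rightarrow> real. bounded_linear L \<Longrightarrow> L u = L v"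
  shows "u = v"
proof -
  have lin: "bounded_linear (\<lambda>x. re_inner x (u - v))"
    by (rule bounded_bilinear.bounded_linear_left[OF bounded_bilinear_re_inner])
  have "re_inner (u - v) (u - v) = 0"
    using assms[OF lin] linear_diff[OF bounded_linear.linear[OF lin], of u v] by simp
  then show ?thesis
    by (simp add: re_inner_self)
qed

lemma scaleC_of_real: "complex_of_real r *\<^sub>C x = r *\<^sub>R x"
  by (simp add: scaleR_scaleC)

lemma scaleC_zero_left: "0 *\<^sub>C x = 0"
  using scaleC_of_real[of 0 x] by simp

section \<open>Bounded semigroups and their resolvents\<close>

text \<open>Fixing \<open>K\<close> makes the constants explicit; \<open>K \<ge> 1\<close> is a
  normalisation that permits division by \<open>K\<close>.\<close>

locale bounded_semigroup =
  fixes T :: "real \<Rightarrow> 'a::chilbert_space \<Rightarrow> 'a" and D :: "'a set" and A :: "'a \<Rightarrow> 'a"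
    and K :: real
  assumes semigroup: "C0_semigroup T"
    and generator: "is_generator T D A"
    and T_bound: "\<And>t x. t \<ge> 0 \<Longrightarrow> norm (T t x) \<le> K * norm x"
    and K_ge_1: "K \<ge> 1"
    and zero_in_resolvent_set: "0 \<in> resolvent_set D A"
begin

lemma T_linear: "t \<ge> 0 \<Longrightarrow> bounded_linear (T t)"
  using semigroup by (simp add: C0_semigroup_def bounded_clinear_def)

lemma T_scaleR: "t \<ge> 0 \<Longrightarrow> T t (r *\<^sub>R x) = r *\<^sub>R T t x"
  using linear_scale[OF bounded_linear.linear[OF T_linear]] by blast

lemma T_diff: "t \<ge> 0 \<Longrightarrow> T t (x - y) = T t x - T t y"
  using linear_diff[OF bounded_linear.linear[OF T_linear]] by blast

lemma T_minus: "t \<ge> 0 \<Longrightarrow> T t (- x) = - T t x"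
  using linear_neg[OF bounded_linear.linear[OF T_linear]] by blast

lemma T_0 [simp]: "T 0 x = x"
  using semigroup by (simp add: C0_semigroup_def)

lemma T_add: "s \<ge> 0 \<Longrightarrow> t \<ge> 0 \<Longrightarrow> T (s + t) x = T s (T t x)"
  using semigroup by (simp add: C0_semigroup_def)

lemma T_commute: "s \<ge> 0 \<Longrightarrow> t \<ge> 0 \<Longrightarrow> T s (T t x) = T t (T s x)"
  by (metis T_add add.commute)

lemma T_tendsto: "((\<lambda>t. T t x) \<longlongrightarrow> x) (at_right 0)"
  using semigroup by (simp add: C0_semigroup_def)

section \<open>Continuity and differentiability of orbits\<close>

text \<open>The operator at the smaller time factors out and costs only \<open>K\<close>; right
  continuity at \<open>0\<close> therefore gives continuity from both sides.\<close>

lemma norm_T_diff_le: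
  assumes "s \<ge> 0" "t \<ge> 0"
  shows "norm (T t x - T s x) \<le> K * norm (T \<bar>t - s\<bar> x - x)"
proof -
  have *: "norm (T t x - T s x) \<le> K * norm (T \<bar>t - s\<bar> x - x)" if "0 \<le> s" "s \<le> t" for s t
  proof -
    have "T t x - T s x = T s (T (t - s) x - x)"
      using T_add[of s "t - s" x] that by (simp add: T_diff)
    then show ?thesis
      using T_bound[of s "T (t - s) x - x"] that by simp
  qed
  show ?thesis
    using *[of s t] *[of t s] assms
    by (cases "s \<le> t") (auto simp: norm_minus_commute abs_minus_commute)
qed

text \<open>The even extension bypasses the arbitrary values of \<open>T\<close> at negative times
  and makes orbit functionals Borel measurable on the whole line.\<close>

lemma continuous_T_abs: "continuous_on UNIV (\<lambda>t. T \<bar>t\<bar> x)"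
  unfolding continuous_on_iff
proof (intro ballI allI impI)
  fix s e :: real assume e: "e > 0"
  have "\<forall>\<^sub>F h in at_right 0. dist (T h x) x < e / K"
    using T_tendsto[of x] e K_ge_1 unfolding tendsto_iff by simp
  then obtain d where d: "d > 0" "\<And>h. 0 < h \<Longrightarrow> h < d \<Longrightarrow> dist (T h x) x < e / K"
    by (auto simp: eventually_at_right_field)
  have "dist (T \<bar>t\<bar> x) (T \<bar>s\<bar> x) < e" if "dist t s < d" for t
  proof -
    define h where "h = \<bar>\<bar>t\<bar> - \<bar>s\<bar>\<bar>"
    have "0 \<le> h" "h < d"
      using that by (auto simp: h_def dist_real_def)
    then have "norm (T h x - x) < e / K"
      using d(2)[of h] e K_ge_1 by (cases "h = 0") (auto simp: dist_norm)
    then have "K * norm (T h x - x) < e"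
      using K_ge_1 by (simp add: field_simps)
    then show ?thesis
      using norm_T_diff_le[of "\<bar>s\<bar>" "\<bar>t\<bar>" x] by (simp add: dist_norm h_def)
  qed
  with d(1) show "\<exists>d>0. \<forall>t\<in>UNIV. dist t s < d \<longrightarrow> dist (T \<bar>t\<bar> x) (T \<bar>s\<bar> x) < e"
    by blast
qed

lemma continuous_T: "S \<subseteq> {0..} \<Longrightarrow> continuous_on S (\<lambda>t. T t x)"
  using continuous_on_subset[OF continuous_T_abs, of S x]
  by (rule continuous_on_eq) auto

lemma generator_tendsto: "x \<in> D \<Longrightarrow> ((\<lambda>h. (T h x - x) /\<^sub>R h) \<longlongrightarrow> A x) (at_right 0)"
  using generator by (simp add: is_generator_def)

lemma generatorI:
  assumes "((\<lambda>h. (T h x - x) /\<^sub>R h) \<longlongrightarrow> y) (at_right 0)"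
  shows "x \<in> D" "A x = y"
proof -
  show "x \<in> D"
    using generator assms by (auto simp: is_generator_def)
  from tendsto_unique[OF _ generator_tendsto[OF this] assms] show "A x = y"
    by simp
qed

lemma T_generator:
  assumes x: "x \<in> D" and t: "t \<ge> 0"
  shows "T t x \<in> D" "A (T t x) = T t (A x)"
proof -
  have "((\<lambda>h. T t ((T h x - x) /\<^sub>R h)) \<longlongrightarrow> T t (A x)) (at_right 0)"
    by (rule bounded_linear.tendsto[OF T_linear[OF t] generator_tendsto[OF x]])
  moreover have "\<forall>\<^sub>F h in at_right 0. T t ((T h x - x) /\<^sub>R h) = (T h (T t x) - T t x) /\<^sub>R h"
    unfolding eventually_at_right_field
    by (rule exI[of _ 1]) (use t in \<open>auto simp: T_scaleR T_diff T_commute[of t]\<close>)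
  ultimately have "((\<lambda>h. (T h (T t x) - T t x) /\<^sub>R h) \<longlongrightarrow> T t (A x)) (at_right 0)"
    by (rule Lim_transform_eventually)
  from generatorI[OF this] show "T t x \<in> D" "A (T t x) = T t (A x)" .
qed

text \<open>The generator supplies right difference quotients at \<open>0\<close> only. A left
  quotient at \<open>t\<close> is \<open>T s\<close> applied to such a quotient, so
  \<open>m = min s t\<close> treats both sides at once, and uniform boundedness controls the moving
  operator \<open>T m\<close>.\<close>

lemma T_has_vector_derivative:
  assumes x: "x \<in> D" and t: "t \<ge> 0"
  shows "((\<lambda>t. T t x) has_vector_derivative T t (A x)) (at t within {0..})"
proof -
  \<comment> \<open>The first term is the error of the difference quotient at \<open>0\<close>; the
    second pays for replacing \<open>T m\<close> by \<open>T t\<close> when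
    \<open>s < t\<close>.\<close>
  define \<delta> where "\<delta> h = K * norm ((T h x - x) /\<^sub>R h - A x) + K * norm (T h (A x) - A x)" for h
  have "(\<delta> \<longlongrightarrow> K * norm (A x - A x) + K * norm (A x - A x)) (at_right 0)"
    unfolding \<delta>_def by (intro tendsto_intros generator_tendsto x T_tendsto)
  then have "(\<delta> \<longlongrightarrow> 0) (at_right 0)"
    by simp
  moreover have "filterlim (\<lambda>s. \<bar>s - t\<bar>) (at_right 0) (at t within {0..})"
    unfolding filterlim_at
    by (auto simp: eventually_at_filter intro!: tendsto_eq_intros)
  ultimately have \<delta>: "((\<lambda>s. \<delta> \<bar>s - t\<bar>) \<longlongrightarrow> 0) (at t within {0..})"
    by (rule filterlim_compose)
  have bound: "norm ((1 / norm (s - t)) *\<^sub>R (T s x - (T t x + (s - t) *\<^sub>R T t (A x)))) \<le> \<delta> \<bar>s - t\<bar>"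
    if s: "s \<in> {0..}" "s \<noteq> t" for s
  proof -
    define h where "h = \<bar>s - t\<bar>"
    define m where "m = min s t"
    have h: "h > 0" and m: "m \<ge> 0"
      using s t by (auto simp: h_def m_def)
    define q where "q = (T h x - x) /\<^sub>R h"
    have q: "T m q = (T (max s t) x - T m x) /\<^sub>R h"
    proof -
      have "max s t = m + h"
        by (auto simp: h_def m_def)
      then have "T (max s t) x = T m (T h x)"
        using h m by (simp add: T_add)
      then show ?thesis
        using m by (simp add: q_def T_scaleR T_diff)
    qed
    have "norm ((1 / norm (s - t)) *\<^sub>R (T s x - (T t x + (s - t) *\<^sub>R T t (A x))))
        = norm (T m q - T t (A x))"
    proof (cases "s > t")
      case True
      then have "(1 / norm (s - t)) *\<^sub>R (T s x - (T t x + (s - t) *\<^sub>R T t (A x)))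
          = (T s x - T t x) /\<^sub>R h - T t (A x)"
        by (simp add: h_def scaleR_diff_right scaleR_add_right divide_inverse)
      then show ?thesis
        using q True by (simp add: m_def)
    next
      case False
      with s have st: "s < t" by simp
      then have "(1 / norm (s - t)) *\<^sub>R (T s x - (T t x + (s - t) *\<^sub>R T t (A x)))
          = - ((T t x - T s x) /\<^sub>R h - T t (A x))"
      proof -
        have "s - t = - h" "norm (s - t) = h"
          using st by (auto simp: h_def)
        then show ?thesis
          using h by (simp add: scaleR_diff_right scaleR_add_right divide_inverse)
      qed
      then have "norm ((1 / norm (s - t)) *\<^sub>R (T s x - (T t x + (s - t) *\<^sub>R T t (A x))))
          = norm ((T t x - T s x) /\<^sub>R h - T t (A x))"
        by (simp only: norm_minus_cancel)
      then show ?thesis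
        using q st by (simp add: m_def max_def)
    qed
    also have "T m q - T t (A x) = T m (q - A x) + (T m (A x) - T t (A x))"
      using m by (simp add: T_diff)
    also have "norm \<dots> \<le> norm (T m (q - A x)) + norm (T m (A x) - T t (A x))"
      by (rule norm_triangle_ineq)
    also have "norm (T m (A x) - T t (A x)) \<le> K * norm (T h (A x) - A x)"
    proof (cases "s > t")
      case True
      then have "m = t" by (simp add: m_def)
      then show ?thesis using K_ge_1 by simp
    next
      case False
      then have "m = s" by (simp add: m_def)
      then show ?thesis
        using norm_T_diff_le[of t s "A x"] s t by (simp add: h_def)
    qed
    also have "norm (T m (q - A x)) \<le> K * norm (q - A x)"
      by (rule T_bound[OF m])
    finally show ?thesis
      by (simp add: \<delta>_def q_def h_def)
  qed
  have "((\<lambda>s. (1 / norm (s - t)) *\<^sub>R (T s x - (T t x + (s - t) *\<^sub>R T t (A x)))) \<longlongrightarrow> 0) (at t within {0..})"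
    by (rule Lim_null_comparison[OF _ \<delta>])
       (use bound in \<open>auto simp: eventually_at_filter\<close>)
  then show ?thesis
    unfolding has_vector_derivative_def has_derivative_within
    by (simp add: bounded_linear_scaleR_left)
qed

subsection \<open>Negative powers of the shifted generator\<close>

text \<open>\<open>G s b\<close> is \<open>(s - A)\<close> to the power \<open>-b\<close>; for \<open>s > 0\<close> the semigroup law in \<open>b\<close> is just the
  Beta integral, which is why \<open>neg_power\<close> is approached through \<open>s \<rightarrow> 0\<close>.\<close>

definition G :: "real \<Rightarrow> real \<Rightarrow> 'a \<Rightarrow> 'a" where
  "G s b x = (1 / Gamma b) *\<^sub>R integral {0<..} (\<lambda>t. (t powr (b - 1) * exp (- (s * t))) *\<^sub>R T t x)"

lemma G_integrable:
  assumes "s > 0" "b > 0"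
  shows "(\<lambda>t. (t powr (b - 1) * exp (- (s * t))) *\<^sub>R T t x) integrable_on {0<..}"
proof (rule integrable_on_Ioi_dominated)
  show "continuous_on {0<..} (\<lambda>t. (t powr (b - 1) * exp (- (s * t))) *\<^sub>R T t x)"
    by (intro continuous_intros continuous_T) auto
  show "(\<lambda>t. K * norm x * (t powr (b - 1) * exp (- (s * t)))) integrable_on {0<..}"
    using has_integral_powr_exp_scale[OF assms] by blast
  show "norm ((t powr (b - 1) * exp (- (s * t))) *\<^sub>R T t x)
      \<le> K * norm x * (t powr (b - 1) * exp (- (s * t)))" if "t > 0" for t
    using T_bound[of t x] that by (simp add: mult.commute mult_left_mono)
qed

lemma G_has_integral:
  assumes "s > 0" "b > 0"
  shows "((\<lambda>t. (t powr (b - 1) * exp (- (s * t))) *\<^sub>R T t x) has_integral Gamma b *\<^sub>R G s b x) {0<..}"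
  using integrable_integral[OF G_integrable[OF assms, of x]] Gamma_real_pos[OF assms(2)]
  by (simp add: G_def)

lemma norm_G_le:
  assumes "s > 0" "b > 0"
  shows "norm (G s b x) \<le> K * norm x * s powr (- b)"
proof -
  have "norm (integral {0<..} (\<lambda>t. (t powr (b - 1) * exp (- (s * t))) *\<^sub>R T t x))
      \<le> integral {0<..} (\<lambda>t. K * norm x * (t powr (b - 1) * exp (- (s * t))))"
  proof (rule integral_norm_bound_integral[OF G_integrable[OF assms]])
    show "(\<lambda>t. K * norm x * (t powr (b - 1) * exp (- (s * t)))) integrable_on {0<..}"
      using has_integral_powr_exp_scale[OF assms] by blast
    show "norm ((t powr (b - 1) * exp (- (s * t))) *\<^sub>R T t x)
        \<le> K * norm x * (t powr (b - 1) * exp (- (s * t)))" if "t \<in> {0<..}" for t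
      using T_bound[of t x] that by (simp add: mult.commute mult_left_mono)
  qed
  also have "\<dots> = K * norm x * (Gamma b / s powr b)"
    using has_integral_powr_exp_scale[OF assms] by (rule integral_unique)
  finally show ?thesis
    using Gamma_real_pos[OF assms(2)] by (simp add: G_def powr_minus field_simps)
qed

lemma G_linear:
  assumes "s > 0" "b > 0"
  shows "bounded_linear (G s b)"
proof (rule bounded_linear_intro)
  note \<Gamma> = Gamma_real_pos[OF assms(2)]
  have "((\<lambda>t. (t powr (b - 1) * exp (- (s * t))) *\<^sub>R T t (x + y)) has_integral
      Gamma b *\<^sub>R G s b x + Gamma b *\<^sub>R G s b y) {0<..}" for x y
    by (rule has_integral_eq[OF _ has_integral_add[OF G_has_integral[OF assms] G_has_integral[OF assms]]])
       (simp add: linear_add[OF bounded_linear.linear[OF T_linear]] scaleR_add_right)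
  from integral_unique[OF this] show "G s b (x + y) = G s b x + G s b y" for x y
    using \<Gamma> by (simp add: G_def scaleR_add_right)
  have "((\<lambda>t. (t powr (b - 1) * exp (- (s * t))) *\<^sub>R T t (r *\<^sub>R x)) has_integral
      r *\<^sub>R (Gamma b *\<^sub>R G s b x)) {0<..}" for r x
    by (rule has_integral_eq[OF _ has_integral_cmul[OF G_has_integral[OF assms]]])
       (simp add: T_scaleR)
  from integral_unique[OF this] show "G s b (r *\<^sub>R x) = r *\<^sub>R G s b x" for r x
    using \<Gamma> by (simp add: G_def)
  show "norm (G s b x) \<le> norm x * (K * s powr (- b))" for x
    using norm_G_le[OF assms, of x] by (simp add: ac_simps)
qed

text \<open>Scalar form of the defining integral. The absolute value in
  \<open>T \<bar>t\<bar> x\<close> is harmless because the kernel vanishes for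
  \<open>t \<le> 0\<close>, and it leaves a bounded measurable factor for Fubini.\<close>

lemma G_functional:
  fixes L :: "'a \<Rightarrow> real"
  assumes "s > 0" "b > 0" and L: "bounded_linear L"
  shows "L (G s b x) = (LINT t|lborel. gamma_kernel s b t * L (T \<bar>t\<bar> x)) / Gamma b"
proof -
  let ?f = "\<lambda>t. t powr (b - 1) * exp (- (s * t)) * L (T t x)"
  interpret L: bounded_linear L by fact
  obtain C where C: "\<And>y. norm (L y) \<le> norm y * C" "C \<ge> 0"
    using L.nonneg_bounded by blast
  have "((L \<circ> (\<lambda>t. (t powr (b - 1) * exp (- (s * t))) *\<^sub>R T t x)) has_integral L (Gamma b *\<^sub>R G s b x)) {0<..}"
    by (rule has_integral_linear[OF G_has_integral[OF assms(1,2)] L])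
  then have "(?f has_integral Gamma b * L (G s b x)) {0<..}"
    by (simp add: o_def L.scaleR)
  then have "Gamma b * L (G s b x) = integral {0<..} ?f"
    by (simp add: integral_unique)
  also have "\<dots> = (LINT t|lborel. indicator {0<..} t * ?f t)"
  proof (rule integral_Ioi_eq_lborel)
    show "continuous_on {0<..} ?f"
      by (intro continuous_intros L.continuous_on continuous_T) auto
    show "(\<lambda>t. C * K * norm x * (t powr (b - 1) * exp (- (s * t)))) integrable_on {0<..}"
      using has_integral_powr_exp_scale[OF assms(1,2)] by blast
    show "\<bar>?f t\<bar> \<le> C * K * norm x * (t powr (b - 1) * exp (- (s * t)))" if "t > 0" for t
    proof -
      have "\<bar>L (T t x)\<bar> \<le> norm (T t x) * C"
        using C(1)[of "T t x"] by simp
      also have "\<dots> \<le> K * norm x * C"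
        using C(2) T_bound[of t x] that by (intro mult_right_mono) auto
      finally have "(t powr (b - 1) * exp (- (s * t))) * \<bar>L (T t x)\<bar>
          \<le> (t powr (b - 1) * exp (- (s * t))) * (K * norm x * C)"
        by (rule mult_left_mono) simp
      then show ?thesis
        by (simp add: abs_mult ac_simps)
    qed
  qed
  also have "\<dots> = (LINT t|lborel. gamma_kernel s b t * L (T \<bar>t\<bar> x))"
    by (rule Bochner_Integration.integral_cong) (auto simp: gamma_kernel_def indicator_def)
  finally show ?thesis
    using Gamma_real_pos[OF assms(2)] by (simp add: field_simps)
qed

lemma G_commute:
  assumes "s > 0" "b > 0" and F: "bounded_linear F"
    and comm: "\<And>t x. t \<ge> 0 \<Longrightarrow> F (T t x) = T t (F x)"
  shows "F (G s b x) = G s b (F x)"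
proof -
  interpret F: bounded_linear F by fact
  have "((F \<circ> (\<lambda>t. (t powr (b - 1) * exp (- (s * t))) *\<^sub>R T t x)) has_integral F (Gamma b *\<^sub>R G s b x)) {0<..}"
    by (rule has_integral_linear[OF G_has_integral[OF assms(1,2)] F])
  then have "((\<lambda>t. (t powr (b - 1) * exp (- (s * t))) *\<^sub>R T t (F x)) has_integral Gamma b *\<^sub>R F (G s b x)) {0<..}"
    unfolding F.scaleR by (rule has_integral_eq[rotated]) (simp add: F.scaleR comm)
  from has_integral_unique[OF this G_has_integral[OF assms(1,2)]] show ?thesis
    using Gamma_real_pos[OF assms(2)] by simp
qed

text \<open>Varying \<open>s\<close> in the exponential costs one factor \<open>t\<close>, so the
  Lipschitz constant on \<open>{m<..}\<close> comes from the Gamma integral of order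
  \<open>b + 1\<close>. Continuity in \<open>s\<close> is what the integrability criteria ask of
  integrals over the shift.\<close>

lemma continuous_G:
  assumes b: "b > 0"
  shows "continuous_on {0<..} (\<lambda>s. G s b x)"
proof -
  note \<Gamma> = Gamma_real_pos[OF b]
  have diff: "norm (G r b x - G s b x) \<le> \<bar>r - s\<bar> * (K * norm x * Gamma (b + 1) / m powr (b + 1) / Gamma b)"
    if m: "m > 0" "m \<le> r" "r \<le> s" for m r s
  proof -
    let ?g = "\<lambda>t. \<bar>r - s\<bar> * (K * norm x) * (t powr (b + 1 - 1) * exp (- (m * t)))"
    have int: "((\<lambda>t. (t powr (b - 1) * exp (- (r * t))) *\<^sub>R T t x - (t powr (b - 1) * exp (- (s * t))) *\<^sub>R T t x)
        has_integral Gamma b *\<^sub>R G r b x - Gamma b *\<^sub>R G s b x) {0<..}"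
      by (intro has_integral_diff G_has_integral) (use m b in auto)
    have g: "(?g has_integral \<bar>r - s\<bar> * (K * norm x) * (Gamma (b + 1) / m powr (b + 1))) {0<..}"
      by (intro has_integral_powr_exp_scale) (use m b in auto)
    have "norm (integral {0<..} (\<lambda>t. (t powr (b - 1) * exp (- (r * t))) *\<^sub>R T t x
        - (t powr (b - 1) * exp (- (s * t))) *\<^sub>R T t x)) \<le> integral {0<..} ?g"
    proof (rule integral_norm_bound_integral)
      fix t :: real assume "t \<in> {0<..}"
      then have t: "t > 0" by simp
      have "exp (- (r * t)) - exp (- (s * t)) = exp (- (r * t)) * (1 - exp (- ((s - r) * t)))"
        by (simp add: right_diff_distrib algebra_simps flip: exp_add)
      also have "\<dots> \<le> exp (- (m * t)) * ((s - r) * t)"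
        using m t exp_ge_add_one_self[of "- ((s - r) * t)"] by (intro mult_mono) auto
      finally have "\<bar>exp (- (r * t)) - exp (- (s * t))\<bar> \<le> exp (- (m * t)) * (\<bar>r - s\<bar> * t)"
        using m t by simp
      then have "t powr (b - 1) * \<bar>exp (- (r * t)) - exp (- (s * t))\<bar> * norm (T t x)
          \<le> t powr (b - 1) * (exp (- (m * t)) * (\<bar>r - s\<bar> * t)) * (K * norm x)"
        using T_bound[of t x] t by (intro mult_mono mult_left_mono) auto
      also have "\<dots> = ?g t"
      proof -
        have "t powr b = t powr (b - 1) * t"
          using t powr_add[of t "b - 1" 1] by simp
        then show ?thesis by simp
      qed
      finally show "norm ((t powr (b - 1) * exp (- (r * t))) *\<^sub>R T t x
          - (t powr (b - 1) * exp (- (s * t))) *\<^sub>R T t x) \<le> ?g t"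
        by (simp add: abs_mult flip: scaleR_diff_left right_diff_distrib)
    qed (use int g in blast)+
    then have "Gamma b * norm (G r b x - G s b x) \<le> \<bar>r - s\<bar> * (K * norm x) * (Gamma (b + 1) / m powr (b + 1))"
      unfolding integral_unique[OF int] integral_unique[OF g]
      using \<Gamma> by (simp flip: scaleR_diff_right)
    then have "norm (G r b x - G s b x)
        \<le> \<bar>r - s\<bar> * (K * norm x) * (Gamma (b + 1) / m powr (b + 1)) / Gamma b"
      by (subst pos_le_divide_eq[OF \<Gamma>]) (simp only: mult.commute[of _ "Gamma b"])
    then show ?thesis
      by (simp add: mult.assoc)
  qed
  have "isCont (\<lambda>s. G s b x) s" if s: "s > 0" for s
  proof -
    define m where "m = s / 2"
    have m: "m > 0" "m < s" using s by (auto simp: m_def)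
    define C where "C = K * norm x * Gamma (b + 1) / m powr (b + 1) / Gamma b"
    have C: "C \<ge> 0"
      using \<Gamma> K_ge_1 b Gamma_real_pos[of "b + 1"] by (simp add: C_def)
    have "C-lipschitz_on {m<..} (\<lambda>s. G s b x)"
    proof (rule lipschitz_onI[OF _ C])
      fix r r' assume "r \<in> {m<..}" "r' \<in> {m<..}"
      then show "dist (G r b x) (G r' b x) \<le> C * dist r r'"
        using diff[of m r r'] diff[of m r' r] m
        by (cases "r \<le> r'") (auto simp: dist_norm C_def norm_minus_commute abs_minus_commute mult.commute)
    qed
    then have "continuous_on {m<..} (\<lambda>s. G s b x)"
      by (rule lipschitz_on_continuous_on)
    then show ?thesis
      using m by (simp add: continuous_on_eq_continuous_at)
  qed
  then show ?thesis
    by (simp add: continuous_on_eq_continuous_at)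
qed

subsection \<open>The resolvent\<close>

definition R :: "real \<Rightarrow> 'a \<Rightarrow> 'a" where
  "R s = resolvent D A (complex_of_real s)"

text \<open>\<open>resolvent D A 0\<close> inverts \<open>- A\<close>, whence the signs. It is the
  inverse from which facts about positive \<open>s\<close> are derived.\<close>

lemma R_0:
  shows R_0_in_D: "R 0 x \<in> D" and A_R_0: "A (R 0 x) = - x"
    and R_0_A: "y \<in> D \<Longrightarrow> R 0 (A y) = - y" and R_0_linear: "bounded_linear (R 0)"
proof -
  have bij: "bij_betw (\<lambda>x. 0 *\<^sub>C x - A x) D UNIV" and lin: "bounded_linear (resolvent D A 0)"
    using zero_in_resolvent_set by (auto simp: resolvent_set_def bounded_clinear_def)
  then show lin': "bounded_linear (R 0)"
    by (simp add: R_def)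
  show "R 0 x \<in> D"
    using bij unfolding R_def resolvent_def by (simp add: bij_betw_def inv_into_into)
  have "0 *\<^sub>C R 0 x - A (R 0 x) = x"
    using f_inv_into_f[of x "\<lambda>x. 0 *\<^sub>C x - A x" D] bij
    unfolding R_def resolvent_def by (simp add: bij_betw_def)
  then show "A (R 0 x) = - x"
    by (simp add: scaleC_zero_left)
      (metis minus_equation_iff)
  show "R 0 (A y) = - y" if "y \<in> D"
  proof -
    have "R 0 (0 *\<^sub>C y - A y) = y"
      using inv_into_f_f[of "\<lambda>x. 0 *\<^sub>C x - A x" D y] bij that
      unfolding R_def resolvent_def by (simp add: bij_betw_def)
    then have "R 0 (- A y) = y"
      by (simp add: scaleC_zero_left)
    then show ?thesis
      using linear_neg[OF bounded_linear.linear[OF lin'], of "A y"]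
      by (metis minus_minus)
  qed
qed

lemma T_R_0:
  assumes "t \<ge> 0"
  shows "R 0 (T t x) = T t (R 0 x)"
proof -
  interpret R0: bounded_linear "R 0" by (rule R_0_linear)
  have "- T t (R 0 x) = R 0 (A (T t (R 0 x)))"
    by (intro R_0_A[symmetric] T_generator(1) R_0_in_D assms)
  also have "A (T t (R 0 x)) = - T t x"
    using assms by (simp add: T_generator(2) R_0_in_D A_R_0 T_minus)
  finally show ?thesis
    by (simp add: R0.neg)
qed

text \<open>The integrand is the derivative of \<open>- (exp (- (s * t)) *\<^sub>R T t x)\<close>:
  the endpoint \<open>0\<close> contributes \<open>x\<close>, and the contribution at infinity
  vanishes because the orbit is bounded.\<close>

lemma G_one_left_inverse:
  assumes s: "s > 0" and x: "x \<in> D"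
  shows "G s 1 (s *\<^sub>R x - A x) = x"
proof -
  define f where "f t = (t powr (1 - 1) * exp (- (s * t))) *\<^sub>R T t (s *\<^sub>R x - A x)" for t
  define F where "F N = x - exp (- (s * N)) *\<^sub>R T N x" for N
  have "(f has_integral F N) {0..N}" if N: "N > 0" for N
  proof -
    have "((\<lambda>t. exp (- (s * t)) *\<^sub>R T t (s *\<^sub>R x - A x)) has_integral
        (- (exp (- (s * N)) *\<^sub>R T N x) - (- (exp (- (s * 0)) *\<^sub>R T 0 x)))) {0..N}"
    proof (rule fundamental_theorem_of_calculus)
      fix t assume t: "t \<in> {0..N}"
      have "((\<lambda>t. T t x) has_vector_derivative T t (A x)) (at t within {0..N})"
        by (rule has_vector_derivative_within_subset[OF T_has_vector_derivative[OF x]]) (use t in auto)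
      moreover have "((\<lambda>t. exp (- (s * t))) has_field_derivative - s * exp (- (s * t))) (at t within {0..N})"
        by (auto intro!: derivative_eq_intros)
      ultimately have "((\<lambda>t. - (exp (- (s * t)) *\<^sub>R T t x)) has_vector_derivative
          - (exp (- (s * t)) *\<^sub>R T t (A x) + (- s * exp (- (s * t))) *\<^sub>R T t x)) (at t within {0..N})"
        by (intro has_vector_derivative_minus has_vector_derivative_scaleR)
      then show "((\<lambda>t. - (exp (- (s * t)) *\<^sub>R T t x)) has_vector_derivative
          exp (- (s * t)) *\<^sub>R T t (s *\<^sub>R x - A x)) (at t within {0..N})"
        using t by (simp add: T_diff T_scaleR scaleR_diff_right mult.commute)
    qed (use N in simp)
    then have "((\<lambda>t. exp (- (s * t)) *\<^sub>R T t (s *\<^sub>R x - A x)) has_integral F N) {0..N}"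
      by (simp add: F_def)
    \<comment> \<open>\<open>0 powr 0\<close> is \<open>0\<close>, so \<open>f\<close> differs from
      the exponential integrand at the single point \<open>0\<close>.\<close>
    then show ?thesis
      by (rule has_integral_spike[of "{0}", rotated 2]) (auto simp: f_def)
  qed
  moreover have "(F \<longlongrightarrow> x) at_top"
  proof -
    have "((\<lambda>N. exp (- (s * N)) * (K * norm x)) \<longlongrightarrow> 0 * (K * norm x)) at_top"
      by (intro tendsto_intros filterlim_compose[OF exp_at_bot]
          filterlim_compose[OF filterlim_uminus_at_bot_at_top]
          filterlim_tendsto_pos_mult_at_top[OF tendsto_const s] filterlim_ident)
    then have "((\<lambda>N. exp (- (s * N)) * (K * norm x)) \<longlongrightarrow> 0) at_top"
      by simp
    moreover have "\<forall>\<^sub>F N in at_top. norm (exp (- (s * N)) *\<^sub>R T N x) \<le> exp (- (s * N)) * (K * norm x)"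
      using eventually_ge_at_top[of 0] by eventually_elim (simp add: T_bound)
    ultimately have "((\<lambda>N. exp (- (s * N)) *\<^sub>R T N x) \<longlongrightarrow> 0) at_top"
      by (rule Lim_null_comparison[rotated])
    then have "(F \<longlongrightarrow> x - 0) at_top"
      unfolding F_def by (intro tendsto_intros)
    then show ?thesis by simp
  qed
  moreover have "f integrable_on {0<..}"
    unfolding f_def using s by (intro G_integrable) auto
  ultimately have "integral {0<..} f = x"
    by (intro integral_Ioi_eq_limit[of f F])
  moreover have "G s 1 (s *\<^sub>R x - A x) = (1 / Gamma 1) *\<^sub>R integral {0<..} f"
    unfolding G_def f_def[abs_def] ..
  ultimately show ?thesis
    by simp
qed

text \<open>The inverse at \<open>0\<close> replaces an argument with closedness of
  \<open>A\<close>: the left inverse property at \<open>R 0 x\<close> and commutation give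
  \<open>G s 1 x = R 0 (x - s *\<^sub>R G s 1 x)\<close>, which lies in \<open>D\<close> and on
  which \<open>A\<close> is known.\<close>

lemma G_one_right_inverse:
  assumes s: "s > 0"
  shows "G s 1 x \<in> D" "s *\<^sub>R G s 1 x - A (G s 1 x) = x"
proof -
  have "bounded_linear (G s 1)"
    using s by (intro G_linear) auto
  then interpret Gs: bounded_linear "G s 1" .
  interpret R0: bounded_linear "R 0" by (rule R_0_linear)
  have "G s 1 (s *\<^sub>R R 0 x + x) = R 0 x"
    using G_one_left_inverse[OF s R_0_in_D[of x]] by (simp add: A_R_0)
  moreover have "G s 1 (R 0 x) = R 0 (G s 1 x)"
    using s by (intro G_commute[symmetric] R_0_linear T_R_0) auto
  ultimately have *: "G s 1 x = R 0 (x - s *\<^sub>R G s 1 x)"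
    by (simp add: Gs.add Gs.scaleR R0.diff R0.scaleR eq_diff_eq add.commute)
  show "G s 1 x \<in> D"
    by (subst *) (rule R_0_in_D)
  have "A (G s 1 x) = - (x - s *\<^sub>R G s 1 x)"
    by (subst *) (rule A_R_0)
  then show "s *\<^sub>R G s 1 x - A (G s 1 x) = x"
    by simp
qed

text \<open>The left inverse makes \<open>s - A\<close> injective on \<open>D\<close>, so
  \<open>inv_into\<close> must return the preimage exhibited by the right inverse; membership of
  \<open>s\<close> in the resolvent set is not presupposed.\<close>

lemma R_eq_G_one:
  assumes s: "s > 0"
  shows "R s = G s 1"
proof
  fix x
  let ?f = "\<lambda>x. complex_of_real s *\<^sub>C x - A x"
  have "inj_on ?f D"
    by (rule inj_on_inverseI[of _ "G s 1"]) (simp add: scaleC_of_real G_one_left_inverse[OF s])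
  from inv_into_f_f[OF this G_one_right_inverse(1)[OF s, of x]] show "R s x = G s 1 x"
    unfolding R_def resolvent_def by (simp add: scaleC_of_real G_one_right_inverse(2)[OF s])
qed

lemma R_facts:
  assumes "s \<ge> 0"
  shows R_in_D: "R s x \<in> D" and R_right_inverse: "s *\<^sub>R R s x - A (R s x) = x"
    and R_left_inverse: "y \<in> D \<Longrightarrow> R s (s *\<^sub>R y - A y) = y"
    and R_linear: "bounded_linear (R s)"
proof -
  show "R s x \<in> D"
    using assms R_0_in_D[of x] G_one_right_inverse(1)[of s x] R_eq_G_one[of s] by (cases "s = 0") auto
  show "s *\<^sub>R R s x - A (R s x) = x"
    using assms A_R_0[of x] G_one_right_inverse(2)[of s x] R_eq_G_one[of s] by (cases "s = 0") auto
  show "R s (s *\<^sub>R y - A y) = y" if "y \<in> D"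
    using assms R_0_A[OF that] linear_neg[OF bounded_linear.linear[OF R_0_linear], of "A y"]
      G_one_left_inverse[of s y] that R_eq_G_one[of s] by (cases "s = 0") auto
  show "bounded_linear (R s)"
    using assms R_0_linear G_linear[of s 1] R_eq_G_one[of s] by (cases "s = 0") auto
qed

lemma resolvent_identity:
  assumes "s \<ge> 0" "r \<ge> 0"
  shows "R s x - R r x = (r - s) *\<^sub>R R s (R r x)"
proof -
  interpret bounded_linear "R s" by (rule R_linear[OF assms(1)])
  have "R s ((s - r) *\<^sub>R R r x + (r *\<^sub>R R r x - A (R r x))) = R r x"
    using R_left_inverse[OF assms(1) R_in_D[OF assms(2)], of x] by (simp add: algebra_simps)
  then have "(s - r) *\<^sub>R R s (R r x) + R s x = R r x"
    unfolding R_right_inverse[OF assms(2)] by (simp add: add scaleR)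
  then show ?thesis
    by (simp add: algebra_simps eq_diff_eq)
qed

lemma T_R: "s \<ge> 0 \<Longrightarrow> t \<ge> 0 \<Longrightarrow> R s (T t x) = T t (R s x)"
  using T_R_0[of t x] G_commute[of s 1 "T t" x] R_eq_G_one[of s] T_linear[of t] T_commute[of t]
  by (cases "s = 0") auto

lemma norm_R_le: "s > 0 \<Longrightarrow> norm (R s x) \<le> K * norm x / s"
  using norm_G_le[of s 1 x] by (simp add: R_eq_G_one powr_minus divide_inverse)

text \<open>The Laplace bound \<open>K / s\<close> degenerates at \<open>0\<close>. The identity
  \<open>R s x = R 0 (x - s *\<^sub>R R s x)\<close> repairs this, since
  \<open>s *\<^sub>R R s x\<close> is bounded by \<open>K * norm x\<close>.\<close>

lemma R_uniform_bound: "\<exists>C>0. \<forall>s\<ge>0. \<forall>x. norm (R s x) \<le> C * norm x"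
proof -
  obtain C where C: "\<And>x. norm (R 0 x) \<le> norm x * C" "C > 0"
    using bounded_linear.pos_bounded[OF R_0_linear] by blast
  have "norm (R s x) \<le> (C * (1 + K)) * norm x" if s: "s \<ge> 0" for s x
  proof -
    interpret R0: bounded_linear "R 0" by (rule R_0_linear)
    have "R s x = R 0 (x - s *\<^sub>R R s x)"
      using resolvent_identity[of 0 s x] s by (simp add: R0.diff R0.scaleR algebra_simps eq_diff_eq)
    then have "norm (R s x) \<le> norm (x - s *\<^sub>R R s x) * C"
      using C(1)[of "x - s *\<^sub>R R s x"] by simp
    also have "norm (x - s *\<^sub>R R s x) \<le> norm x + norm (s *\<^sub>R R s x)"
      by (rule norm_triangle_ineq4)
    also have "norm (s *\<^sub>R R s x) \<le> K * norm x"
    proof (cases "s = 0")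
      case False
      with s have "s > 0" by simp
      with norm_R_le[OF this, of x] show ?thesis by (simp add: field_simps)
    qed (use K_ge_1 in simp)
    finally show ?thesis
      using C(2) by (simp add: algebra_simps)
  qed
  moreover have "C * (1 + K) > 0"
    using C(2) K_ge_1 by simp
  ultimately show ?thesis by blast
qed

text \<open>\<open>x\<close> is the limit of \<open>(R 0 x - T h (R 0 x)) / h = R 0 ((x - T h x) / h)\<close> as \<open>h \<rightarrow> 0\<close>.\<close>

lemma R_0_range_dense: "\<exists>z. norm (x - R 0 z) < e" if "e > 0"
proof -
  interpret R0: bounded_linear "R 0" by (rule R_0_linear)
  have "((\<lambda>h. (T h (R 0 x) - R 0 x) /\<^sub>R h) \<longlongrightarrow> - x) (at_right 0)"
    using generator_tendsto[OF R_0_in_D[of x]] by (simp add: A_R_0)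
  then have "\<forall>\<^sub>F h in at_right 0. dist ((T h (R 0 x) - R 0 x) /\<^sub>R h) (- x) < e"
    using that unfolding tendsto_iff by blast
  then have "\<forall>\<^sub>F h in at_right (0::real). norm (x - R 0 (- ((T h x - x) /\<^sub>R h))) < e"
    using eventually_at_right_less[of 0]
  proof eventually_elim
    case (elim h)
    have "R 0 (- ((T h x - x) /\<^sub>R h)) = - ((T h (R 0 x) - R 0 x) /\<^sub>R h)"
      using elim by (simp add: R0.neg R0.scaleR R0.diff T_R_0)
    with elim show ?case
      by (simp add: dist_norm norm_minus_commute add.commute)
  qed
  then obtain h where "norm (x - R 0 (- ((T h x - x) /\<^sub>R h))) < e"
    using eventually_happens[of _ "at_right (0::real)"] by auto
  then show ?thesis by blast
qed

lemma orbit_functional: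
  fixes L :: "'a \<Rightarrow> real"
  assumes "bounded_linear L"
  shows orbit_functional_measurable: "(\<lambda>t. L (T \<bar>t\<bar> x)) \<in> borel_measurable borel"
    and orbit_functional_bounded: "\<exists>M. \<forall>t. \<bar>L (T \<bar>t\<bar> x)\<bar> \<le> M"
proof -
  interpret L: bounded_linear L by fact
  show "(\<lambda>t. L (T \<bar>t\<bar> x)) \<in> borel_measurable borel"
    by (intro borel_measurable_continuous_onI L.continuous_on continuous_T_abs)
  obtain C where C: "\<And>y. norm (L y) \<le> norm y * C" "C \<ge> 0"
    using L.nonneg_bounded by blast
  have "\<bar>L (T \<bar>t\<bar> x)\<bar> \<le> K * norm x * C" for t
  proof -
    have "\<bar>L (T \<bar>t\<bar> x)\<bar> \<le> norm (T \<bar>t\<bar> x) * C"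
      using C(1)[of "T \<bar>t\<bar> x"] by simp
    also have "\<dots> \<le> K * norm x * C"
      using C(2) by (intro mult_right_mono T_bound) auto
    finally show ?thesis .
  qed
  then show "\<exists>M. \<forall>t. \<bar>L (T \<bar>t\<bar> x)\<bar> \<le> M"
    by blast
qed

section \<open>Additivity and subordination of the shifted powers\<close>

lemma G_add:
  assumes s: "s > 0" and b: "b > 0" and c: "c > 0"
  shows "G s b (G s c x) = G s (b + c) x"
proof (rule functionals_separate)
  fix L :: "'a \<Rightarrow> real"
  assume L: "bounded_linear L"
  define \<phi> where "\<phi> t = L (T \<bar>t\<bar> x)" for t
  have \<phi>_meas: "\<phi> \<in> borel_measurable borel"
    unfolding \<phi>_def[abs_def] by (rule orbit_functional_measurable[OF L])
  obtain M where M: "\<And>t. \<bar>\<phi> t\<bar> \<le> M"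
    using orbit_functional_bounded[OF L, of x] by (auto simp: \<phi>_def)
  note \<Gamma> = Gamma_real_pos[OF b] Gamma_real_pos[OF c]
  let ?h = "\<lambda>t u. gamma_kernel s b t * gamma_kernel s c (u - t)"
  have inner: "gamma_kernel s b t * L (T \<bar>t\<bar> (G s c x)) = (LINT u|lborel. ?h t u * \<phi> u) / Gamma c" for t
  proof (cases "t > 0")
    case False
    then have "gamma_kernel s b t = 0"
      by (simp add: gamma_kernel_def)
    then show ?thesis by simp
  next
    case t: True
    \<comment> \<open>Absorbing \<open>T t\<close> into the functional lets the scalar
      representation act on the inner power; the shift \<open>u = t + r\<close> then exposes the
      convolution.\<close>
    have "bounded_linear (L \<circ> T t)"
      using t by (intro bounded_linear_compose[OF L, unfolded o_def[symmetric]] T_linear) simp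
    from G_functional[OF s c this, of x]
    have "L (T t (G s c x)) = (LINT r|lborel. gamma_kernel s c r * L (T t (T \<bar>r\<bar> x))) / Gamma c"
      by simp
    also have "(LINT r|lborel. gamma_kernel s c r * L (T t (T \<bar>r\<bar> x)))
        = (LINT r|lborel. gamma_kernel s c (t + 1 * r - t) * \<phi> (t + 1 * r))"
    proof (intro Bochner_Integration.integral_cong refl)
      fix r :: real
      show "gamma_kernel s c r * L (T t (T \<bar>r\<bar> x)) = gamma_kernel s c (t + 1 * r - t) * \<phi> (t + 1 * r)"
        using t by (cases "r > 0") (auto simp: \<phi>_def T_add gamma_kernel_def)
    qed
    also have "\<dots> = (LINT u|lborel. gamma_kernel s c (u - t) * \<phi> u)"
      using lborel_integral_real_affine[of 1 "\<lambda>u. gamma_kernel s c (u - t) * \<phi> u" t] by simp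
    finally show ?thesis
      using t by (simp add: mult.assoc)
  qed
  have "L (G s b (G s c x)) = (LINT t|lborel. (LINT u|lborel. ?h t u * \<phi> u)) / Gamma c / Gamma b"
    by (simp add: G_functional[OF s b L] inner)
  also have "(LINT t|lborel. (LINT u|lborel. ?h t u * \<phi> u))
      = (LINT u|lborel. (Beta b c * gamma_kernel s (b + c) u) * \<phi> u)"
  proof (rule lborel_Fubini_bounded[where M=M])
    show "integrable lborel (\<lambda>u. Beta b c * gamma_kernel s (b + c) u)"
      using integrable_gamma_kernel[of s "b + c"] s b c by simp
    show "Beta b c * gamma_kernel s (b + c) u \<ge> 0" for u
      using \<Gamma> Gamma_real_pos[of "b + c"] b c by (simp add: Beta_def)
  qed (use b c M \<phi>_meas nn_integral_gamma_kernel_convolution in auto)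
  also have "\<dots> = Beta b c * (LINT u|lborel. gamma_kernel s (b + c) u * \<phi> u)"
    by (simp add: mult.assoc)
  also have "\<dots> / Gamma c / Gamma b = L (G s (b + c) x)"
    using G_functional[of s "b + c" L x] s b c L \<Gamma>[THEN less_imp_neq] by (simp add: \<phi>_def Beta_def)
  finally show "L (G s b (G s c x)) = L (G s (b + c) x)" .
qed

text \<open>The Laplace integral of \<open>s powr (c - 1)\<close> is
  \<open>Gamma c / t powr c\<close>, so integrating over the shift lowers the exponent from
  \<open>b + c\<close> to \<open>b\<close>. The case \<open>b + c = 1\<close> is Balakrishnan's
  formula; integer \<open>b + c\<close> gives the representation behind the moment
  inequality.\<close>

lemma G_subordination:
  assumes e: "e > 0" and b: "b > 0" and c: "c > 0"
  defines "f \<equiv> \<lambda>x s. s powr (c - 1) *\<^sub>R G (s + e) (b + c) x"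
  shows "f x integrable_on {0<..}"
    and "integral {0<..} (f x) = (Gamma b * Gamma c / Gamma (b + c)) *\<^sub>R G e b x"
proof -
  have contf: "continuous_on {0<..} (f x)"
    unfolding f_def
    by (intro continuous_intros continuous_on_compose2[OF continuous_G[of "b + c" x]])
       (use b c e in auto)
  \<comment> \<open>Here \<open>s + e \<ge> e\<close> removes the singularity of the power at
    \<open>0\<close>; for large \<open>s\<close> the bound \<open>s + e \<ge> s\<close> supplies the
    decay.\<close>
  have small: "norm (f x s) \<le> K * norm x * e powr (- (b + c)) * s powr (c - 1)"
    if "0 < s" for s
  proof -
    have "norm (G (s + e) (b + c) x) \<le> K * norm x * (s + e) powr (- (b + c))"
      using that e b c by (intro norm_G_le) auto
    also have "\<dots> \<le> K * norm x * e powr (- (b + c))"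
      using that e b c K_ge_1 by (intro mult_left_mono powr_mono2') auto
    finally show ?thesis
      by (simp add: f_def mult.commute mult_left_mono)
  qed
  have large: "norm (f x s) \<le> K * norm x * s powr (- b - 1)" if s: "1 \<le> s" for s
  proof -
    have "norm (G (s + e) (b + c) x) \<le> K * norm x * (s + e) powr (- (b + c))"
      using that e b c by (intro norm_G_le) auto
    also have "\<dots> \<le> K * norm x * s powr (- (b + c))"
      using that e b c K_ge_1 by (intro mult_left_mono powr_mono2') auto
    finally have "norm (f x s) \<le> s powr (c - 1) * (K * norm x * s powr (- (b + c)))"
      by (simp add: f_def mult_left_mono)
    also have "\<dots> = K * norm x * s powr (c - 1 + - (b + c))"
      by (simp only: powr_add ac_simps)
    also have "c - 1 + - (b + c) = - b - 1"
      by simp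
    finally show ?thesis .
  qed
  show f: "f x integrable_on {0<..}"
    by (rule split_power_bound(1)[OF contf c b zero_less_one]) (use small large in auto)
  have nf: "(\<lambda>s. norm (f x s)) integrable_on {0<..}"
    by (rule split_power_bound(1)[OF continuous_on_norm[OF contf] c b zero_less_one])
       (use small large in auto)
  note \<Gamma> = Gamma_real_pos[OF b] Gamma_real_pos[OF c]
  have \<Gamma>': "Gamma (b + c) > 0"
    using b c by (intro Gamma_real_pos) simp
  show "integral {0<..} (f x) = (Gamma b * Gamma c / Gamma (b + c)) *\<^sub>R G e b x"
  proof (rule functionals_separate)
    fix L :: "'a \<Rightarrow> real"
    assume L: "bounded_linear L"
    then interpret L: bounded_linear L .
    obtain C where C: "\<And>y. norm (L y) \<le> norm y * C" "C \<ge> 0"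
      using L.nonneg_bounded by blast
    define \<phi> where "\<phi> t = L (T \<bar>t\<bar> x)" for t
    have \<phi>_meas [measurable]: "\<phi> \<in> borel_measurable borel"
      unfolding \<phi>_def[abs_def] by (rule orbit_functional_measurable[OF L])
    obtain M where M: "\<And>t. \<bar>\<phi> t\<bar> \<le> M"
      using orbit_functional_bounded[OF L, of x] by (auto simp: \<phi>_def)
    let ?h = "\<lambda>s t. gamma_kernel e (b + c) t * gamma_kernel t c s"
    have inner: "indicator {0<..} s * L (f x s) = (LINT t|lborel. ?h s t * \<phi> t) / Gamma (b + c)" for s
    proof (cases "s > 0")
      case False
      then show ?thesis by (simp add: gamma_kernel_def)
    next
      case s: True
      have "L (f x s) = s powr (c - 1) * ((LINT t|lborel. gamma_kernel (s + e) (b + c) t * \<phi> t) / Gamma (b + c))"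
        unfolding f_def L.scaleR \<phi>_def using s e b c by (simp add: G_functional[OF _ _ L])
      also have "\<dots> = (LINT t|lborel. s powr (c - 1) * (gamma_kernel (s + e) (b + c) t * \<phi> t)) / Gamma (b + c)"
        by simp
      also have "(LINT t|lborel. s powr (c - 1) * (gamma_kernel (s + e) (b + c) t * \<phi> t))
          = (LINT t|lborel. ?h s t * \<phi> t)"
      proof (intro Bochner_Integration.integral_cong refl)
        fix t :: real
        have "exp (- ((s + e) * t)) = exp (- (e * t)) * exp (- (t * s))"
          by (simp add: algebra_simps flip: exp_add)
        then show "s powr (c - 1) * (gamma_kernel (s + e) (b + c) t * \<phi> t) = ?h s t * \<phi> t"
          using s by (simp add: gamma_kernel_def)
      qed
      finally show ?thesis
        using s by simp
    qed
    have "L (integral {0<..} (f x)) = integral {0<..} (L \<circ> f x)"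
      by (rule integral_linear[OF f L, symmetric])
    also have "\<dots> = (LINT s|lborel. indicator {0<..} s * L (f x s))"
      unfolding o_def
    proof (rule integral_Ioi_eq_lborel)
      show "continuous_on {0<..} (\<lambda>s. L (f x s))"
        by (intro L.continuous_on contf)
      show "(\<lambda>s. norm (f x s) * C) integrable_on {0<..}"
        using integrable_on_mult_left[OF nf] by simp
    qed (use C in auto)
    also have "\<dots> = (LINT s|lborel. (LINT t|lborel. ?h s t * \<phi> t)) / Gamma (b + c)"
      by (simp add: inner)
    also have "(LINT s|lborel. (LINT t|lborel. ?h s t * \<phi> t))
        = (LINT t|lborel. (Gamma c * gamma_kernel e b t) * \<phi> t)"
    proof (rule lborel_Fubini_bounded[where M=M])
      show "case_prod ?h \<in> borel_measurable (lborel \<Otimes>\<^sub>M lborel)"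
        unfolding gamma_kernel_def by measurable
      show "integrable lborel (\<lambda>t. Gamma c * gamma_kernel e b t)"
        using integrable_gamma_kernel[OF e b] by simp
      show "(\<integral>\<^sup>+s. ennreal (?h s t) \<partial>lborel) = ennreal (Gamma c * gamma_kernel e b t)" for t
      proof (cases "t > 0")
        case False
        then have *: "gamma_kernel e (b + c) t = 0" "gamma_kernel e b t = 0"
          by (simp_all add: gamma_kernel_def)
        show ?thesis unfolding * by simp
      next
        case t: True
        have "(\<integral>\<^sup>+s. ennreal (?h s t) \<partial>lborel)
            = (\<integral>\<^sup>+s. ennreal (gamma_kernel e (b + c) t) * ennreal (gamma_kernel t c s) \<partial>lborel)"
          by (simp add: ennreal_mult)
        also have "\<dots> = ennreal (gamma_kernel e (b + c) t) * ennreal (Gamma c / t powr c)"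
          by (subst nn_integral_cmult) (simp_all add: nn_integral_gamma_kernel t c)
        also have "\<dots> = ennreal (gamma_kernel e (b + c) t * (Gamma c / t powr c))"
          using \<Gamma> by (simp flip: ennreal_mult)
        also have "gamma_kernel e (b + c) t * (Gamma c / t powr c) = Gamma c * gamma_kernel e b t"
        proof -
          have "t powr (b + c - 1) = t powr (b - 1) * t powr c"
            by (simp add: add_diff_eq add.commute flip: powr_add)
          then show ?thesis
            using t by (simp add: gamma_kernel_def)
        qed
        finally show ?thesis .
      qed
    qed (use M \<phi>_meas \<Gamma> in auto)
    also have "\<dots> = Gamma c * (LINT t|lborel. gamma_kernel e b t * \<phi> t)"
      by (simp add: mult.assoc)
    also have "(LINT t|lborel. gamma_kernel e b t * \<phi> t) = Gamma b * L (G e b x)"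
      using G_functional[OF e b L, of x] \<Gamma> by (simp add: \<phi>_def)
    finally show "L (integral {0<..} (f x)) = L ((Gamma b * Gamma c / Gamma (b + c)) *\<^sub>R G e b x)"
      by (simp add: L.scaleR)
  qed
qed

text \<open>Subordination with \<open>c = 1 - a\<close>, the reflection formula turning the Gamma
  factors into the constant of \<open>neg_power_frac\<close>. Formally putting \<open>e = 0\<close>
  gives the definition of the fractional power.\<close>

lemma G_Balakrishnan:
  assumes e: "e > 0" and a: "0 < a" "a < 1"
  shows "(\<lambda>s. s powr (- a) *\<^sub>R R (s + e) x) integrable_on {0<..}"
    and "G e a x = (sin (pi * a) / pi) *\<^sub>R integral {0<..} (\<lambda>s. s powr (- a) *\<^sub>R R (s + e) x)"
proof -
  have *: "s powr (1 - a - 1) *\<^sub>R G (s + e) (a + (1 - a)) x = s powr (- a) *\<^sub>R R (s + e) x"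
    if "s \<in> {0<..}" for s
    using that e by (simp add: R_eq_G_one)
  have a': "1 - a > 0" using a by simp
  show "(\<lambda>s. s powr (- a) *\<^sub>R R (s + e) x) integrable_on {0<..}"
    using G_subordination(1)[OF e a(1) a', of x] by (rule integrable_eq) (rule *)
  have "integral {0<..} (\<lambda>s. s powr (- a) *\<^sub>R R (s + e) x)
      = integral {0<..} (\<lambda>s. s powr (1 - a - 1) *\<^sub>R G (s + e) (a + (1 - a)) x)"
    by (rule integral_cong[symmetric]) (rule *)
  also have "\<dots> = (Gamma a * Gamma (1 - a) / Gamma (a + (1 - a))) *\<^sub>R G e a x"
    by (rule G_subordination(2)[OF e a(1) a'])
  also have "Gamma a * Gamma (1 - a) / Gamma (a + (1 - a)) = pi / sin (pi * a)"
    using Gamma_reflection_real[of a] by simp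
  finally show "G e a x = (sin (pi * a) / pi) *\<^sub>R integral {0<..} (\<lambda>s. s powr (- a) *\<^sub>R R (s + e) x)"
    using sin_gt_zero[of "pi * a"] a by simp
qed

subsection \<open>The fractional powers as limits\<close>

abbreviation B :: "real \<Rightarrow> 'a \<Rightarrow> 'a" where
  "B \<equiv> neg_power D A"

lemma B_frac: "0 < a \<Longrightarrow> a < 1 \<Longrightarrow>
    B a x = (sin (pi * a) / pi) *\<^sub>R integral {0<..} (\<lambda>s. s powr (- a) *\<^sub>R R s x)"
  by (simp add: neg_power_def neg_power_frac_def frac_eq R_def floor_eq_iff
      floor_unique[of 0 a, simplified])

lemma B_1: "B 1 x = R 0 x"
  by (simp add: neg_power_def neg_power_frac_def R_def frac_def)

lemma B_add_1: "b \<ge> 0 \<Longrightarrow> B (b + 1) x = R 0 (B b x)"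
  by (simp add: neg_power_def R_def frac_def nat_add_distrib)

lemma continuous_R: "continuous_on {0<..} (\<lambda>s. R s x)"
  using continuous_G[of 1 x] by (rule continuous_on_eq) (simp_all add: R_eq_G_one)

text \<open>A bound uniform in \<open>x\<close> is needed, since \<open>B_add\<close> passes to the
  limit in two factors at once. For \<open>b < 1\<close> the two Balakrishnan integrals are compared
  by the resolvent identity; larger \<open>b\<close> are reached by splitting off one
  resolvent.\<close>

lemma B_approx:
  assumes "b > 0"
  shows "\<exists>M\<ge>0. \<forall>e x. 0 < e \<longrightarrow> e \<le> 1 \<longrightarrow> norm (G e b x - B b x) \<le> M * e * norm x"
proof -
  obtain C where C: "C > 0" "\<And>s x. s \<ge> 0 \<Longrightarrow> norm (R s x) \<le> C * norm x"
    using R_uniform_bound by blast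
  have R_R_0: "norm (R e x - R 0 x) \<le> C * C * e * norm x" if "e > 0" for e x
  proof -
    have "norm (R e (R 0 x)) \<le> C * (C * norm x)"
      using C(2)[of e "R 0 x"] C(2)[of 0 x] C(1) that
      by (meson mult_left_mono less_imp_le order_refl order_trans)
    then show ?thesis
      using that by (simp add: resolvent_identity ac_simps)
  qed
  \<comment> \<open>Induction over the intervals \<open>(n, n + 1]\<close>: the base case then
    contains \<open>b = 1\<close>, and \<open>b - 1\<close> stays positive in the step.\<close>
  have "\<exists>M\<ge>0. \<forall>e x. 0 < e \<longrightarrow> e \<le> 1 \<longrightarrow> norm (G e b x - B b x) \<le> M * e * norm x"
    if "real n < b" "b \<le> real n + 1" for n b
    using that
  proof (induction n arbitrary: b)
    case 0
    show ?case
    proof (cases "b = 1")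
      case True
      then show ?thesis
        using R_R_0 C(1) by (intro exI[of _ "C * C"]) (auto simp: B_1 simp flip: R_eq_G_one)
    next
      case False
      with 0 have b: "0 < b" "b < 1" by auto
      define M where "M = \<bar>sin (pi * b) / pi\<bar> * (C * C / (1 - b) + C * K / b)"
      have "norm (G e b x - B b x) \<le> M * e * norm x" if e: "0 < e" for e x
      proof -
        define f where "f s = s powr (- b) *\<^sub>R R (s + e) x - s powr (- b) *\<^sub>R R s x" for s
        have R_int: "(\<lambda>s. s powr (- b) *\<^sub>R R s x) integrable_on {0<..}"
        proof (rule split_power_bound(1)[where p="1 - b" and q=b and \<tau>=1 and M="C * norm x" and N="K * norm x"])
          show "continuous_on {0<..} (\<lambda>s. s powr (- b) *\<^sub>R R s x)"
            by (intro continuous_intros continuous_R) auto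
          show "norm (s powr (- b) *\<^sub>R R s x) \<le> C * norm x * s powr (1 - b - 1)" if "0 < s" for s
            using C(2)[of s x] that by (simp add: mult.commute mult_left_mono)
          show "norm (s powr (- b) *\<^sub>R R s x) \<le> K * norm x * s powr (- b - 1)" if "1 \<le> s" for s
            using norm_R_le[of s x] that
              mult_left_mono[of "norm (R s x)" "K * norm x / s" "s powr (- b)"]
            by (simp add: powr_diff ac_simps)
        qed (use b in auto)
        have f: "continuous_on {0<..} f"
          unfolding f_def[abs_def]
          by (intro continuous_intros continuous_R continuous_on_compose2[OF continuous_R])
             (use e in auto)
        \<comment> \<open>The resolvent identity extracts the factor \<open>e\<close>; of the two
          resolvents, \<open>R s\<close> also supplies the decay \<open>1 / s\<close> at
          infinity.\<close>
        have f_eq: "f s = - e *\<^sub>R s powr (- b) *\<^sub>R R (s + e) (R s x)" if "s > 0" for s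
          using resolvent_identity[of "s + e" s x] that e
          by (simp add: f_def ac_simps flip: scaleR_diff_right)
        have norm_f: "norm (f s) \<le> e * (s powr (- b) * (C * norm (R s x)))" if "s > 0" for s
          using C(2)[of "s + e" "R s x"] that e
          by (simp add: f_eq mult_left_mono)
        have small: "norm (f s) \<le> C * C * e * norm x * s powr (1 - b - 1)" if "0 < s" for s
        proof -
          have "e * (s powr (- b) * (C * norm (R s x))) \<le> e * (s powr (- b) * (C * (C * norm x)))"
            using C that e by (intro mult_left_mono) auto
          with norm_f[OF that] show ?thesis by (simp add: ac_simps)
        qed
        have large: "norm (f s) \<le> C * K * e * norm x * s powr (- b - 1)" if "1 \<le> s" for s
        proof -
          have "e * (s powr (- b) * (C * norm (R s x))) \<le> e * (s powr (- b) * (C * (K * norm x / s)))"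
            using C(1) norm_R_le[of s x] that e by (intro mult_left_mono) auto
          with norm_f[of s] that show ?thesis by (simp add: ac_simps powr_diff)
        qed
        have "norm (integral {0<..} f)
            \<le> C * C * e * norm x * (1 powr (1 - b) / (1 - b)) + C * K * e * norm x * (1 powr (- b) / b)"
          using b by (intro split_power_bound(2)[OF f _ _ zero_less_one small large]) auto
        also have "\<dots> = (C * C / (1 - b) + C * K / b) * e * norm x"
          by (simp add: algebra_simps)
        finally have *: "norm (integral {0<..} f) \<le> (C * C / (1 - b) + C * K / b) * e * norm x" .
        have "G e b x - B b x = (sin (pi * b) / pi) *\<^sub>R integral {0<..} f"
          unfolding f_def[abs_def] B_frac[OF b]
          by (subst Henstock_Kurzweil_Integration.integral_diff[OF G_Balakrishnan(1)[OF e b] R_int])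
             (simp add: G_Balakrishnan(2)[OF e b] scaleR_diff_right)
        then have "norm (G e b x - B b x) = \<bar>sin (pi * b) / pi\<bar> * norm (integral {0<..} f)"
          by simp
        also have "\<dots> \<le> \<bar>sin (pi * b) / pi\<bar> * ((C * C / (1 - b) + C * K / b) * e * norm x)"
          using * by (rule mult_left_mono) simp
        finally show ?thesis
          by (simp add: M_def mult.assoc)
      qed
      moreover have "M \<ge> 0"
        using C(1) K_ge_1 b by (simp add: M_def)
      ultimately show ?thesis by blast
    qed
  next
    case (Suc n)
    have b: "b - 1 > 0"
      using Suc.prems by simp
    from Suc.IH[of "b - 1"] Suc.prems obtain M where M: "M \<ge> 0"
        "\<And>e x. 0 < e \<Longrightarrow> e \<le> 1 \<Longrightarrow> norm (G e (b - 1) x - B (b - 1) x) \<le> M * e * norm x"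
      by auto
    have "norm (G e b x - B b x) \<le> (C * M + C * C * (K + M)) * e * norm x" if e: "0 < e" "e \<le> 1" for e x
    proof -
      interpret Re: bounded_linear "R e"
        using e by (intro R_linear) simp
      have "norm (B (b - 1) x) \<le> norm (G 1 (b - 1) x) + norm (G 1 (b - 1) x - B (b - 1) x)"
        using norm_triangle_ineq4[of "G 1 (b - 1) x" "G 1 (b - 1) x - B (b - 1) x"] by simp
      also have "\<dots> \<le> (K + M) * norm x"
        using norm_G_le[of 1 "b - 1" x] M(2)[of 1 x] b by (simp add: algebra_simps)
      finally have Bx: "norm (B (b - 1) x) \<le> (K + M) * norm x" .
      have "G e b x = R e (G e (b - 1) x)"
        using G_add[of e 1 "b - 1" x] e b by (simp add: R_eq_G_one)
      moreover have "B b x = R 0 (B (b - 1) x)"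
        using B_add_1[of "b - 1" x] b by simp
      ultimately have "G e b x - B b x
          = R e (G e (b - 1) x - B (b - 1) x) + (R e (B (b - 1) x) - R 0 (B (b - 1) x))"
        by (simp add: Re.diff)
      also have "norm \<dots> \<le> C * (M * e * norm x) + C * C * e * ((K + M) * norm x)"
      proof (rule norm_triangle_le, rule add_mono)
        show "norm (R e (G e (b - 1) x - B (b - 1) x)) \<le> C * (M * e * norm x)"
          using C(2)[of e] M(2)[OF e, of x] C(1) e
          by (meson less_imp_le mult_left_mono order_trans)
        show "norm (R e (B (b - 1) x) - R 0 (B (b - 1) x)) \<le> C * C * e * ((K + M) * norm x)"
          by (rule order_trans[OF R_R_0[OF e(1)] mult_left_mono[OF Bx]]) (use C(1) e in simp)
      qed
      finally show ?thesis
        by (simp add: algebra_simps)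
    qed
    moreover have "C * M + C * C * (K + M) \<ge> 0"
      using C(1) M(1) K_ge_1 by simp
    ultimately show ?case by blast
  qed
  moreover have "real (nat (\<lceil>b\<rceil> - 1)) = of_int \<lceil>b\<rceil> - 1"
    using assms by simp
  ultimately show ?thesis
    using ceiling_correct[of b] by (metis diff_add_cancel)
qed

lemma B_tendsto:
  assumes "b > 0"
  shows "((\<lambda>e. G e b x) \<longlongrightarrow> B b x) (at_right 0)"
proof -
  obtain M where M: "\<And>e x. 0 < e \<Longrightarrow> e \<le> 1 \<Longrightarrow> norm (G e b x - B b x) \<le> M * e * norm x"
    using B_approx[OF assms] by blast
  have "((\<lambda>e. M * e * norm x) \<longlongrightarrow> M * 0 * norm x) (at_right 0)"
    by (intro tendsto_intros)
  then have "((\<lambda>e. M * e * norm x) \<longlongrightarrow> 0) (at_right 0)"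
    by simp
  moreover have "\<forall>\<^sub>F e in at_right 0. norm (G e b x - B b x) \<le> M * e * norm x"
    unfolding eventually_at_right_field using M by (intro exI[of _ 1]) auto
  ultimately have "((\<lambda>e. G e b x - B b x) \<longlongrightarrow> 0) (at_right 0)"
    by (rule Lim_null_comparison[rotated])
  then show ?thesis
    by (simp add: LIM_zero_iff)
qed

lemma B_linear:
  assumes "b > 0"
  shows "bounded_linear (B b)"
proof -
  have ev: "\<forall>\<^sub>F e in at_right (0::real). bounded_linear (G e b)"
    using eventually_at_right_less[of 0] by eventually_elim (use assms in \<open>simp add: G_linear\<close>)
  obtain M where M: "M \<ge> 0" "\<And>e x. 0 < e \<Longrightarrow> e \<le> 1 \<Longrightarrow> norm (G e b x - B b x) \<le> M * e * norm x"
    using B_approx[OF assms] by blast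
  show ?thesis
  proof (rule bounded_linear_intro)
    fix x y r
    have "((\<lambda>e. G e b (x + y)) \<longlongrightarrow> B b x + B b y) (at_right 0)"
    proof (rule Lim_transform_eventually)
      show "((\<lambda>e. G e b x + G e b y) \<longlongrightarrow> B b x + B b y) (at_right 0)"
        by (intro tendsto_intros B_tendsto assms)
      show "\<forall>\<^sub>F e in at_right 0. G e b x + G e b y = G e b (x + y)"
        using ev by eventually_elim (simp add: linear_add[OF bounded_linear.linear])
    qed
    from tendsto_unique[OF _ B_tendsto[OF assms] this] show "B b (x + y) = B b x + B b y"
      by simp
    have "((\<lambda>e. G e b (r *\<^sub>R x)) \<longlongrightarrow> r *\<^sub>R B b x) (at_right 0)"
    proof (rule Lim_transform_eventually)
      show "((\<lambda>e. r *\<^sub>R G e b x) \<longlongrightarrow> r *\<^sub>R B b x) (at_right 0)"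
        by (intro tendsto_intros B_tendsto assms)
      show "\<forall>\<^sub>F e in at_right 0. r *\<^sub>R G e b x = G e b (r *\<^sub>R x)"
        using ev by eventually_elim (simp add: linear_scale[OF bounded_linear.linear])
    qed
    from tendsto_unique[OF _ B_tendsto[OF assms] this] show "B b (r *\<^sub>R x) = r *\<^sub>R B b x"
      by simp
    have "norm (B b x) \<le> norm (G 1 b x) + norm (G 1 b x - B b x)"
      using norm_triangle_ineq4[of "G 1 b x" "G 1 b x - B b x"] by simp
    also have "\<dots> \<le> norm x * (K + M)"
      using norm_G_le[of 1 b x] M(2)[of 1 x] assms by (simp add: algebra_simps)
    finally show "norm (B b x) \<le> norm x * (K + M)" .
  qed
qed

lemma T_B:
  assumes "b > 0" "t \<ge> 0"
  shows "B b (T t x) = T t (B b x)"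
proof -
  have "((\<lambda>e. T t (G e b x)) \<longlongrightarrow> T t (B b x)) (at_right 0)"
    by (intro bounded_linear.tendsto[OF T_linear] B_tendsto assms)
  moreover have "\<forall>\<^sub>F e in at_right 0. T t (G e b x) = G e b (T t x)"
    using eventually_at_right_less[of 0]
    by eventually_elim (intro G_commute T_linear T_commute; use assms in simp)
  ultimately have "((\<lambda>e. G e b (T t x)) \<longlongrightarrow> T t (B b x)) (at_right 0)"
    by (rule Lim_transform_eventually)
  from tendsto_unique[OF _ B_tendsto[OF assms(1)] this] show ?thesis
    by simp
qed

text \<open>Additivity of \<open>G e\<close> survives \<open>e \<rightarrow> 0\<close> because the
  operators \<open>G e b\<close> with \<open>e \<le> 1\<close> are bounded by the common constant
  \<open>C + M\<close>.\<close>

lemma B_add: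
  assumes b: "b > 0" and c: "c > 0"
  shows "B b (B c x) = B (b + c) x"
proof -
  obtain M where M: "M \<ge> 0" "\<And>e x. 0 < e \<Longrightarrow> e \<le> 1 \<Longrightarrow> norm (G e b x - B b x) \<le> M * e * norm x"
    using B_approx[OF b] by blast
  obtain C where C: "C > 0" "\<And>x. norm (B b x) \<le> norm x * C"
    using bounded_linear.pos_bounded[OF B_linear[OF b]] by blast
  have "((\<lambda>e. (C + M) * norm (G e c x - B c x) + norm (G e b (B c x) - B b (B c x)))
      \<longlongrightarrow> (C + M) * norm (B c x - B c x) + norm (B b (B c x) - B b (B c x))) (at_right 0)"
    by (intro tendsto_intros B_tendsto b c)
  then have lim: "((\<lambda>e. (C + M) * norm (G e c x - B c x) + norm (G e b (B c x) - B b (B c x)))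
      \<longlongrightarrow> 0) (at_right 0)"
    by simp
  have "\<forall>\<^sub>F e in at_right 0. norm (G e (b + c) x - B b (B c x))
      \<le> (C + M) * norm (G e c x - B c x) + norm (G e b (B c x) - B b (B c x))"
    unfolding eventually_at_right_field
  proof (intro exI[of _ 1] conjI allI impI)
    fix e :: real assume e: "0 < e" "e < 1"
    let ?y = "G e c x - B c x"
    have "norm (G e b ?y) \<le> norm (B b ?y) + norm (G e b ?y - B b ?y)"
      using norm_triangle_ineq[of "B b ?y" "G e b ?y - B b ?y"] by simp
    also have "norm (G e b ?y - B b ?y) \<le> M * 1 * norm ?y"
      using M(2)[of e ?y] M(1) e mult_right_mono[of "M * e" "M * 1" "norm ?y"]
      by (simp add: mult_left_le)
    finally have *: "norm (G e b ?y) \<le> (C + M) * norm ?y"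
      using C(2)[of ?y] by (simp add: algebra_simps)
    have eq: "G e (b + c) x - B b (B c x) = G e b ?y + (G e b (B c x) - B b (B c x))"
      using G_add[of e b c x] e b c linear_diff[OF bounded_linear.linear[OF G_linear[of e b]]] by simp
    show "norm (G e (b + c) x - B b (B c x))
        \<le> (C + M) * norm ?y + norm (G e b (B c x) - B b (B c x))"
      unfolding eq by (intro norm_triangle_le add_right_mono *)
  qed simp
  from Lim_null_comparison[OF this lim] have "((\<lambda>e. G e (b + c) x) \<longlongrightarrow> B b (B c x)) (at_right 0)"
    by (simp add: LIM_zero_iff)
  from tendsto_unique[OF _ this B_tendsto] show ?thesis
    using b c by simp
qed

subsection \<open>A moment inequality\<close>

text \<open>\<open>V e s\<close> is \<open>(e - A) R (s + e)\<close>, bounded uniformly in \<open>e\<close> and \<open>s\<close>.\<close>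

definition V :: "real \<Rightarrow> real \<Rightarrow> 'a \<Rightarrow> 'a" where
  "V e s y = y - s *\<^sub>R R (s + e) y"

lemma V_linear: "e > 0 \<Longrightarrow> s > 0 \<Longrightarrow> bounded_linear (V e s)"
  unfolding V_def
  by (intro bounded_linear_sub bounded_linear_ident bounded_linear_const_scaleR R_linear) auto

lemma V_T: "e > 0 \<Longrightarrow> s > 0 \<Longrightarrow> t \<ge> 0 \<Longrightarrow> V e s (T t x) = T t (V e s x)"
  by (simp add: V_def T_diff T_scaleR T_R)

lemma norm_R_shift_le:
  assumes "e > 0" "s > 0"
  shows "norm (R (s + e) x) \<le> K * norm x / s"
proof -
  have "norm (R (s + e) x) \<le> K * norm x / (s + e)"
    using assms by (intro norm_R_le) simp
  also have "\<dots> \<le> K * norm x / s"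
    using assms K_ge_1 by (intro divide_left_mono) auto
  finally show ?thesis .
qed

lemma norm_V_le:
  assumes "e > 0" "s > 0"
  shows "norm (V e s x) \<le> (1 + K) * norm x"
proof -
  have "norm (V e s x) \<le> norm x + norm (s *\<^sub>R R (s + e) x)"
    unfolding V_def by (rule norm_triangle_ineq4)
  also have "norm (s *\<^sub>R R (s + e) x) \<le> K * norm x"
    using norm_R_shift_le[OF assms, of x] assms by (simp add: field_simps)
  finally show ?thesis
    by (simp add: algebra_simps)
qed

text \<open>The operator \<open>(e - A) R (s + e) R (r + e)\<close> is symmetric in \<open>r\<close>
  and \<open>s\<close>, so \<open>e - A\<close> may be attached to either resolvent.\<close>

lemma V_R:
  assumes "e > 0" "s > 0" "r \<ge> 0"
  shows "V e s (R (r + e) y) = R (s + e) (y - r *\<^sub>R R (r + e) y)"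
proof -
  interpret Rs: bounded_linear "R (s + e)"
    using assms by (intro R_linear) simp
  define X where "X = R (s + e) (R (r + e) y)"
  have "(r - s) *\<^sub>R X = R (s + e) y - R (r + e) y"
    using resolvent_identity[of "s + e" "r + e" y] assms by (simp add: X_def)
  then have eq: "R (r + e) y = R (s + e) y - (r - s) *\<^sub>R X"
    by simp
  have "V e s (R (r + e) y) = R (r + e) y - s *\<^sub>R X"
    by (simp add: V_def X_def)
  also have "\<dots> = R (s + e) y - r *\<^sub>R X"
    by (subst eq) (simp add: scaleR_diff_left)
  also have "\<dots> = R (s + e) (y - r *\<^sub>R R (r + e) y)"
    by (simp add: X_def Rs.diff Rs.scaleR)
  finally show ?thesis .
qed

text \<open>In the Balakrishnan integral, \<open>e - A\<close> is attached to
  \<open>R (r + e)\<close> for \<open>r \<le> s\<close>, leaving \<open>K / s\<close>, and to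
  \<open>R (s + e)\<close> for \<open>r \<ge> s\<close>, leaving \<open>K / r\<close>. Splitting at
  \<open>r = s\<close> gives the homogeneous order \<open>s powr (- a)\<close>.\<close>

lemma norm_V_G_le:
  assumes a: "0 < a" "a < 1"
  shows "\<exists>C\<ge>0. \<forall>e s y. 0 < e \<longrightarrow> 0 < s \<longrightarrow> norm (V e s (G e a y)) \<le> C * s powr (- a) * norm y"
proof -
  define C where "C = \<bar>sin (pi * a) / pi\<bar> * (K * (1 + K) * (1 / (1 - a) + 1 / a))"
  have "norm (V e s (G e a y)) \<le> C * s powr (- a) * norm y" if e: "0 < e" and s: "0 < s" for e s y
  proof -
    interpret V: bounded_linear "V e s" by (rule V_linear[OF e s])
    define f where "f r = r powr (- a) *\<^sub>R V e s (R (r + e) y)" for r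
    have "V e s (G e a y) = (sin (pi * a) / pi) *\<^sub>R
        V e s (integral {0<..} (\<lambda>r. r powr (- a) *\<^sub>R R (r + e) y))"
      by (subst G_Balakrishnan(2)[OF e a]) (simp add: V.scaleR)
    also have "V e s (integral {0<..} (\<lambda>r. r powr (- a) *\<^sub>R R (r + e) y)) = integral {0<..} f"
      using integral_linear[OF G_Balakrishnan(1)[OF e a] V_linear[OF e s], of y]
      by (simp add: o_def f_def[abs_def] V.scaleR)
    finally have eq: "V e s (G e a y) = (sin (pi * a) / pi) *\<^sub>R integral {0<..} f" .
    have f: "continuous_on {0<..} f"
      unfolding f_def[abs_def]
      by (intro continuous_intros V.continuous_on continuous_on_compose2[OF continuous_R]) (use e in auto)
    have "norm (integral {0<..} f) \<le> K * (1 + K) * norm y / s * (s powr (1 - a) / (1 - a))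
        + K * (1 + K) * norm y * (s powr (- a) / a)"
    proof (rule split_power_bound(2)[OF f])
      fix r :: real assume r: "0 < r"
      have "norm (y - r *\<^sub>R R (r + e) y) \<le> (1 + K) * norm y"
        using norm_V_le[OF e r, of y] by (simp add: V_def)
      then have "K * norm (y - r *\<^sub>R R (r + e) y) / s \<le> K * ((1 + K) * norm y) / s"
        using K_ge_1 s by (intro divide_right_mono mult_left_mono) auto
      then have *: "norm (V e s (R (r + e) y)) \<le> K * (1 + K) * norm y / s"
        using norm_R_shift_le[OF e s, of "y - r *\<^sub>R R (r + e) y"] V_R[OF e s, of r y] r by simp
      show "norm (f r) \<le> K * (1 + K) * norm y / s * r powr (1 - a - 1)"
        using mult_left_mono[OF *, of "r powr (- a)"] by (simp add: f_def mult.commute)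
    next
      fix r assume "s \<le> r"
      then have r: "r > 0" using s by simp
      have "norm (V e s (R (r + e) y)) \<le> (1 + K) * norm (R (r + e) y)"
        by (rule norm_V_le[OF e s])
      also have "\<dots> \<le> (1 + K) * (K * norm y / r)"
        using K_ge_1 by (intro mult_left_mono norm_R_shift_le[OF e r]) auto
      finally have "r powr (- a) * norm (V e s (R (r + e) y)) \<le> r powr (- a) * ((1 + K) * (K * norm y / r))"
        by (rule mult_left_mono) simp
      also have "\<dots> = K * (1 + K) * norm y * r powr (- a - 1)"
        using r by (simp add: powr_diff)
      finally show "norm (f r) \<le> K * (1 + K) * norm y * r powr (- a - 1)"
        by (simp add: f_def)
    qed (use a s in auto)
    also have "\<dots> = K * (1 + K) * (1 / (1 - a) + 1 / a) * s powr (- a) * norm y"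
    proof -
      have "s powr (1 - a) = s * s powr (- a)"
        using s powr_add[of s 1 "- a"] by simp
      then show ?thesis
        using s by (simp add: algebra_simps add_divide_distrib)
    qed
    finally have "norm (integral {0<..} f) \<le> K * (1 + K) * (1 / (1 - a) + 1 / a) * s powr (- a) * norm y" .
    then have "\<bar>sin (pi * a) / pi\<bar> * norm (integral {0<..} f) \<le>
        \<bar>sin (pi * a) / pi\<bar> * (K * (1 + K) * (1 / (1 - a) + 1 / a) * s powr (- a) * norm y)"
      by (rule mult_left_mono) simp
    then show ?thesis
      unfolding eq by (simp only: norm_scaleR C_def mult.assoc)
  qed
  moreover have "C \<ge> 0"
    using a K_ge_1 by (simp add: C_def)
  ultimately show ?thesis by blast
qed

text \<open>Since \<open>R (s + e) = V e s (G e 1)\<close>, each unit of \<open>\<beta>\<close> can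
  be traded for one bounded factor \<open>V e s\<close>. What remains is
  \<open>0 < \<beta> \<le> 1\<close>, where the complementary power \<open>1 - \<beta>\<close> is
  handled by \<open>norm_V_G_le\<close>.\<close>

lemma norm_G_shift_le:
  assumes "real n < \<beta>" "\<beta> \<le> real n + 1"
  shows "\<exists>C\<ge>0. \<forall>e s x. 0 < e \<longrightarrow> 0 < s \<longrightarrow>
    norm (G (s + e) (real n + 1) x) \<le> C * s powr (\<beta> - (real n + 1)) * norm (G e \<beta> x)"
  using assms
proof (induction n arbitrary: \<beta>)
  case 0
  have G_V: "G (s + e) 1 x = V e s (G e 1 x)" if "0 < e" "0 < s" for e s x
    using resolvent_identity[of "s + e" e x] that
    by (simp add: V_def algebra_simps flip: R_eq_G_one)
  show ?case
  proof (cases "\<beta> = 1")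
    case True
    show ?thesis
      using K_ge_1 norm_V_le by (intro exI[of _ "1 + K"]) (simp add: True G_V)
  next
    case False
    with 0 have \<beta>: "0 < \<beta>" "\<beta> < 1" by auto
    with norm_V_G_le[of "1 - \<beta>"] obtain C where C: "C \<ge> 0"
        "\<And>e s y. 0 < e \<Longrightarrow> 0 < s \<Longrightarrow> norm (V e s (G e (1 - \<beta>) y)) \<le> C * s powr (- (1 - \<beta>)) * norm y"
      by auto
    have "norm (G (s + e) 1 x) \<le> C * s powr (\<beta> - 1) * norm (G e \<beta> x)" if "0 < e" "0 < s" for e s x
      using C(2)[OF that, of "G e \<beta> x"] G_V[OF that, of x] G_add[of e "1 - \<beta>" \<beta> x] that \<beta> by simp
    with C(1) show ?thesis by auto
  qed
next
  case (Suc n)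
  from Suc.IH[of "\<beta> - 1"] Suc.prems obtain C where C: "C \<ge> 0"
    "\<And>e s x. 0 < e \<Longrightarrow> 0 < s \<Longrightarrow>
      norm (G (s + e) (real n + 1) x) \<le> C * s powr (\<beta> - 1 - (real n + 1)) * norm (G e (\<beta> - 1) x)"
    by auto
  have \<beta>: "\<beta> - 1 > 0"
    using Suc.prems by simp
  have "norm (G (s + e) (real (Suc n) + 1) x) \<le> C * (1 + K) * s powr (\<beta> - (real (Suc n) + 1)) * norm (G e \<beta> x)"
    if es: "0 < e" "0 < s" for e s x
  proof -
    define y where "y = V e s (G e 1 x)"
    have "G (s + e) 1 x = y"
      using resolvent_identity[of "s + e" e x] es
      by (simp add: y_def V_def algebra_simps flip: R_eq_G_one)
    then have "G (s + e) (real (Suc n) + 1) x = G (s + e) (real n + 1) y"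
      using G_add[of "s + e" "real n + 1" 1 x] es by (simp add: add.commute add.left_commute)
    moreover have "G e (\<beta> - 1) y = V e s (G e \<beta> x)"
      using G_commute[OF es(1) \<beta> V_linear[OF es] V_T[OF es], of "G e 1 x"] G_add[of e "\<beta> - 1" 1 x] es \<beta>
      by (simp add: y_def)
    ultimately have "norm (G (s + e) (real (Suc n) + 1) x)
        \<le> C * s powr (\<beta> - 1 - (real n + 1)) * norm (V e s (G e \<beta> x))"
      using C(2)[OF es, of y] by simp
    also have "\<dots> \<le> C * s powr (\<beta> - 1 - (real n + 1)) * ((1 + K) * norm (G e \<beta> x))"
      using C(1) by (intro mult_left_mono norm_V_le es) auto
    finally show ?thesis
      by (simp add: algebra_simps)
  qed
  moreover have "C * (1 + K) \<ge> 0"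
    using C(1) K_ge_1 by simp
  ultimately show ?case by blast
qed

text \<open>The subordination integral for \<open>G e b x\<close> is split at \<open>\<tau>\<close>:
  small shifts are controlled by \<open>G e \<beta> x\<close>, large ones by \<open>x\<close>. The
  free \<open>\<tau>\<close> is later a power of time.\<close>

lemma moment_inequality_G:
  assumes b: "0 < b" "b < \<beta>"
  shows "\<exists>C\<ge>0. \<forall>e \<tau> x. 0 < e \<longrightarrow> 0 < \<tau> \<longrightarrow>
    norm (G e b x) \<le> C * (\<tau> powr (\<beta> - b) * norm (G e \<beta> x) + \<tau> powr (- b) * norm x)"
proof -
  define n where "n = nat (\<lceil>\<beta>\<rceil> - 1)"
  have "real n = of_int \<lceil>\<beta>\<rceil> - 1"
    using b by (simp add: n_def)
  then have n: "real n < \<beta>" "\<beta> \<le> real n + 1"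
    using ceiling_correct[of \<beta>] by auto
  \<comment> \<open>Chosen so that \<open>b + c\<close> is the integer \<open>n + 1\<close> to which
    \<open>norm_G_shift_le\<close> applies.\<close>
  define c where "c = real n + 1 - b"
  have c: "c > 0" "b + c = real n + 1"
    using n b by (auto simp: c_def)
  from norm_G_shift_le[OF n] obtain C where C: "C \<ge> 0"
    "\<And>e s x. 0 < e \<Longrightarrow> 0 < s \<Longrightarrow>
      norm (G (s + e) (b + c) x) \<le> C * s powr (\<beta> - (b + c)) * norm (G e \<beta> x)"
    unfolding c(2) by blast
  define E where "E = Gamma (b + c) / (Gamma b * Gamma c)"
  have E: "E \<ge> 0"
    using b c(1) by (simp add: E_def)
  have \<Gamma>: "Gamma b \<noteq> 0" "Gamma c \<noteq> 0" "Gamma (b + c) \<noteq> 0"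
    using b(1) c(1) Gamma_real_pos[of b] Gamma_real_pos[of c] Gamma_real_pos[of "b + c"] by linarith+
  have "norm (G e b x) \<le> E * (C / (\<beta> - b) + K / b) * (\<tau> powr (\<beta> - b) * norm (G e \<beta> x) + \<tau> powr (- b) * norm x)"
    if e: "0 < e" and \<tau>: "0 < \<tau>" for e \<tau> x
  proof -
    define f where "f s = s powr (c - 1) *\<^sub>R G (s + e) (b + c) x" for s
    have contf: "continuous_on {0<..} f"
      unfolding f_def[abs_def]
      by (intro continuous_intros continuous_on_compose2[OF continuous_G[of "b + c" x]])
         (use b c e in auto)
    have "norm (integral {0<..} f) \<le> C * norm (G e \<beta> x) * (\<tau> powr (\<beta> - b) / (\<beta> - b))
        + K * norm x * (\<tau> powr (- b) / b)"
    proof (rule split_power_bound(2)[OF contf])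
      fix s :: real assume s: "0 < s"
      have "norm (f s) \<le> s powr (c - 1) * (C * s powr (\<beta> - (b + c)) * norm (G e \<beta> x))"
        using C(2)[OF e s, of x] by (simp add: f_def mult_left_mono)
      also have "\<dots> = C * norm (G e \<beta> x) * s powr (c - 1 + (\<beta> - (b + c)))"
        by (simp only: powr_add ac_simps)
      also have "c - 1 + (\<beta> - (b + c)) = \<beta> - b - 1"
        by simp
      finally show "norm (f s) \<le> C * norm (G e \<beta> x) * s powr (\<beta> - b - 1)" .
    next
      fix s assume "\<tau> \<le> s"
      then have s: "s > 0" using \<tau> by simp
      have "norm (G (s + e) (b + c) x) \<le> K * norm x * (s + e) powr (- (b + c))"
        using s e b c by (intro norm_G_le) auto
      also have "\<dots> \<le> K * norm x * s powr (- (b + c))"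
        using s e b c K_ge_1 by (intro mult_left_mono powr_mono2') auto
      finally have "norm (f s) \<le> s powr (c - 1) * (K * norm x * s powr (- (b + c)))"
        by (simp add: f_def mult_left_mono)
      also have "\<dots> = K * norm x * s powr (c - 1 + - (b + c))"
        by (simp only: powr_add ac_simps)
      also have "c - 1 + - (b + c) = - b - 1"
        by simp
      finally show "norm (f s) \<le> K * norm x * s powr (- b - 1)" .
    qed (use b \<tau> in auto)
    also have "\<dots> \<le> (C / (\<beta> - b) + K / b) * (\<tau> powr (\<beta> - b) * norm (G e \<beta> x) + \<tau> powr (- b) * norm x)"
    proof -
      have "0 \<le> C / (\<beta> - b) * (\<tau> powr (- b) * norm x)"
        "0 \<le> K / b * (\<tau> powr (\<beta> - b) * norm (G e \<beta> x))"
        using C(1) K_ge_1 b by auto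
      then show ?thesis
        by (simp add: algebra_simps)
    qed
    finally have *: "norm (integral {0<..} f)
      \<le> (C / (\<beta> - b) + K / b) * (\<tau> powr (\<beta> - b) * norm (G e \<beta> x) + \<tau> powr (- b) * norm x)" .
    have "G e b x = E *\<^sub>R integral {0<..} f"
      unfolding f_def[abs_def] G_subordination(2)[OF e b(1) c(1)] using \<Gamma> by (simp add: E_def)
    then have "norm (G e b x) = E * norm (integral {0<..} f)"
      using E by simp
    then show ?thesis
      using mult_left_mono[OF * E] by (simp add: mult.assoc)
  qed
  moreover have "E * (C / (\<beta> - b) + K / b) \<ge> 0"
    using E C(1) K_ge_1 b by simp
  ultimately show ?thesis by blast
qed

lemma moment_inequality:
  assumes b: "0 < b" "b < \<beta>"
  shows "\<exists>C\<ge>0. \<forall>\<tau> x. 0 < \<tau> \<longrightarrow>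
    norm (B b x) \<le> C * (\<tau> powr (\<beta> - b) * norm (B \<beta> x) + \<tau> powr (- b) * norm x)"
proof -
  from moment_inequality_G[OF b] obtain C where C: "C \<ge> 0"
    "\<And>e \<tau> x. 0 < e \<Longrightarrow> 0 < \<tau> \<Longrightarrow>
      norm (G e b x) \<le> C * (\<tau> powr (\<beta> - b) * norm (G e \<beta> x) + \<tau> powr (- b) * norm x)"
    by blast
  have "norm (B b x) \<le> C * (\<tau> powr (\<beta> - b) * norm (B \<beta> x) + \<tau> powr (- b) * norm x)" if \<tau>: "0 < \<tau>" for \<tau> x
  proof (rule tendsto_le)
    show "((\<lambda>e. norm (G e b x)) \<longlongrightarrow> norm (B b x)) (at_right 0)"
      using b by (intro tendsto_intros B_tendsto)
    show "((\<lambda>e. C * (\<tau> powr (\<beta> - b) * norm (G e \<beta> x) + \<tau> powr (- b) * norm x))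
        \<longlongrightarrow> C * (\<tau> powr (\<beta> - b) * norm (B \<beta> x) + \<tau> powr (- b) * norm x)) (at_right 0)"
      by (rule tendsto_mult[OF tendsto_const tendsto_add[OF tendsto_mult[OF tendsto_const tendsto_norm] tendsto_const]])
         (use b in \<open>auto intro: B_tendsto\<close>)
    show "\<forall>\<^sub>F e in at_right 0. norm (G e b x) \<le> C * (\<tau> powr (\<beta> - b) * norm (G e \<beta> x) + \<tau> powr (- b) * norm x)"
      using eventually_at_right_less[of 0] by eventually_elim (use C(2) \<tau> in simp)
  qed simp
  with C(1) show ?thesis by blast
qed

subsection \<open>Rates of decay\<close>

text \<open>Stated on vectors, so that rates compose by substitution; \<open>t0 \<ge> 1\<close>
  keeps powers of \<open>t\<close> unproblematic.\<close>

definition decays :: "real \<Rightarrow> (real \<Rightarrow> real) \<Rightarrow> bool" where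
  "decays b h \<longleftrightarrow> (\<exists>c\<ge>0. \<exists>t0\<ge>1. \<forall>t\<ge>t0. \<forall>x. norm (T t (B b x)) \<le> c * h t * norm x)"

lemma decays_mono:
  assumes "decays b g" and "C \<ge> 0" and "t1 \<ge> 1" and "\<And>t. t \<ge> t1 \<Longrightarrow> g t \<le> C * h t"
  shows "decays b h"
proof -
  obtain c t0 where *: "c \<ge> 0" "t0 \<ge> 1" "\<And>t x. t \<ge> t0 \<Longrightarrow> norm (T t (B b x)) \<le> c * g t * norm x"
    using assms(1) by (auto simp: decays_def)
  have "norm (T t (B b x)) \<le> (c * C) * h t * norm x" if "t \<ge> max t0 t1" for t x
  proof -
    have "c * g t * norm x \<le> c * (C * h t) * norm x"
      using assms(4)[of t] *(1) that by (intro mult_right_mono mult_left_mono) auto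
    then show ?thesis
      using *(3)[of t x] that by (simp add: mult.assoc)
  qed
  moreover have "c * C \<ge> 0" "max t0 t1 \<ge> 1"
    using * assms by auto
  ultimately show ?thesis
    unfolding decays_def by blast
qed

text \<open>Half of the time is spent on each factor, since \<open>T (t / 2)\<close> commutes with
  \<open>B b\<close>.\<close>

lemma decays_add:
  assumes b: "b > 0" "b' > 0" and "decays b g" "decays b' h" and g: "\<And>t. g t \<ge> 0"
  shows "decays (b + b') (\<lambda>t. g (t / 2) * h (t / 2))"
proof -
  obtain c t0 where 1: "c \<ge> 0" "t0 \<ge> 1" "\<And>t x. t \<ge> t0 \<Longrightarrow> norm (T t (B b x)) \<le> c * g t * norm x"
    using assms(3) by (auto simp: decays_def)
  obtain c' t0' where 2: "c' \<ge> 0" "t0' \<ge> 1" "\<And>t x. t \<ge> t0' \<Longrightarrow> norm (T t (B b' x)) \<le> c' * h t * norm x"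
    using assms(4) by (auto simp: decays_def)
  have "norm (T t (B (b + b') x)) \<le> (c * c') * (g (t / 2) * h (t / 2)) * norm x"
    if t: "t \<ge> 2 * max t0 t0'" for t x
  proof -
    have t2: "t / 2 \<ge> 0" "t / 2 \<ge> t0" "t / 2 \<ge> t0'"
      using t 1(2) 2(2) by auto
    have "T t (B (b + b') x) = T (t / 2) (T (t / 2) (B b (B b' x)))"
      using T_add[OF t2(1) t2(1)] B_add[OF b] by simp
    also have "\<dots> = T (t / 2) (B b (T (t / 2) (B b' x)))"
      by (simp only: T_B[OF b(1) t2(1)])
    finally have "norm (T t (B (b + b') x)) \<le> c * g (t / 2) * norm (T (t / 2) (B b' x))"
      using 1(3)[OF t2(2)] by simp
    also have "\<dots> \<le> c * g (t / 2) * (c' * h (t / 2) * norm x)"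
      using 1(1) g 2(3)[OF t2(3)] by (intro mult_left_mono) auto
    finally show ?thesis
      by (simp add: ac_simps)
  qed
  moreover have "c * c' \<ge> 0" "2 * max t0 t0' \<ge> 1"
    using 1 2 by auto
  ultimately show ?thesis
    unfolding decays_def by blast
qed

lemma decays_power_mult:
  assumes "b > 0" and "decays b (\<lambda>t. t powr (- p))"
  shows "decays (real (Suc n) * b) (\<lambda>t. t powr (- (real (Suc n) * p)))"
proof (induction n)
  case 0
  then show ?case using assms by simp
next
  case (Suc n)
  define q where "q = real (Suc n) * p"
  have "real (Suc n) * b > 0"
    using assms(1) by simp
  from decays_add[OF this assms(1) Suc.IH assms(2)]
  have "decays (real (Suc n) * b + b) (\<lambda>t. (t / 2) powr (- q) * (t / 2) powr (- p))"
    by (simp add: q_def)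
  then have "decays (real (Suc n) * b + b) (\<lambda>t. t powr (- (q + p)))"
  proof (rule decays_mono[where C="2 powr (q + p)" and ?t1.0=1])
    fix t :: real assume "t \<ge> 1"
    define r where "r = q + p"
    have "(t / 2) powr (- q) * (t / 2) powr (- p) = (t / 2) powr (- r)"
      by (simp add: r_def flip: powr_add)
    also have "\<dots> = 2 powr r * t powr (- r)"
      using \<open>t \<ge> 1\<close> by (simp add: powr_divide powr_minus field_simps)
    also have "\<dots> = 2 powr (q + p) * t powr (- (q + p))"
      by (simp only: r_def)
    finally show "(t / 2) powr (- q) * (t / 2) powr (- p) \<le> 2 powr (q + p) * t powr (- (q + p))"
      by simp
  qed auto
  moreover have "real (Suc n) * b + b = real (Suc (Suc n)) * b" "q + p = real (Suc (Suc n)) * p"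
    by (simp_all add: q_def algebra_simps)
  ultimately show ?case
    by simp
qed

text \<open>The moment inequality is applied to \<open>T t x\<close>: the higher power decays by
  hypothesis, the orbit itself is only bounded.\<close>

lemma decays_interpolate:
  assumes b: "0 < b" "b < \<beta>" and "decays \<beta> (\<lambda>t. t powr (- p))"
  shows "decays b (\<lambda>t. t powr (- (p * b / \<beta>)))"
proof -
  obtain c t0 where 1: "c \<ge> 0" "t0 \<ge> 1" "\<And>t x. t \<ge> t0 \<Longrightarrow> norm (T t (B \<beta> x)) \<le> c * t powr (- p) * norm x"
    using assms(3) by (auto simp: decays_def)
  from moment_inequality[OF b] obtain C where C: "C \<ge> 0"
    "\<And>\<tau> x. 0 < \<tau> \<Longrightarrow> norm (B b x) \<le> C * (\<tau> powr (\<beta> - b) * norm (B \<beta> x) + \<tau> powr (- b) * norm x)"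
    by blast
  have "norm (T t (B b x)) \<le> (C * (c + K)) * t powr (- (p * b / \<beta>)) * norm x" if t: "t \<ge> t0" for t x
  proof -
    have t': "t > 0" using t 1(2) by simp
    \<comment> \<open>Balances the two terms:
      \<open>\<tau> powr (\<beta> - b) * t powr (- p)\<close> equals
      \<open>\<tau> powr (- b)\<close>.\<close>
    define \<tau> where "\<tau> = t powr (p / \<beta>)"
    have "norm (T t (B b x)) = norm (B b (T t x))"
      using b t' by (simp add: T_B)
    also have "\<dots> \<le> C * (\<tau> powr (\<beta> - b) * norm (B \<beta> (T t x)) + \<tau> powr (- b) * norm (T t x))"
      using t' by (intro C(2)) (simp add: \<tau>_def)
    also have "\<dots> \<le> C * (\<tau> powr (\<beta> - b) * (c * t powr (- p) * norm x) + \<tau> powr (- b) * (K * norm x))"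
      using C(1) 1(3)[OF t, of x] T_bound[of t x] t' b
      by (intro mult_left_mono add_mono) (auto simp: T_B)
    also have "\<tau> powr (\<beta> - b) * (c * t powr (- p) * norm x) = c * t powr (- (p * b / \<beta>)) * norm x"
    proof -
      have "p / \<beta> * (\<beta> - b) + - p = - (p * b / \<beta>)"
        using b by (simp add: field_simps)
      then have "\<tau> powr (\<beta> - b) * t powr (- p) = t powr (- (p * b / \<beta>))"
        unfolding \<tau>_def powr_powr by (simp flip: powr_add)
      then show ?thesis by (simp add: ac_simps)
    qed
    also have "\<tau> powr (- b) = t powr (- (p * b / \<beta>))"
      by (simp add: \<tau>_def powr_powr)
    finally show ?thesis
      by (simp add: algebra_simps)
  qed
  moreover have "C * (c + K) \<ge> 0"
    using C(1) 1(1) K_ge_1 by simp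
  ultimately show ?thesis
    unfolding decays_def using 1(2) by blast
qed

text \<open>Multiplying the exponent climbs beyond \<open>b\<close>, interpolation descends to it.
  The ratio of rate to exponent is preserved in both moves, so \<open>b\<close> may lie on either
  side of \<open>\<beta>\<close>.\<close>

lemma decays_rescale:
  assumes \<beta>: "\<beta> > 0" and b: "b > 0" and "decays \<beta> (\<lambda>t. t powr (- p))"
  shows "decays b (\<lambda>t. t powr (- (p * b / \<beta>)))"
proof -
  obtain n where n: "b / \<beta> < real n"
    using reals_Archimedean2 by blast
  then have "b < real n * \<beta>"
    using \<beta> by (simp add: field_simps)
  also have "\<dots> \<le> real (Suc n) * \<beta>"
    using \<beta> by simp
  finally have "b < real (Suc n) * \<beta>" .
  from decays_interpolate[OF b this decays_power_mult[OF \<beta> assms(3)]] show ?thesis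
    using \<beta> by simp
qed

text \<open>On the range of \<open>R 0\<close> the power is \<open>\<beta> + 1\<close>, which decays
  at the strictly better rate \<open>q\<close>; the rest of \<open>x\<close> is small and is
  controlled by the uniform bound.\<close>

lemma decays_strong:
  assumes \<beta>: "\<beta> > 0" and p: "p > 0" and dec: "decays \<beta> (\<lambda>t. t powr (- p))"
  shows "((\<lambda>t. t powr p * norm (T t (B \<beta> x))) \<longlongrightarrow> 0) at_top"
  unfolding tendsto_iff
proof (intro allI impI)
  fix \<epsilon> :: real assume \<epsilon>: "\<epsilon> > 0"
  obtain c t0 where 1: "c \<ge> 0" "t0 \<ge> 1" "\<And>t x. t \<ge> t0 \<Longrightarrow> norm (T t (B \<beta> x)) \<le> c * t powr (- p) * norm x"
    using dec by (auto simp: decays_def)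
  define q where "q = p * (\<beta> + 1) / \<beta>"
  have "decays (\<beta> + 1) (\<lambda>t. t powr (- q))"
    using decays_rescale[OF \<beta> _ dec, of "\<beta> + 1"] \<beta> by (simp add: q_def)
  then obtain c' t0' where 2: "c' \<ge> 0" "t0' \<ge> 1"
    "\<And>t x. t \<ge> t0' \<Longrightarrow> norm (T t (B (\<beta> + 1) x)) \<le> c' * t powr (- q) * norm x"
    by (auto simp: decays_def)
  \<comment> \<open>\<open>c + 1\<close> guards against \<open>c = 0\<close> in the
    denominator.\<close>
  obtain z where z: "norm (x - R 0 z) < \<epsilon> / (2 * (c + 1))"
    using R_0_range_dense[of "\<epsilon> / (2 * (c + 1))" x] \<epsilon> 1(1) by auto
  have "q - p > 0"
    using \<beta> p by (simp add: q_def field_simps)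
  then have "((\<lambda>t. c' * t powr (- (q - p)) * norm z) \<longlongrightarrow> c' * 0 * norm z) at_top"
    by (intro tendsto_intros tendsto_neg_powr filterlim_ident) auto
  then have "((\<lambda>t. c' * t powr (- (q - p)) * norm z) \<longlongrightarrow> 0) at_top"
    by simp
  then have "\<forall>\<^sub>F t in at_top. dist (c' * t powr (- (q - p)) * norm z) 0 < \<epsilon> / 2"
    by (rule tendstoD) (use \<epsilon> in simp)
  then show "\<forall>\<^sub>F t in at_top. dist (t powr p * norm (T t (B \<beta> x))) 0 < \<epsilon>"
    using eventually_ge_at_top[of "max t0 t0'"]
  proof eventually_elim
    case (elim t)
    then have t: "t \<ge> t0" "t \<ge> t0'" "t > 0"
      using 1(2) by auto
    interpret B\<beta>: bounded_linear "B \<beta>" by (rule B_linear[OF \<beta>])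
    have "B \<beta> x = B \<beta> (x - R 0 z) + B (\<beta> + 1) z"
      using B_add[OF \<beta>, of 1 z] by (simp add: B\<beta>.diff B_1)
    then have eq: "T t (B \<beta> x) = T t (B \<beta> (x - R 0 z)) + T t (B (\<beta> + 1) z)"
      using t by (simp add: linear_add[OF bounded_linear.linear[OF T_linear]])
    have "norm (T t (B \<beta> x)) \<le> c * t powr (- p) * norm (x - R 0 z) + c' * t powr (- q) * norm z"
      unfolding eq using 1(3)[OF t(1), of "x - R 0 z"] 2(3)[OF t(2), of z]
        norm_triangle_ineq[of "T t (B \<beta> (x - R 0 z))" "T t (B (\<beta> + 1) z)"] by linarith
    then have "t powr p * norm (T t (B \<beta> x))
        \<le> t powr p * (c * t powr (- p) * norm (x - R 0 z) + c' * t powr (- q) * norm z)"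
      by (rule mult_left_mono) simp
    also have "\<dots> = c * norm (x - R 0 z) + c' * t powr (- (q - p)) * norm z"
    proof -
      have "t powr p * t powr (- p) = 1" "t powr p * t powr (- q) = t powr (- (q - p))"
        using t by (simp_all flip: powr_add)
      then show ?thesis
        by (simp add: distrib_left mult.left_commute[of _ c] mult.left_commute[of _ c'] flip: mult.assoc)
           (simp add: mult.assoc mult.left_commute)
    qed
    also have "c * norm (x - R 0 z) \<le> \<epsilon> / 2"
    proof -
      have "c * norm (x - R 0 z) \<le> (c + 1) * (\<epsilon> / (2 * (c + 1)))"
        using z 1(1) by (intro mult_mono) auto
      also have "\<dots> = \<epsilon> / 2"
        using 1(1) by (simp add: field_simps)
      finally show ?thesis .
    qed
    finally show ?case
      using elim(1) 2(1) by (simp add: abs_mult)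
  qed
qed

text \<open>The Landau symbol compares absolute values, hence the sign condition on
  \<open>h\<close>; it is imposed from \<open>1\<close> on because \<open>ln t / t\<close> is
  negative for \<open>t\<close> between \<open>0\<close> and \<open>1\<close>.\<close>

lemma bigo_iff_decays:
  assumes b: "b > 0" and h: "\<And>t. t \<ge> 1 \<Longrightarrow> h t \<ge> 0"
  shows "(\<lambda>t. onorm (T t \<circ> B b)) \<in> O[at_top](h) \<longleftrightarrow> decays b h"
proof
  have lin: "bounded_linear (T t \<circ> B b)" if "t \<ge> 0" for t
    unfolding o_def by (intro bounded_linear_compose[OF T_linear B_linear] that b)
  show "decays b h" if "(\<lambda>t. onorm (T t \<circ> B b)) \<in> O[at_top](h)"
  proof -
    from that obtain c where c: "c > 0"
      "\<forall>\<^sub>F t in at_top. norm (onorm (T t \<circ> B b)) \<le> c * norm (h t)"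
      by (elim landau_o.bigE)
    then obtain t0 where t0: "\<And>t. t \<ge> t0 \<Longrightarrow> norm (onorm (T t \<circ> B b)) \<le> c * norm (h t)"
      by (auto simp: eventually_at_top_linorder)
    have "norm (T t (B b x)) \<le> c * h t * norm x" if t: "t \<ge> max 1 t0" for t x
    proof -
      have "norm (T t (B b x)) \<le> onorm (T t \<circ> B b) * norm x"
        using onorm[OF lin, of t x] t by simp
      also have "\<dots> \<le> c * h t * norm x"
        using t0[of t] h[of t] t by (intro mult_right_mono) auto
      finally show ?thesis .
    qed
    then show ?thesis
      unfolding decays_def using c(1) by (intro exI[of _ c] conjI exI[of _ "max 1 t0"]) auto
  qed
  show "(\<lambda>t. onorm (T t \<circ> B b)) \<in> O[at_top](h)" if "decays b h"
  proof -
    from that obtain c t0 where c: "c \<ge> 0" "t0 \<ge> 1"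
      "\<And>t x. t \<ge> t0 \<Longrightarrow> norm (T t (B b x)) \<le> c * h t * norm x"
      by (auto simp: decays_def)
    show ?thesis
    proof (rule bigoI)
      show "\<forall>\<^sub>F t in at_top. norm (onorm (T t \<circ> B b)) \<le> c * norm (h t)"
        using eventually_ge_at_top[of t0]
      proof eventually_elim
        case (elim t)
        then have "onorm (T t \<circ> B b) \<le> c * h t"
          using c h[of t] by (intro onorm_bound) auto
        then show ?case
          using onorm_pos_le[OF lin, of t] elim c(2) h[of t] by simp
      qed
    qed
  qed
qed

end

section \<open>The Lyapunov equation\<close>

locale lyapunov_semigroup = bounded_semigroup T D A K
  for T :: "real \<Rightarrow> 'a::chilbert_space \<Rightarrow> 'a" and D A K +
  fixes Q :: "real \<Rightarrow> 'a \<Rightarrow> 'a"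
  assumes Q_selfadjoint: "\<And>\<xi>. \<xi> > 0 \<Longrightarrow> selfadjoint (Q \<xi>)"
    and Q_solution: "\<And>\<xi>. \<xi> > 0 \<Longrightarrow> lyapunov_solution D A \<xi> (Q \<xi>)"
begin

definition q :: "real \<Rightarrow> 'a \<Rightarrow> real" where
  "q \<xi> x = re_inner x (Q \<xi> x)"

lemma Q_linear: "\<xi> > 0 \<Longrightarrow> bounded_linear (Q \<xi>)"
  using Q_selfadjoint[of \<xi>] by (simp add: selfadjoint_def bounded_clinear_def)

lemma Q_symmetric: "\<xi> > 0 \<Longrightarrow> re_inner (Q \<xi> x) y = re_inner x (Q \<xi> y)"
  using Q_selfadjoint[of \<xi>] by (simp add: selfadjoint_def re_inner_def)

section \<open>The Lyapunov form as the energy of an orbit\<close>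

text \<open>Quadratic forms of selfadjoint operators are real; this reduces the complex limits in
  the decay conditions to limits of \<open>q\<close>.\<close>

lemma cinner_Q:
  assumes "\<xi> > 0"
  shows "cinner x (Q \<xi> x) = complex_of_real (q \<xi> x)"
proof -
  have "cinner x (Q \<xi> x) = cnj (cinner x (Q \<xi> x))"
    using Q_selfadjoint[OF assms] cinner_commute[of x "Q \<xi> x"] by (simp add: selfadjoint_def)
  then have "Im (cinner x (Q \<xi> x)) = 0"
    by (metis Reals_cnj_iff complex_is_Real_iff)
  then show ?thesis
    by (simp add: q_def re_inner_def complex_eq_iff)
qed

lemma q_bound: "\<xi> > 0 \<Longrightarrow> \<exists>C\<ge>0. \<forall>x. \<bar>q \<xi> x\<bar> \<le> C * (norm x)\<^sup>2"
proof -
  assume \<xi>: "\<xi> > 0"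
  obtain C where C: "C > 0" "\<And>x. norm (Q \<xi> x) \<le> norm x * C"
    using bounded_linear.pos_bounded[OF Q_linear[OF \<xi>]] by blast
  obtain C' where C': "C' > 0" "\<And>x y :: 'a. norm (re_inner x y) \<le> norm x * norm y * C'"
    using bounded_bilinear.pos_bounded[OF bounded_bilinear_re_inner] by blast
  have "\<bar>q \<xi> x\<bar> \<le> (C * C') * (norm x)\<^sup>2" for x
  proof -
    have "\<bar>q \<xi> x\<bar> \<le> norm x * norm (Q \<xi> x) * C'"
      using C'(2)[of x "Q \<xi> x"] by (simp add: q_def)
    also have "\<dots> \<le> norm x * (norm x * C) * C'"
      using C C' by (intro mult_right_mono mult_left_mono) auto
    finally show ?thesis
      by (simp add: power2_eq_square ac_simps)
  qed
  then show ?thesis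
    using C(1) C'(1) by (intro exI[of _ "C * C'"]) auto
qed

text \<open>The diagonal of the Lyapunov equation. The left-hand side is the derivative of
  \<open>q \<xi>\<close> along the orbit through \<open>u\<close>.\<close>

lemma lyapunov_real:
  assumes \<xi>: "\<xi> > 0" and u: "u \<in> D"
  shows "2 * re_inner (A u) (Q \<xi> u) = 2 * \<xi> * q \<xi> u - (norm u)\<^sup>2"
proof -
  have "cinner (A u - \<xi> *\<^sub>R u) (Q \<xi> u) + cinner (Q \<xi> u) (A u - \<xi> *\<^sub>R u) = - cinner u u"
    using Q_solution[OF \<xi>] u by (simp add: lyapunov_solution_def)
  then have "re_inner (A u - \<xi> *\<^sub>R u) (Q \<xi> u) + re_inner (Q \<xi> u) (A u - \<xi> *\<^sub>R u) = - re_inner u u"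
    unfolding re_inner_def by (simp flip: plus_complex.sel)
  moreover have "re_inner (Q \<xi> u) (A u - \<xi> *\<^sub>R u) = re_inner (A u - \<xi> *\<^sub>R u) (Q \<xi> u)"
    by (rule re_inner_commute)
  moreover have "re_inner (A u - \<xi> *\<^sub>R u) (Q \<xi> u) = re_inner (A u) (Q \<xi> u) - \<xi> * q \<xi> u"
    using re_inner_add_left[of "A u - \<xi> *\<^sub>R u" "\<xi> *\<^sub>R u" "Q \<xi> u"]
    by (simp add: re_inner_scaleR_left q_def)
  ultimately show ?thesis
    by (simp add: re_inner_self)
qed

lemma continuous_orbit_energy:
  "S \<subseteq> {0..} \<Longrightarrow> continuous_on S (\<lambda>r. exp (- (2 * \<xi> * r)) * (norm (T r x))\<^sup>2)"
  by (intro continuous_intros continuous_T)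

lemma energy_identity_domain:
  assumes \<xi>: "\<xi> > 0" and x: "x \<in> D" and t: "t \<ge> 0"
  shows "integral {0..t} (\<lambda>r. exp (- (2 * \<xi> * r)) * (norm (T r x))\<^sup>2)
    = q \<xi> x - exp (- (2 * \<xi> * t)) * q \<xi> (T t x)"
proof -
  define F where "F r = - (exp (- (2 * \<xi> * r)) * q \<xi> (T r x))" for r
  have "((\<lambda>r. exp (- (2 * \<xi> * r)) * (norm (T r x))\<^sup>2) has_integral (F t - F 0)) {0..t}"
  proof (rule fundamental_theorem_of_calculus[OF t])
    fix r assume r: "r \<in> {0..t}"
    have T': "((\<lambda>r. T r x) has_vector_derivative T r (A x)) (at r within {0..t})"
      by (rule has_vector_derivative_within_subset[OF T_has_vector_derivative[OF x]]) (use r in auto)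
    have "((\<lambda>r. q \<xi> (T r x)) has_vector_derivative
        re_inner (T r x) (Q \<xi> (T r (A x))) + re_inner (T r (A x)) (Q \<xi> (T r x))) (at r within {0..t})"
      unfolding q_def
      by (intro bounded_bilinear.has_vector_derivative[OF bounded_bilinear_re_inner]
          bounded_linear.has_vector_derivative[OF Q_linear[OF \<xi>]] T')
    moreover have "re_inner (T r x) (Q \<xi> (T r (A x))) + re_inner (T r (A x)) (Q \<xi> (T r x))
        = 2 * re_inner (A (T r x)) (Q \<xi> (T r x))"
      using Q_symmetric[OF \<xi>, of "T r x" "T r (A x)"] re_inner_commute[of "Q \<xi> (T r x)" "T r (A x)"]
        T_generator(2)[OF x, of r] r by simp
    ultimately have q': "((\<lambda>r. q \<xi> (T r x)) has_real_derivative
        2 * \<xi> * q \<xi> (T r x) - (norm (T r x))\<^sup>2) (at r within {0..t})"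
      using lyapunov_real[OF \<xi> T_generator(1)[OF x, of r]] r
      by (simp add: has_real_derivative_iff_has_vector_derivative)
    have "(F has_real_derivative exp (- (2 * \<xi> * r)) * (norm (T r x))\<^sup>2) (at r within {0..t})"
      unfolding F_def by (rule derivative_eq_intros q' refl)+ (simp add: algebra_simps)
    then show "(F has_vector_derivative exp (- (2 * \<xi> * r)) * (norm (T r x))\<^sup>2) (at r within {0..t})"
      by (simp add: has_real_derivative_iff_has_vector_derivative)
  qed
  then show ?thesis
    by (simp add: integral_unique F_def)
qed

text \<open>Outside \<open>D\<close> the orbit need not be differentiable, but both sides are
  continuous in \<open>x\<close> for fixed \<open>t\<close>, so density of the range of
  \<open>R 0\<close> suffices.\<close>

lemma energy_identity:
  assumes \<xi>: "\<xi> > 0" and t: "t \<ge> 0"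
  shows "integral {0..t} (\<lambda>r. exp (- (2 * \<xi> * r)) * (norm (T r x))\<^sup>2)
    = q \<xi> x - exp (- (2 * \<xi> * t)) * q \<xi> (T t x)"
proof -
  have "\<exists>z. norm (x - R 0 z) < inverse (real (Suc n))" for n
    by (rule R_0_range_dense) simp
  then obtain z where z: "\<And>n. norm (x - R 0 (z n)) < inverse (real (Suc n))"
    by metis
  define y where "y n = R 0 (z n)" for n
  have "(\<lambda>n. y n - x) \<longlonglongrightarrow> 0"
    by (rule Lim_null_comparison[OF _ LIMSEQ_inverse_real_of_nat])
       (use z in \<open>auto simp: y_def norm_minus_commute less_imp_le\<close>)
  then have y: "y \<longlonglongrightarrow> x"
    by (simp add: LIM_zero_iff)
  have norm_y: "norm (y n) \<le> norm x + 1" for n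
  proof -
    have "inverse (real (Suc n)) \<le> 1"
      by (simp add: field_simps)
    then show ?thesis
      using z[of n] norm_triangle_sub[of "y n" x] by (simp add: y_def norm_minus_commute)
  qed
  have lim1: "(\<lambda>n. integral {0..t} (\<lambda>r. exp (- (2 * \<xi> * r)) * (norm (T r (y n)))\<^sup>2))
      \<longlonglongrightarrow> integral {0..t} (\<lambda>r. exp (- (2 * \<xi> * r)) * (norm (T r x))\<^sup>2)"
  proof (rule dominated_convergence(2)[where h="\<lambda>_. (K * (norm x + 1))\<^sup>2"])
    show "(\<lambda>r. exp (- (2 * \<xi> * r)) * (norm (T r (y n)))\<^sup>2) integrable_on {0..t}" for n
      by (intro integrable_continuous_real continuous_orbit_energy) auto
    show "norm (exp (- (2 * \<xi> * r)) * (norm (T r (y n)))\<^sup>2) \<le> (K * (norm x + 1))\<^sup>2"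
      if "r \<in> {0..t}" for n r
    proof -
      have "norm (T r (y n)) \<le> K * norm (y n)"
        using that by (intro T_bound) simp
      also have "\<dots> \<le> K * (norm x + 1)"
        using norm_y K_ge_1 by (intro mult_left_mono) auto
      finally have "(norm (T r (y n)))\<^sup>2 \<le> (K * (norm x + 1))\<^sup>2"
        by (rule power_mono) simp
      moreover have "exp (- (2 * \<xi> * r)) \<le> 1"
        using \<xi> that by simp
      ultimately have "exp (- (2 * \<xi> * r)) * (norm (T r (y n)))\<^sup>2 \<le> 1 * (K * (norm x + 1))\<^sup>2"
        by (intro mult_mono) auto
      then show ?thesis by simp
    qed
    show "(\<lambda>n. exp (- (2 * \<xi> * r)) * (norm (T r (y n)))\<^sup>2) \<longlonglongrightarrow> exp (- (2 * \<xi> * r)) * (norm (T r x))\<^sup>2"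
      if "r \<in> {0..t}" for r
      using that by (intro tendsto_intros bounded_linear.tendsto[OF T_linear y]) simp
  qed auto
  have lim2: "(\<lambda>n. q \<xi> (y n) - exp (- (2 * \<xi> * t)) * q \<xi> (T t (y n)))
      \<longlonglongrightarrow> q \<xi> x - exp (- (2 * \<xi> * t)) * q \<xi> (T t x)"
    unfolding q_def
    by (intro tendsto_intros bounded_linear.tendsto[OF Q_linear[OF \<xi>]]
        bounded_linear.tendsto[OF T_linear[OF t]] y)
  have "integral {0..t} (\<lambda>r. exp (- (2 * \<xi> * r)) * (norm (T r (y n)))\<^sup>2)
      = q \<xi> (y n) - exp (- (2 * \<xi> * t)) * q \<xi> (T t (y n))" for n
    unfolding y_def by (rule energy_identity_domain[OF \<xi> R_0_in_D t])
  then show ?thesis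
    using LIMSEQ_unique[OF lim1] lim2 by simp
qed

text \<open>\<open>q \<xi>\<close> stays bounded along the bounded orbit, so the exponential factor
  kills the boundary term. The integral representation thus follows from the equation alone, for any
  selfadjoint solution.\<close>

lemma energy_tendsto:
  assumes \<xi>: "\<xi> > 0"
  shows "((\<lambda>t. integral {0..t} (\<lambda>r. exp (- (2 * \<xi> * r)) * (norm (T r x))\<^sup>2)) \<longlongrightarrow> q \<xi> x) at_top"
proof -
  obtain C where C: "C \<ge> 0" "\<And>x. \<bar>q \<xi> x\<bar> \<le> C * (norm x)\<^sup>2"
    using q_bound[OF \<xi>] by blast
  have "filterlim (\<lambda>t. 2 * \<xi> * t) at_top at_top"
    using \<xi> by (intro filterlim_tendsto_pos_mult_at_top[OF tendsto_const] filterlim_ident) simp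
  then have "((\<lambda>t. exp (- (2 * \<xi> * t))) \<longlongrightarrow> 0) at_top"
    by (intro filterlim_compose[OF exp_at_bot] filterlim_compose[OF filterlim_uminus_at_bot_at_top])
  then have "((\<lambda>t. exp (- (2 * \<xi> * t)) * (C * (K * norm x)\<^sup>2)) \<longlongrightarrow> 0) at_top"
    by (rule tendsto_mult_left_zero)
  moreover have "\<forall>\<^sub>F t in at_top. norm (exp (- (2 * \<xi> * t)) * q \<xi> (T t x))
      \<le> exp (- (2 * \<xi> * t)) * (C * (K * norm x)\<^sup>2)"
    using eventually_ge_at_top[of 0]
  proof eventually_elim
    case (elim t)
    have "\<bar>q \<xi> (T t x)\<bar> \<le> C * (norm (T t x))\<^sup>2"
      by (rule C(2))
    also have "\<dots> \<le> C * (K * norm x)\<^sup>2"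
      using C(1) by (intro mult_left_mono power_mono T_bound elim) auto
    finally show ?case
      by (simp add: abs_mult)
  qed
  ultimately have "((\<lambda>t. exp (- (2 * \<xi> * t)) * q \<xi> (T t x)) \<longlongrightarrow> 0) at_top"
    by (rule Lim_null_comparison[rotated])
  then have "((\<lambda>t. q \<xi> x - exp (- (2 * \<xi> * t)) * q \<xi> (T t x)) \<longlongrightarrow> q \<xi> x - 0) at_top"
    by (intro tendsto_intros)
  moreover have "\<forall>\<^sub>F t in at_top. q \<xi> x - exp (- (2 * \<xi> * t)) * q \<xi> (T t x)
      = integral {0..t} (\<lambda>r. exp (- (2 * \<xi> * r)) * (norm (T r x))\<^sup>2)"
    using eventually_ge_at_top[of 0] by eventually_elim (simp add: energy_identity[OF \<xi>])
  ultimately show ?thesis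
    by (simp add: Lim_transform_eventually)
qed

lemma energy_le_q:
  assumes \<xi>: "\<xi> > 0" and t: "t \<ge> 0"
  shows "integral {0..t} (\<lambda>r. exp (- (2 * \<xi> * r)) * (norm (T r x))\<^sup>2) \<le> q \<xi> x"
proof (rule tendsto_lowerbound[OF energy_tendsto[OF \<xi>]])
  show "\<forall>\<^sub>F s in at_top. integral {0..t} (\<lambda>r. exp (- (2 * \<xi> * r)) * (norm (T r x))\<^sup>2)
      \<le> integral {0..s} (\<lambda>r. exp (- (2 * \<xi> * r)) * (norm (T r x))\<^sup>2)"
    using eventually_ge_at_top[of t]
  proof eventually_elim
    case (elim s)
    then show ?case
      by (intro integral_subset_le integrable_continuous_real continuous_orbit_energy) auto
  qed
qed simp

lemma q_nonneg: "\<xi> > 0 \<Longrightarrow> q \<xi> x \<ge> 0"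
  using energy_le_q[of \<xi> 0 x] by simp

text \<open>Every earlier point of the orbit bounds the present one up to \<open>K\<close>, and at
  \<open>\<xi> = 1 / t\<close> the weight is at least \<open>exp (- 2)\<close> on
  \<open>{0..t}\<close>. Integrating over this interval produces the factor
  \<open>t\<close>.\<close>

lemma norm_T_le_q:
  assumes t: "t > 0"
  shows "t * (norm (T t x))\<^sup>2 \<le> (K * exp 1)\<^sup>2 * q (1 / t) x"
proof -
  have "t * (norm (T t x))\<^sup>2 = integral {0..t} (\<lambda>r. (norm (T t x))\<^sup>2)"
    using t by simp
  also have "\<dots> \<le> integral {0..t} (\<lambda>r. (K * exp 1)\<^sup>2 * (exp (- (2 * (1 / t) * r)) * (norm (T r x))\<^sup>2))"
  proof (rule integral_le)
    show "(\<lambda>r. (K * exp 1)\<^sup>2 * (exp (- (2 * (1 / t) * r)) * (norm (T r x))\<^sup>2)) integrable_on {0..t}"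
      by (intro integrable_continuous_real continuous_on_mult_left continuous_orbit_energy) auto
    fix r assume r: "r \<in> {0..t}"
    have "norm (T t x) \<le> K * norm (T r x)"
      using T_add[of "t - r" r x] T_bound[of "t - r" "T r x"] r by simp
    then have 1: "(norm (T t x))\<^sup>2 \<le> (K * norm (T r x))\<^sup>2"
      by (rule power_mono) simp
    have "(exp 1)\<^sup>2 * exp (- (2 * (1 / t) * r)) = exp (2 - 2 * (r / t))"
      by (simp add: power2_eq_square flip: exp_add)
    also have "\<dots> \<ge> 1"
      using r t by (simp add: divide_le_eq)
    finally have "(K * norm (T r x))\<^sup>2 * 1 \<le> (K * norm (T r x))\<^sup>2 * ((exp 1)\<^sup>2 * exp (- (2 * (1 / t) * r)))"
      by (intro mult_left_mono) auto
    then show "(norm (T t x))\<^sup>2 \<le> (K * exp 1)\<^sup>2 * (exp (- (2 * (1 / t) * r)) * (norm (T r x))\<^sup>2)"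
      using 1 by (simp add: power_mult_distrib ac_simps)
  qed (simp add: integrable_const_ivl)
  also have "\<dots> = (K * exp 1)\<^sup>2 * integral {0..t} (\<lambda>r. exp (- (2 * (1 / t) * r)) * (norm (T r x))\<^sup>2)"
    by (rule integral_mult_right)
  also have "\<dots> \<le> (K * exp 1)\<^sup>2 * q (1 / t) x"
    using t by (intro mult_left_mono energy_le_q) auto
  finally show ?thesis .
qed

text \<open>The weight \<open>w\<close> is capped by the identity so that the operators are pointwise bounded also for
  the times at which the hypothesis on \<open>q\<close> does not yet apply.\<close>

lemma decays_of_q_bound:
  assumes b: "b > 0"
    and w: "\<And>t. t \<ge> 2 \<Longrightarrow> 0 < w t" "\<And>t. t \<ge> 2 \<Longrightarrow> w t \<le> t"
    and q: "\<And>x. \<forall>\<^sub>F t in at_top. (w t)\<^sup>2 * q (1 / t) (B b x) \<le> t"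
  shows "decays b (\<lambda>t. 1 / w t)"
proof -
  define f where "f t x = w t *\<^sub>R T t (B b x)" for t x
  have "\<exists>C>0. \<forall>t\<in>{2..}. \<forall>x. norm (f t x) \<le> C * norm x"
  proof (rule uniform_boundedness)
    show "bounded_linear (f t)" if "t \<in> {2..}" for t
      unfolding f_def[abs_def]
      by (intro bounded_linear_const_scaleR bounded_linear_compose[OF T_linear B_linear[OF b]])
         (use that in simp)
    fix x
    obtain N where N: "\<And>t. t \<ge> N \<Longrightarrow> (w t)\<^sup>2 * q (1 / t) (B b x) \<le> t"
      using q[of x] by (auto simp: eventually_at_top_linorder)
    have "norm (f t x) \<le> max (K * exp 1) (\<bar>N\<bar> * (K * norm (B b x)))" if t: "t \<in> {2..}" for t
    proof (cases "t \<ge> N")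
      case True
      have "t * (norm (f t x))\<^sup>2 = (w t)\<^sup>2 * (t * (norm (T t (B b x)))\<^sup>2)"
        by (simp add: f_def power_mult_distrib)
      also have "\<dots> \<le> (w t)\<^sup>2 * ((K * exp 1)\<^sup>2 * q (1 / t) (B b x))"
        using t by (intro mult_left_mono norm_T_le_q) auto
      also have "\<dots> = (K * exp 1)\<^sup>2 * ((w t)\<^sup>2 * q (1 / t) (B b x))"
        by simp
      also have "\<dots> \<le> (K * exp 1)\<^sup>2 * t"
        using N[OF True] by (intro mult_left_mono) auto
      finally have "(norm (f t x))\<^sup>2 \<le> (K * exp 1)\<^sup>2"
        using t by (simp add: mult.commute)
      then have "norm (f t x) \<le> K * exp 1"
        by (rule power2_le_imp_le) (use K_ge_1 in simp)
      then show ?thesis by simp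
    next
      case False
      have "norm (f t x) = w t * norm (T t (B b x))"
        using w(1)[of t] t by (simp add: f_def)
      also have "\<dots> \<le> \<bar>N\<bar> * (K * norm (B b x))"
        using w[of t] t False by (intro mult_mono T_bound) auto
      finally show ?thesis by simp
    qed
    then show "\<exists>c. \<forall>t\<in>{2..}. norm (f t x) \<le> c"
      by blast
  qed
  then obtain C where C: "C > 0" "\<And>t x. t \<ge> 2 \<Longrightarrow> norm (f t x) \<le> C * norm x"
    by auto
  have "norm (T t (B b x)) \<le> C * (1 / w t) * norm x" if "t \<ge> 2" for t x
    using C(2)[OF that, of x] w(1)[OF that] by (simp add: f_def field_simps)
  then show ?thesis
    unfolding decays_def using C(1) by (intro exI[of _ C] conjI exI[of _ 2]) auto
qed

section \<open>Transfer between decay rates and Lyapunov conditions\<close>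

text \<open>An Abelian argument: the energy up to \<open>t0\<close> is bounded independently of
  \<open>\<xi>\<close>, hence negligible against \<open>W \<xi>\<close>, while the tail is a small
  multiple of the kernel integral, which \<open>W \<xi>\<close> dominates.\<close>

lemma q_negligible:
  assumes lim: "((\<lambda>t. t powr p * norm (T t y)) \<longlongrightarrow> 0) at_top"
    and kernel: "\<And>\<xi> t0 t. 0 < \<xi> \<Longrightarrow> \<xi> \<le> 1 / 2 \<Longrightarrow> 1 \<le> t0 \<Longrightarrow> t0 \<le> t \<Longrightarrow>
      integral {t0..t} (\<lambda>r. exp (- (2 * \<xi> * r)) * r powr (- (2 * p))) \<le> C * W \<xi>"
    and C: "C \<ge> 0"
    and W: "filterlim W at_top (at_right 0)"
  shows "((\<lambda>\<xi>. q \<xi> y / W \<xi>) \<longlongrightarrow> 0) (at_right 0)"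
  unfolding tendsto_iff
proof (intro allI impI)
  fix \<epsilon> :: real assume \<epsilon>: "\<epsilon> > 0"
  \<comment> \<open>Makes the tail at most half of \<open>\<epsilon> * W \<xi>\<close>;
    \<open>C + 1\<close> avoids division by zero.\<close>
  define \<delta> where "\<delta> = sqrt (\<epsilon> / (2 * (C + 1)))"
  have \<delta>: "\<delta> > 0" "\<delta>\<^sup>2 * C \<le> \<epsilon> / 2"
    using \<epsilon> C by (auto simp: \<delta>_def field_simps)
  have "\<forall>\<^sub>F t in at_top. dist (t powr p * norm (T t y)) 0 < \<delta>"
    using lim \<delta>(1) by (rule tendstoD)
  then obtain N where N: "\<And>t. t \<ge> N \<Longrightarrow> t powr p * norm (T t y) < \<delta>"
    by (auto simp: eventually_at_top_linorder)
  define t0 where "t0 = max 1 N"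
  have t0: "t0 \<ge> 1" by (simp add: t0_def)
  have norm_T: "(norm (T r y))\<^sup>2 \<le> \<delta>\<^sup>2 * r powr (- (2 * p))" if r: "r \<ge> t0" for r
  proof -
    have r': "r > 0" using r t0 by simp
    have "norm (T r y) = r powr (- p) * (r powr p * norm (T r y))"
      using r' by (simp add: powr_minus)
    also have "\<dots> \<le> r powr (- p) * \<delta>"
      using N[of r] r by (intro mult_left_mono) (auto simp: t0_def)
    finally have "(norm (T r y))\<^sup>2 \<le> (r powr (- p) * \<delta>)\<^sup>2"
      by (rule power_mono) simp
    also have "\<dots> = \<delta>\<^sup>2 * (r powr (- p) * r powr (- p))"
      by (simp add: power2_eq_square)
    also have "r powr (- p) * r powr (- p) = r powr (- (2 * p))"
      by (simp flip: powr_add)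
    finally show ?thesis .
  qed
  define M where "M = (K * norm y)\<^sup>2 * t0"
  have q_le: "q \<xi> y \<le> M + \<delta>\<^sup>2 * (C * W \<xi>)" if \<xi>: "0 < \<xi>" "\<xi> \<le> 1 / 2" for \<xi>
  proof (rule tendsto_upperbound[OF energy_tendsto[OF \<xi>(1)]])
    let ?f = "\<lambda>r. exp (- (2 * \<xi> * r)) * (norm (T r y))\<^sup>2"
    show "\<forall>\<^sub>F t in at_top. integral {0..t} ?f \<le> M + \<delta>\<^sup>2 * (C * W \<xi>)"
      using eventually_ge_at_top[of t0]
    proof eventually_elim
      case (elim t)
      have int: "?f integrable_on {a..b}" if "a \<ge> 0" for a b
        using that by (intro integrable_continuous_real continuous_orbit_energy) auto
      have "integral {0..t} ?f = integral {0..t0} ?f + integral {t0..t} ?f"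
        using elim t0 by (intro Henstock_Kurzweil_Integration.integral_combine[symmetric] int) auto
      also have "integral {0..t0} ?f \<le> integral {0..t0} (\<lambda>r. (K * norm y)\<^sup>2)"
      proof (rule integral_le[OF int])
        fix r assume r: "r \<in> {0..t0}"
        have "(norm (T r y))\<^sup>2 \<le> (K * norm y)\<^sup>2"
          using r by (intro power_mono T_bound) auto
        then have "?f r \<le> 1 * (K * norm y)\<^sup>2"
          using r \<xi> by (intro mult_mono) auto
        then show "?f r \<le> (K * norm y)\<^sup>2" by simp
      qed auto
      also have "\<dots> = M"
        using t0 by (simp add: M_def)
      also have "integral {t0..t} ?f \<le> integral {t0..t} (\<lambda>r. \<delta>\<^sup>2 * (exp (- (2 * \<xi> * r)) * r powr (- (2 * p))))"
      proof (rule integral_le[OF int])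
        show "(\<lambda>r. \<delta>\<^sup>2 * (exp (- (2 * \<xi> * r)) * r powr (- (2 * p)))) integrable_on {t0..t}"
          using t0 by (intro integrable_continuous_real continuous_intros) auto
        show "?f r \<le> \<delta>\<^sup>2 * (exp (- (2 * \<xi> * r)) * r powr (- (2 * p)))" if "r \<in> {t0..t}" for r
          using mult_left_mono[OF norm_T[of r], of "exp (- (2 * \<xi> * r))"] that by (simp add: ac_simps)
      qed (use t0 in auto)
      also have "\<dots> = \<delta>\<^sup>2 * integral {t0..t} (\<lambda>r. exp (- (2 * \<xi> * r)) * r powr (- (2 * p)))"
        by (rule integral_mult_right)
      also have "\<dots> \<le> \<delta>\<^sup>2 * (C * W \<xi>)"
        using kernel[OF \<xi> t0 elim] by (rule mult_left_mono) simp
      finally show ?case by simp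
    qed
  qed simp
  have "\<forall>\<^sub>F \<xi> in at_right 0. W \<xi> > 2 * M / \<epsilon> + 1"
    using W by (simp add: filterlim_at_top_dense)
  moreover have "\<forall>\<^sub>F \<xi> in at_right (0::real). 0 < \<xi> \<and> \<xi> \<le> 1 / 2"
    unfolding eventually_at_right_field by (intro exI[of _ "1 / 2"]) auto
  ultimately show "\<forall>\<^sub>F \<xi> in at_right 0. dist (q \<xi> y / W \<xi>) 0 < \<epsilon>"
  proof eventually_elim
    case (elim \<xi>)
    have "M \<ge> 0" using t0 by (simp add: M_def)
    then have "0 \<le> 2 * M / \<epsilon>" using \<epsilon> by simp
    with elim(1) have W: "W \<xi> > 0" "W \<xi> > 2 * M / \<epsilon>" by linarith+
    then have "2 * M < \<epsilon> * W \<xi>"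
      using \<epsilon> by (simp add: field_simps)
    moreover have "\<delta>\<^sup>2 * C * W \<xi> \<le> \<epsilon> / 2 * W \<xi>"
      using \<delta>(2) W(1) by (intro mult_right_mono) auto
    ultimately have "q \<xi> y < \<epsilon> * W \<xi>"
      using q_le[of \<xi>] elim(2) by (simp add: mult.assoc)
    then show ?case
      using W(1) q_nonneg[of \<xi> y] elim(2) by (simp add: field_simps)
  qed
qed

text \<open>Since \<open>2 * \<gamma> < 1\<close>, the kernel
  \<open>r powr (- (2 * \<gamma>))\<close> has a Gamma integral of order
  \<open>1 - 2 * \<gamma> > 0\<close>, and its scaling in \<open>\<xi>\<close> is the inverse of the
  weight in \<open>lyapunov_decay\<close>. The same inequality makes \<open>W\<close> tend to
  infinity.\<close>

lemma lyapunov_decayI: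
  assumes \<alpha>: "\<alpha> > 0" and \<gamma>: "0 < \<gamma>" "\<gamma> < 1 / 2" and dec: "decays \<alpha> (\<lambda>t. t powr (- 1))"
  shows "lyapunov_decay D A Q \<alpha> \<gamma>"
  unfolding lyapunov_decay_def
proof
  fix x
  define y where "y = B (\<alpha> * \<gamma>) x"
  have "decays (\<alpha> * \<gamma>) (\<lambda>t. t powr (- \<gamma>))"
    using decays_rescale[OF \<alpha> _ dec, of "\<alpha> * \<gamma>"] \<alpha> \<gamma> by simp
  then have lim: "((\<lambda>t. t powr \<gamma> * norm (T t y)) \<longlongrightarrow> 0) at_top"
    unfolding y_def using \<alpha> \<gamma> by (intro decays_strong) auto
  have "((\<lambda>\<xi>. q \<xi> y / \<xi> powr (2 * \<gamma> - 1)) \<longlongrightarrow> 0) (at_right 0)"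
  proof (rule q_negligible[OF lim, where C="Gamma (1 - 2 * \<gamma>) / 2 powr (1 - 2 * \<gamma>)"])
    fix \<xi> t0 t :: real assume \<xi>: "0 < \<xi>" and t0: "1 \<le> t0" "t0 \<le> t"
    have g: "((\<lambda>r. r powr (1 - 2 * \<gamma> - 1) * exp (- (2 * \<xi> * r))) has_integral
        Gamma (1 - 2 * \<gamma>) / (2 * \<xi>) powr (1 - 2 * \<gamma>)) {0<..}"
      by (rule has_integral_gamma) (use \<xi> \<gamma> in auto)
    have "integral {t0..t} (\<lambda>r. r powr (1 - 2 * \<gamma> - 1) * exp (- (2 * \<xi> * r)))
        \<le> integral {0<..} (\<lambda>r. r powr (1 - 2 * \<gamma> - 1) * exp (- (2 * \<xi> * r)))"
    proof (rule integral_subset_le)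
      show "(\<lambda>r. r powr (1 - 2 * \<gamma> - 1) * exp (- (2 * \<xi> * r))) integrable_on {t0..t}"
        using t0 by (intro integrable_continuous_real continuous_intros) auto
    qed (use g t0 in auto)
    also have "\<dots> = Gamma (1 - 2 * \<gamma>) / 2 powr (1 - 2 * \<gamma>) * (1 / \<xi> powr (1 - 2 * \<gamma>))"
      using \<xi> integral_unique[OF g] by (simp add: powr_mult)
    also have "1 / \<xi> powr (1 - 2 * \<gamma>) = \<xi> powr (2 * \<gamma> - 1)"
      using powr_minus_divide[of \<xi> "1 - 2 * \<gamma>"] by simp
    finally show "integral {t0..t} (\<lambda>r. exp (- (2 * \<xi> * r)) * r powr (- (2 * \<gamma>)))
        \<le> Gamma (1 - 2 * \<gamma>) / 2 powr (1 - 2 * \<gamma>) * \<xi> powr (2 * \<gamma> - 1)"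
      by (simp add: mult.commute)
  next
    show "filterlim (\<lambda>\<xi>. \<xi> powr (2 * \<gamma> - 1)) at_top (at_right 0)"
      using \<gamma> by real_asymp
  qed (use \<gamma> in auto)
  then have "((\<lambda>\<xi>. complex_of_real (q \<xi> y / \<xi> powr (2 * \<gamma> - 1))) \<longlongrightarrow> complex_of_real 0) (at_right 0)"
    by (rule tendsto_of_real)
  moreover have "\<forall>\<^sub>F \<xi> in at_right 0. complex_of_real (q \<xi> y / \<xi> powr (2 * \<gamma> - 1))
      = complex_of_real (\<xi> powr (1 - 2 * \<gamma>)) * cinner y (Q \<xi> y)"
    using eventually_at_right_less[of 0]
  proof eventually_elim
    case (elim \<xi>)
    then have "q \<xi> y / \<xi> powr (2 * \<gamma> - 1) = \<xi> powr (1 - 2 * \<gamma>) * q \<xi> y"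
      using powr_minus_divide[of \<xi> "1 - 2 * \<gamma>"] by simp
    then show ?case
      using elim by (simp add: cinner_Q)
  qed
  ultimately have "((\<lambda>\<xi>. complex_of_real (\<xi> powr (1 - 2 * \<gamma>)) * cinner y (Q \<xi> y)) \<longlongrightarrow> complex_of_real 0) (at_right 0)"
    by (rule Lim_transform_eventually)
  then show "((\<lambda>\<xi>. complex_of_real (\<xi> powr (1 - 2 * \<gamma>)) * cinner (B (\<alpha> * \<gamma>) x) (Q \<xi> (B (\<alpha> * \<gamma>) x)))
      \<longlongrightarrow> 0) (at_right 0)"
    by (simp add: y_def)
qed

text \<open>Replacing \<open>exp (- y)\<close> by the larger \<open>1 / (1 + y)\<close> makes the
  integrand rational, with primitive \<open>ln r - ln (1 + 2 * \<xi> * r)\<close>.\<close>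

lemma log_kernel_le:
  assumes \<xi>: "0 < \<xi>" "\<xi> \<le> 1 / 2" and t0: "1 \<le> t0" "t0 \<le> (t::real)"
  shows "integral {t0..t} (\<lambda>r. exp (- (2 * \<xi> * r)) * r powr (- 1)) \<le> ln (1 / \<xi>)"
proof -
  have "((\<lambda>r. 1 / (r * (1 + 2 * \<xi> * r))) has_integral
      (ln t - ln (1 + 2 * \<xi> * t) - (ln t0 - ln (1 + 2 * \<xi> * t0)))) {t0..t}"
  proof (rule fundamental_theorem_of_calculus[OF t0(2)])
    fix r assume "r \<in> {t0..t}"
    then have r: "r > 0" using t0 by simp
    then have r': "1 + 2 * \<xi> * r > 0" using \<xi> by (simp add: add_pos_pos)
    have "((\<lambda>r. ln r - ln (1 + 2 * \<xi> * r)) has_real_derivative 1 / (r * (1 + 2 * \<xi> * r))) (at r within {t0..t})"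
      using r r' by (auto intro!: derivative_eq_intros simp: divide_simps)
    then show "((\<lambda>r. ln r - ln (1 + 2 * \<xi> * r)) has_vector_derivative 1 / (r * (1 + 2 * \<xi> * r))) (at r within {t0..t})"
      by (simp add: has_real_derivative_iff_has_vector_derivative)
  qed
  note FTC = this
  have "integral {t0..t} (\<lambda>r. exp (- (2 * \<xi> * r)) * r powr (- 1))
      \<le> integral {t0..t} (\<lambda>r. 1 / (r * (1 + 2 * \<xi> * r)))"
  proof (rule integral_le)
    show "(\<lambda>r. exp (- (2 * \<xi> * r)) * r powr (- 1)) integrable_on {t0..t}"
      using t0 by (intro integrable_continuous_real continuous_intros) auto
    fix r assume "r \<in> {t0..t}"
    then have r: "r > 0" using t0 by simp
    then have r': "1 + 2 * \<xi> * r > 0" using \<xi> by (simp add: add_pos_pos)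
    have "exp (- (2 * \<xi> * r)) \<le> 1 / (1 + 2 * \<xi> * r)"
      using exp_ge_add_one_self[of "2 * \<xi> * r"] r' by (simp add: exp_minus field_simps)
    then have "exp (- (2 * \<xi> * r)) / r \<le> 1 / (1 + 2 * \<xi> * r) / r"
      using r by (intro divide_right_mono) auto
    then show "exp (- (2 * \<xi> * r)) * r powr (- 1) \<le> 1 / (r * (1 + 2 * \<xi> * r))"
      using r by (simp add: powr_minus divide_inverse mult.commute)
  qed (use FTC in blast)
  also have "\<dots> = ln (t / (1 + 2 * \<xi> * t)) + ln ((1 + 2 * \<xi> * t0) / t0)"
  proof -
    have "1 + 2 * \<xi> * t > 0" "1 + 2 * \<xi> * t0 > 0" "t > 0" "t0 > 0"
      using \<xi> t0 by (auto simp: add_pos_pos)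
    then show ?thesis
      using integral_unique[OF FTC] by (simp add: ln_div)
  qed
  also have "\<dots> \<le> ln (1 / (2 * \<xi>)) + ln (1 + 2 * \<xi>)"
  proof (rule add_mono)
    show "ln (t / (1 + 2 * \<xi> * t)) \<le> ln (1 / (2 * \<xi>))"
      using \<xi> t0 by (subst ln_le_cancel_iff) (auto simp: field_simps add_pos_pos)
    have "(1 + 2 * \<xi> * t0) / t0 = 1 / t0 + 2 * \<xi>"
      using t0 by (simp add: add_divide_distrib)
    also have "\<dots> \<le> 1 + 2 * \<xi>"
      using t0 by simp
    finally show "ln ((1 + 2 * \<xi> * t0) / t0) \<le> ln (1 + 2 * \<xi>)"
      using \<xi> t0 by (subst ln_le_cancel_iff) (auto simp: add_pos_pos)
  qed
  also have "\<dots> = ln (1 / (2 * \<xi>) + 1)"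
    using \<xi> ln_mult[of "1 / (2 * \<xi>)" "1 + 2 * \<xi>"] by (simp add: distrib_left)
  \<comment> \<open>Equivalent to \<open>1 \<le> 1 / (2 * \<xi>)\<close>, which is where
    \<open>\<xi> \<le> 1 / 2\<close> enters.\<close>
  also have "\<dots> \<le> ln (1 / \<xi>)"
    using \<xi> by (subst ln_le_cancel_iff) (auto simp: field_simps add_pos_pos)
  finally show ?thesis .
qed

lemma lyapunov_log_decayI:
  assumes \<alpha>: "\<alpha> > 0" and dec: "decays \<alpha> (\<lambda>t. t powr (- 1))"
  shows "lyapunov_log_decay D A Q \<alpha>"
  unfolding lyapunov_log_decay_def
proof
  fix x
  define y where "y = B (\<alpha> / 2) x"
  have "decays (\<alpha> / 2) (\<lambda>t. t powr (- (1 / 2)))"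
    using decays_rescale[OF \<alpha> _ dec, of "\<alpha> / 2"] \<alpha> by simp
  then have lim: "((\<lambda>t. t powr (1 / 2) * norm (T t y)) \<longlongrightarrow> 0) at_top"
    unfolding y_def using \<alpha> by (intro decays_strong) auto
  have "((\<lambda>\<xi>. q \<xi> y / ln (1 / \<xi>)) \<longlongrightarrow> 0) (at_right 0)"
  proof (rule q_negligible[OF lim, where C=1])
    show "filterlim (\<lambda>\<xi>::real. ln (1 / \<xi>)) at_top (at_right 0)"
      by real_asymp
  qed (use log_kernel_le in auto)
  then have "((\<lambda>\<xi>. complex_of_real (q \<xi> y / ln (1 / \<xi>))) \<longlongrightarrow> complex_of_real 0) (at_right 0)"
    by (rule tendsto_of_real)
  moreover have "\<forall>\<^sub>F \<xi> in at_right 0. complex_of_real (q \<xi> y / ln (1 / \<xi>))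
      = cinner y (Q \<xi> y) / complex_of_real (ln (1 / \<xi>))"
    using eventually_at_right_less[of 0] by eventually_elim (simp add: cinner_Q)
  ultimately have "((\<lambda>\<xi>. cinner y (Q \<xi> y) / complex_of_real (ln (1 / \<xi>))) \<longlongrightarrow> complex_of_real 0) (at_right 0)"
    by (rule Lim_transform_eventually)
  then show "((\<lambda>\<xi>. cinner (B (\<alpha> / 2) x) (Q \<xi> (B (\<alpha> / 2) x)) / complex_of_real (ln (1 / \<xi>)))
      \<longlongrightarrow> 0) (at_right 0)"
    by (simp add: y_def)
qed

text \<open>At \<open>\<xi> = 1 / t\<close> the weight times \<open>t\<close> is the square of
  \<open>t powr \<gamma>\<close>, which is therefore the right choice of \<open>w\<close>.\<close>

lemma decays_of_lyapunov_decay: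
  assumes \<alpha>: "\<alpha> > 0" and \<gamma>: "0 < \<gamma>" "\<gamma> < 1 / 2" and L: "lyapunov_decay D A Q \<alpha> \<gamma>"
  shows "decays \<alpha> (\<lambda>t. t powr (- 1))"
proof -
  have "decays (\<alpha> * \<gamma>) (\<lambda>t. 1 / t powr \<gamma>)"
  proof (rule decays_of_q_bound)
    show "t powr \<gamma> \<le> t" if "t \<ge> 2" for t
      using powr_mono[of \<gamma> 1 t] \<gamma> that by simp
    fix x
    let ?y = "B (\<alpha> * \<gamma>) x"
    \<comment> \<open>Of the vanishing limit only eventual boundedness by \<open>1\<close> is kept;
      the threshold may depend on \<open>x\<close>.\<close>
    have "\<forall>\<^sub>F \<xi> in at_right 0. dist (complex_of_real (\<xi> powr (1 - 2 * \<gamma>)) * cinner ?y (Q \<xi> ?y)) 0 < 1"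
      using L by (intro tendstoD) (auto simp: lyapunov_decay_def)
    then have "\<forall>\<^sub>F \<xi> in at_right (0::real). \<xi> powr (1 - 2 * \<gamma>) * q \<xi> ?y \<le> 1"
      using eventually_at_right_less[of 0]
    proof eventually_elim
      case (elim \<xi>)
      then show ?case
        using q_nonneg[of \<xi> ?y] by (simp add: cinner_Q norm_mult)
    qed
    then have "\<forall>\<^sub>F t in at_top. (inverse t) powr (1 - 2 * \<gamma>) * q (inverse t) ?y \<le> 1"
      by (simp add: eventually_at_right_to_top)
    then show "\<forall>\<^sub>F t in at_top. (t powr \<gamma>)\<^sup>2 * q (1 / t) ?y \<le> t"
      using eventually_gt_at_top[of 0]
    proof eventually_elim
      case (elim t)
      have eq: "(inverse t) powr (1 - 2 * \<gamma>) * t = (t powr \<gamma>)\<^sup>2"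
      proof -
        have "(inverse t) powr (1 - 2 * \<gamma>) * t = t powr (- (1 - 2 * \<gamma>)) * t powr 1"
          using elim(2) by (simp add: inverse_powr del: minus_diff_eq flip: powr_minus)
        also have "\<dots> = t powr (\<gamma> + \<gamma>)"
          by (subst powr_add[symmetric]) simp
        finally show ?thesis
          by (simp only: powr_add power2_eq_square)
      qed
      have "(t powr \<gamma>)\<^sup>2 * q (1 / t) ?y = (inverse t) powr (1 - 2 * \<gamma>) * q (inverse t) ?y * t"
        unfolding eq[symmetric] inverse_eq_divide by (simp only: ac_simps)
      also have "\<dots> \<le> 1 * t"
        using elim by (intro mult_right_mono) auto
      finally show ?case by simp
    qed
  qed (use \<alpha> \<gamma> in auto)
  then have "decays (\<alpha> * \<gamma>) (\<lambda>t. t powr (- \<gamma>))"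
    by (simp add: powr_minus_divide)
  \<comment> \<open>The rate \<open>\<gamma>\<close> for exponent \<open>\<alpha> * \<gamma>\<close>
    scales to rate \<open>1\<close> for \<open>\<alpha>\<close>.\<close>
  from decays_rescale[OF _ \<alpha> this] show ?thesis
    using \<alpha> \<gamma> by simp
qed

text \<open>With a logarithm in the rate, \<open>decays_rescale\<close> does not apply; since the
  exponent is exactly \<open>\<alpha> / 2\<close>, composing the estimate with itself reaches
  \<open>\<alpha>\<close>.\<close>

lemma decays_of_lyapunov_log_decay:
  assumes \<alpha>: "\<alpha> > 0" and L: "lyapunov_log_decay D A Q \<alpha>"
  shows "decays \<alpha> (\<lambda>t. ln t / t)"
proof -
  \<comment> \<open>The absolute value keeps \<open>w\<close> nonnegative also for
    \<open>t < 1\<close>, as \<open>decays_add\<close> asks for a sign at every argument.\<close>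
  define w :: "real \<Rightarrow> real" where "w t = sqrt \<bar>t / ln t\<bar>" for t
  have ln2: "ln t \<ge> 1 / 2" if "t \<ge> 2" for t :: real
    using ln2_ge_two_thirds ln_mono[of 2 t] that by linarith
  have "decays (\<alpha> / 2) (\<lambda>t. 1 / w t)"
  proof (rule decays_of_q_bound)
    fix t :: real assume t: "t \<ge> 2"
    show "0 < w t"
      using ln2[OF t] t by (simp add: w_def)
    \<comment> \<open>The square of \<open>w t\<close> is at most \<open>2 * t\<close>, hence at
      most the square of \<open>t\<close> once \<open>t \<ge> 2\<close>: this is the cap by the
      identity.\<close>
    have "\<bar>t / ln t\<bar> \<le> t / (1 / 2)"
      using ln2[OF t] t by (simp add: divide_left_mono abs_of_nonneg del: divide_divide_eq_right)
    also have "\<dots> \<le> t\<^sup>2"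
      using t by (simp add: power2_eq_square)
    finally show "w t \<le> t"
      using t by (simp add: w_def real_sqrt_le_iff real_le_lsqrt)
  next
    fix x
    let ?y = "B (\<alpha> / 2) x"
    have "\<forall>\<^sub>F \<xi> in at_right 0. dist (cinner ?y (Q \<xi> ?y) / complex_of_real (ln (1 / \<xi>))) 0 < 1"
      using L by (intro tendstoD) (auto simp: lyapunov_log_decay_def)
    then have "\<forall>\<^sub>F \<xi> in at_right (0::real). q \<xi> ?y / \<bar>ln (1 / \<xi>)\<bar> \<le> 1"
      using eventually_at_right_less[of 0]
    proof eventually_elim
      case (elim \<xi>)
      then show ?case
        using q_nonneg[of \<xi> ?y] by (simp add: cinner_Q norm_divide)
    qed
    then have "\<forall>\<^sub>F t in at_top. q (inverse t) ?y / \<bar>ln (1 / inverse t)\<bar> \<le> 1"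
      by (simp only: eventually_at_right_to_top)
    then show "\<forall>\<^sub>F t in at_top. (w t)\<^sup>2 * q (1 / t) ?y \<le> t"
      using eventually_ge_at_top[of 2]
    proof eventually_elim
      case (elim t)
      have "ln t > 0" using ln2[OF elim(2)] by linarith
      then have "q (1 / t) ?y \<le> ln t"
        using elim by (simp add: inverse_eq_divide)
      then have "t / ln t * q (1 / t) ?y \<le> t / ln t * ln t"
        using \<open>ln t > 0\<close> elim by (intro mult_left_mono) auto
      then show ?case
        using \<open>ln t > 0\<close> elim by (simp add: w_def)
    qed
  qed (use \<alpha> in auto)
  moreover have "1 / w t \<ge> 0" for t
    by (simp add: w_def)
  ultimately have "decays (\<alpha> / 2 + \<alpha> / 2) (\<lambda>t. 1 / w (t / 2) * (1 / w (t / 2)))"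
    using \<alpha> by (intro decays_add) auto
  then have "decays (\<alpha> / 2 + \<alpha> / 2) (\<lambda>t. ln t / t)"
  \<comment> \<open>\<open>t \<ge> 4\<close> puts \<open>t / 2\<close> into the range
    \<open>\<ge> 2\<close> where the logarithm is bounded below; the factor \<open>2\<close> undoes
    the halving in the denominator.\<close>
  proof (rule decays_mono[where C=2 and ?t1.0=4])
    fix t :: real assume t: "t \<ge> 4"
    have ln: "ln (t / 2) > 0"
      using ln2[of "t / 2"] t by simp
    have "1 / w (t / 2) * (1 / w (t / 2)) = 1 / (w (t / 2))\<^sup>2"
      by (simp add: power2_eq_square)
    also have "\<dots> = ln (t / 2) / (t / 2)"
      using ln t by (simp add: w_def)
    also have "\<dots> = 2 * (ln (t / 2) / t)"
      by simp
    also have "\<dots> \<le> 2 * (ln t / t)"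
      using t by (intro mult_left_mono divide_right_mono) auto
    finally show "1 / w (t / 2) * (1 / w (t / 2)) \<le> 2 * (ln t / t)" .
  qed auto
  then show ?thesis
    by simp
qed

end

theorem lemma3p3:
  fixes T :: "real \<Rightarrow> 'a::chilbert_space \<Rightarrow> 'a"
    and D :: "'a set" and A :: "'a \<Rightarrow> 'a"
    and Q :: "real \<Rightarrow> 'a \<Rightarrow> 'a"
    and \<alpha> :: real
  assumes "C0_semigroup T" and "uniformly_bounded T"
    and "is_generator T D A"
    and "\<And>\<eta>::real. \<i> * complex_of_real \<eta> \<in> resolvent_set D A"
    and "\<And>\<xi>. \<xi> > 0 \<Longrightarrow> selfadjoint (Q \<xi>) \<and> lyapunov_solution D A \<xi> (Q \<xi>)"
    and "\<alpha> > 0"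
  shows
    "(((\<lambda>t. onorm (T t \<circ> neg_power D A \<alpha>)) \<in> O[at_top](\<lambda>t. 1 / t)) \<longleftrightarrow>
        (\<exists>\<gamma>\<in>{0<..<1/2}. lyapunov_decay D A Q \<alpha> \<gamma>)) \<and>
     (((\<lambda>t. onorm (T t \<circ> neg_power D A \<alpha>)) \<in> O[at_top](\<lambda>t. 1 / t)) \<longleftrightarrow>
        (\<forall>\<gamma>\<in>{0<..<1/2}. lyapunov_decay D A Q \<alpha> \<gamma>)) \<and>
     ((\<lambda>t. onorm (T t \<circ> neg_power D A \<alpha>)) \<in> O[at_top](\<lambda>t. 1 / t) \<longrightarrow>
        lyapunov_log_decay D A Q \<alpha>) \<and>
     (lyapunov_log_decay D A Q \<alpha> \<longrightarrow>
        (\<lambda>t. onorm (T t \<circ> neg_power D A \<alpha>)) \<in> O[at_top](\<lambda>t. ln t / t))"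
proof -
  from assms(2) obtain M where M: "\<And>t. t \<ge> 0 \<Longrightarrow> onorm (T t) \<le> M"
    unfolding uniformly_bounded_def bdd_above_def by auto
  \<comment> \<open>The maximum with \<open>1\<close> secures the normalisation
    \<open>K \<ge> 1\<close>.\<close>
  have "norm (T t x) \<le> max 1 M * norm x" if "t \<ge> 0" for t x
  proof -
    have "norm (T t x) \<le> onorm (T t) * norm x"
      using assms(1) that by (intro onorm) (auto simp: C0_semigroup_def bounded_clinear_def)
    also have "\<dots> \<le> max 1 M * norm x"
      using M[OF that] by (intro mult_right_mono) auto
    finally show ?thesis .
  qed
  moreover have "0 \<in> resolvent_set D A"
    using assms(4)[of 0] by simp
  ultimately interpret lyapunov_semigroup T D A "max 1 M" Q
    using assms by unfold_locales auto
  have O_eq: "(\<lambda>t. onorm (T t \<circ> neg_power D A \<alpha>)) \<in> O[at_top](\<lambda>t. 1 / t)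
      \<longleftrightarrow> decays \<alpha> (\<lambda>t. t powr (- 1))"
  proof -
    have "decays \<alpha> (\<lambda>t. 1 / t) \<longleftrightarrow> decays \<alpha> (\<lambda>t. t powr (- 1))"
      by (rule iffI; erule decays_mono[where C=1 and ?t1.0=1]) (auto simp: powr_minus_divide)
    then show ?thesis
      using bigo_iff_decays[OF assms(6), of "\<lambda>t. 1 / t"] by simp
  qed
  have O_log: "(\<lambda>t. onorm (T t \<circ> neg_power D A \<alpha>)) \<in> O[at_top](\<lambda>t. ln t / t)
      \<longleftrightarrow> decays \<alpha> (\<lambda>t. ln t / t)"
    by (rule bigo_iff_decays[OF assms(6)]) simp
  have all: "decays \<alpha> (\<lambda>t. t powr (- 1)) \<Longrightarrow> \<forall>\<gamma>\<in>{0<..<1/2}. lyapunov_decay D A Q \<alpha> \<gamma>"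
    using lyapunov_decayI[OF assms(6)] by simp
  have ex: "\<exists>\<gamma>\<in>{0<..<1/2}. lyapunov_decay D A Q \<alpha> \<gamma> \<Longrightarrow> decays \<alpha> (\<lambda>t. t powr (- 1))"
    using decays_of_lyapunov_decay[OF assms(6)] by auto
  \<comment> \<open>A point of the interval, so that the condition for all \<gamma> implies it for
    some \<gamma>.\<close>
  have "(1 / 4 :: real) \<in> {0<..<1/2}"
    by simp
  then show ?thesis
    unfolding O_eq O_log
    using all ex lyapunov_log_decayI[OF assms(6)] decays_of_lyapunov_log_decay[OF assms(6)]
    by blast
qed

end
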